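(* Let $k$ be an algebraically closed field of characteristic zero, $\mathfrak{g}$ a finite-dimensional simple Lie algebra over $k$ with a fixed Cartan subalgebra $\mathfrak{h}$, $S$ a commutative, associative, unital $k$-algebra of finite type, and $\mathcal{L}=\mathfrak{g}\otimes_k S$. Let $V$ be a simple weight module for $\mathcal{L}$, with module action given by $\phi:\mathcal{L}\rightarrow\operatorname{End}V$. Suppose there exist pairwise distinct maximal ideals $M_1,\ldots,M_r$ of $S$ and a Lie algebra homomorphism $\psi:\mathfrak{g}^{\oplus r}\rightarrow\operatorname{End}V$ such that $\phi=\psi\circ\mathrm{ev}_{\underline{M}}$. Then $V$ is isomorphic to an evaluation weight module of $\mathcal{L}$.
   Context: The Lie bracket on $\mathcal{L}=\mathfrak{g}\otimes S$ is $[x\otimes r,y\otimes s]=[x,y]\otimes rs$. An $\mathcal{L}$-module $V$ is a weight module if $V=\bigoplus_{\lambda\in\mathfrak{h}^*}V_\lambda$ with each weight space $V_\lambda=\{v\in V\mid (h\otimes 1)v=\lambda(h)v\text{ for all }h\in\mathfrak{h}\}$ finite dimensional. Weight modules for $\mathfrak{g}$ are the case $S=k$. For $s\in S$ and a maximal ideal $M$ of $S$, $s(M)\in k$ is the residue of $s$ in $S/M\cong k$. For $\underline{M}=(M_1,\ldots,M_r)$, the evaluation map is $\mathrm{ev}_{\underline{M}}:\mathcal{L}\to\mathfrak{g}^{\oplus r}$, $x\otimes s\mapsto(s(M_1)x,\ldots,s(M_r)x)$. Given simple $\mathfrak{g}$-modules $\underline{W}=(W_1,\ldots,W_r)$, $V(\underline{M},\underline{W})$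 is the vector space $W_1\otimes\cdots\otimes W_r$ with $\mathcal{L}$-action $(x\otimes s).(w_1\otimes\cdots\otimes w_r)=\sum_{i=1}^r s(M_i)\,w_1\otimes\cdots\otimes xw_i\otimes\cdots\otimes w_r$. It is called an evaluation weight module if $M_1,\ldots,M_r$ are distinct and each (simple) $W_i$ is a weight module for $\mathfrak{g}$. *)

theory Defs
  imports "HOL-Library.Function_Algebras" "HOL-Algebra.Algebraic_Closure_Type"
begin

text \<open>
  A vector space is a subspace \<^term>\<open>U\<close> of a type that carries a scalar multiplication \<^term>\<open>s\<close> in the
  sense of \<^locale>\<open>vector_space\<close>. Passing to a subspace is no restriction on the space, and it
  lets a statement quantify over vector spaces and over tensor products of a varying number of
  factors. Function types are vector spaces pointwise.
\<close>

abbreviation subspace_of :: "('k::field \<Rightarrow> 'a::ab_group_add \<Rightarrow> 'a) \<Rightarrow> 'a set \<Rightarrow> bool" where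
  "subspace_of s \<equiv> Modules.module.subspace s"

abbreviation span_of :: "('k::field \<Rightarrow> 'a::ab_group_add \<Rightarrow> 'a) \<Rightarrow> 'a set \<Rightarrow> 'a set" where
  "span_of s \<equiv> Modules.module.span s"

definition fin_dim :: "('k::field \<Rightarrow> 'a::ab_group_add \<Rightarrow> 'a) \<Rightarrow> 'a set \<Rightarrow> bool" where
  "fin_dim s U \<longleftrightarrow> (\<exists>B. finite B \<and> U = span_of s B)"

definition linear_on :: "('k::field \<Rightarrow> 'a::ab_group_add \<Rightarrow> 'a) \<Rightarrow> 'a set \<Rightarrow>
    ('k \<Rightarrow> 'b::ab_group_add \<Rightarrow> 'b) \<Rightarrow> 'b set \<Rightarrow> ('a \<Rightarrow> 'b) \<Rightarrow> bool" where
  "linear_on s1 U s2 U' f \<longleftrightarrow> f \<in> U \<rightarrow> U' \<and> (\<forall>x\<in>U. \<forall>y\<in>U. f (x + y) = f x + f y) \<and>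
     (\<forall>c. \<forall>x\<in>U. f (s1 c x) = s2 c (f x))"

definition pointwise :: "('k \<Rightarrow> 'a \<Rightarrow> 'a) \<Rightarrow> 'k \<Rightarrow> ('i \<Rightarrow> 'a) \<Rightarrow> 'i \<Rightarrow> 'a" where
  "pointwise s c f = (\<lambda>i. s c (f i))"

definition internal_direct_sum :: "'a::ab_group_add set \<Rightarrow> 'i set \<Rightarrow> ('i \<Rightarrow> 'a set) \<Rightarrow> bool" where
  "internal_direct_sum V I U \<longleftrightarrow> (\<forall>i\<in>I. U i \<subseteq> V) \<and>
     (\<forall>v\<in>V. \<exists>!f. finite {i. f i \<noteq> 0} \<and> (\<forall>i\<in>I. f i \<in> U i) \<and> (\<forall>i. i \<notin> I \<longrightarrow> f i = 0) \<and>
        v = (\<Sum>i | f i \<noteq> 0. f i))"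


section \<open>Tensor products\<close>

text \<open>
  Over a field, \<open>A \<otimes> B\<close> embeds into the dual of the space of bilinear forms on \<open>A \<times> B\<close>: the
  elementary tensor \<open>x \<otimes> y\<close> is evaluation of bilinear forms at \<open>(x, y)\<close>, and \<open>A \<otimes> B\<close> is the span
  of these. Every linear map out of \<open>A \<otimes> B\<close> below is given by its values on elementary tensors
  through \<open>tensor_lift\<close>; the universal property that makes this legitimate is proved in
  \<open>tensor_universal\<close>. Tensor products of \<open>W 0, \<dots>, W (r - 1)\<close> are handled in the same way, see
  \<open>mtensor_universal\<close>; an elementary tensor is indexed by an element of \<^term>\<open>Pi\<^sub>E {..<r} W\<close>.
\<close>

definition bilinear_map :: "('k::field \<Rightarrow> 'a::ab_group_add \<Rightarrow> 'a) \<Rightarrow> ('k \<Rightarrow> 'b::ab_group_add \<Rightarrow> 'b) \<Rightarrow>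
    ('k \<Rightarrow> 'c::ab_group_add \<Rightarrow> 'c) \<Rightarrow> ('a \<Rightarrow> 'b \<Rightarrow> 'c) \<Rightarrow> bool" where
  "bilinear_map sA sB sC b \<longleftrightarrow> (\<forall>y. Vector_Spaces.linear sA sC (\<lambda>x. b x y)) \<and>
     (\<forall>x. Vector_Spaces.linear sB sC (\<lambda>y. b x y))"

definition tens :: "('k::field \<Rightarrow> 'a::ab_group_add \<Rightarrow> 'a) \<Rightarrow> ('k \<Rightarrow> 'b::ab_group_add \<Rightarrow> 'b) \<Rightarrow>
    'a \<Rightarrow> 'b \<Rightarrow> ('a \<Rightarrow> 'b \<Rightarrow> 'k) \<Rightarrow> 'k" where
  "tens sA sB x y = (\<lambda>\<beta>. if bilinear_map sA sB (*) \<beta> then \<beta> x y else 0)"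

abbreviation tscale :: "'k::field \<Rightarrow> ('i \<Rightarrow> 'k) \<Rightarrow> 'i \<Rightarrow> 'k" where
  "tscale \<equiv> pointwise (*)"

definition tensor :: "('k::field \<Rightarrow> 'a::ab_group_add \<Rightarrow> 'a) \<Rightarrow> ('k \<Rightarrow> 'b::ab_group_add \<Rightarrow> 'b) \<Rightarrow>
    (('a \<Rightarrow> 'b \<Rightarrow> 'k) \<Rightarrow> 'k) set" where
  "tensor sA sB = span_of tscale {tens sA sB x y | x y. True}"

text \<open>For \<open>F\<close> in \<^term>\<open>tensor sA sB\<close> and bilinear \<open>b\<close>: the value at \<open>F\<close> of the linear map \<open>x \<otimes> y \<mapsto> b x y\<close>.\<close>

definition tensor_lift :: "('k::field \<Rightarrow> 'a::ab_group_add \<Rightarrow> 'a) \<Rightarrow> ('k \<Rightarrow> 'b::ab_group_add \<Rightarrow> 'b) \<Rightarrow>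
    ('k \<Rightarrow> 'c::ab_group_add \<Rightarrow> 'c) \<Rightarrow> ('a \<Rightarrow> 'b \<Rightarrow> 'c) \<Rightarrow> (('a \<Rightarrow> 'b \<Rightarrow> 'k) \<Rightarrow> 'k) \<Rightarrow> 'c" where
  "tensor_lift sA sB sC b F =
     (THE z. \<exists>T. linear_on tscale (tensor sA sB) sC UNIV T \<and>
        (\<forall>x y. T (tens sA sB x y) = b x y) \<and> z = T F)"

definition multilinear_map :: "('k::field \<Rightarrow> 'w::ab_group_add \<Rightarrow> 'w) \<Rightarrow> nat \<Rightarrow> (nat \<Rightarrow> 'w set) \<Rightarrow>
    ('k \<Rightarrow> 'c::ab_group_add \<Rightarrow> 'c) \<Rightarrow> ((nat \<Rightarrow> 'w) \<Rightarrow> 'c) \<Rightarrow> bool" where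
  "multilinear_map sW r W sC b \<longleftrightarrow>
     (\<forall>i<r. \<forall>w \<in> Pi\<^sub>E {..<r} W. linear_on sW (W i) sC UNIV (\<lambda>u. b (w(i := u))))"

definition mtens :: "('k::field \<Rightarrow> 'w::ab_group_add \<Rightarrow> 'w) \<Rightarrow> nat \<Rightarrow> (nat \<Rightarrow> 'w set) \<Rightarrow> (nat \<Rightarrow> 'w) \<Rightarrow>
    ((nat \<Rightarrow> 'w) \<Rightarrow> 'k) \<Rightarrow> 'k" where
  "mtens sW r W w = (\<lambda>\<beta>. if multilinear_map sW r W (*) \<beta> then \<beta> w else 0)"

definition mtensor :: "('k::field \<Rightarrow> 'w::ab_group_add \<Rightarrow> 'w) \<Rightarrow> nat \<Rightarrow> (nat \<Rightarrow> 'w set) \<Rightarrow>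
    (((nat \<Rightarrow> 'w) \<Rightarrow> 'k) \<Rightarrow> 'k) set" where
  "mtensor sW r W = span_of tscale (mtens sW r W ` Pi\<^sub>E {..<r} W)"

definition mtensor_lift :: "('k::field \<Rightarrow> 'w::ab_group_add \<Rightarrow> 'w) \<Rightarrow> nat \<Rightarrow> (nat \<Rightarrow> 'w set) \<Rightarrow>
    ('k \<Rightarrow> 'c::ab_group_add \<Rightarrow> 'c) \<Rightarrow> ((nat \<Rightarrow> 'w) \<Rightarrow> 'c) \<Rightarrow> (((nat \<Rightarrow> 'w) \<Rightarrow> 'k) \<Rightarrow> 'k) \<Rightarrow> 'c" where
  "mtensor_lift sW r W sC b F =
     (THE z. \<exists>T. linear_on tscale (mtensor sW r W) sC UNIV T \<and>
        (\<forall>w \<in> Pi\<^sub>E {..<r} W. T (mtens sW r W w) = b w) \<and> z = T F)"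


section \<open>Lie algebras and their modules\<close>

locale lie_algebra = vector_space scale
  for scale :: "'k::field \<Rightarrow> 'a::ab_group_add \<Rightarrow> 'a" +
  fixes A :: "'a set" and br :: "'a \<Rightarrow> 'a \<Rightarrow> 'a"
  assumes subspace_carrier: "subspace_of scale A"
    and linear_left: "y \<in> A \<Longrightarrow> linear_on scale A scale A (\<lambda>x. br x y)"
    and linear_right: "x \<in> A \<Longrightarrow> linear_on scale A scale A (\<lambda>y. br x y)"
    and alternating: "x \<in> A \<Longrightarrow> br x x = 0"
    and jacobi: "\<lbrakk>x \<in> A; y \<in> A; z \<in> A\<rbrakk> \<Longrightarrow> br x (br y z) + br y (br z x) + br z (br x y) = 0"

definition lie_ideal :: "('k::field \<Rightarrow> 'a::ab_group_add \<Rightarrow> 'a) \<Rightarrow> 'a set \<Rightarrow> ('a \<Rightarrow> 'a \<Rightarrow> 'a) \<Rightarrow> 'a set \<Rightarrow> bool" where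
  "lie_ideal s A br J \<longleftrightarrow> subspace_of s J \<and> J \<subseteq> A \<and> (\<forall>x\<in>A. \<forall>y\<in>J. br x y \<in> J)"

locale simple_lie_algebra = lie_algebra +
  assumes nonabelian: "\<exists>x\<in>A. \<exists>y\<in>A. br x y \<noteq> 0"
    and ideals_trivial: "lie_ideal scale A br J \<Longrightarrow> J = {0} \<or> J = A"

definition lie_subalgebra :: "('k::field \<Rightarrow> 'a::ab_group_add \<Rightarrow> 'a) \<Rightarrow> 'a set \<Rightarrow> ('a \<Rightarrow> 'a \<Rightarrow> 'a) \<Rightarrow> 'a set \<Rightarrow> bool" where
  "lie_subalgebra s A br H \<longleftrightarrow> subspace_of s H \<and> H \<subseteq> A \<and> (\<forall>x\<in>H. \<forall>y\<in>H. br x y \<in> H)"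

fun lower_central :: "('k::field \<Rightarrow> 'a::ab_group_add \<Rightarrow> 'a) \<Rightarrow> ('a \<Rightarrow> 'a \<Rightarrow> 'a) \<Rightarrow> 'a set \<Rightarrow> nat \<Rightarrow> 'a set" where
  "lower_central s br H 0 = H"
| "lower_central s br H (Suc n) = span_of s {br x y | x y. x \<in> H \<and> y \<in> lower_central s br H n}"

definition cartan_subalgebra :: "('k::field \<Rightarrow> 'a::ab_group_add \<Rightarrow> 'a) \<Rightarrow> 'a set \<Rightarrow> ('a \<Rightarrow> 'a \<Rightarrow> 'a) \<Rightarrow> 'a set \<Rightarrow> bool" where
  "cartan_subalgebra s A br H \<longleftrightarrow> lie_subalgebra s A br H \<and>
     (\<exists>n. lower_central s br H n = {0}) \<and> {x \<in> A. \<forall>y\<in>H. br x y \<in> H} = H"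

text \<open>
  A module for the Lie algebra \<open>A\<close> on \<open>V\<close>; equivalently, \<open>\<rho>\<close> is a homomorphism of Lie algebras from
  \<open>A\<close> to \<open>End V\<close> with the commutator bracket. Values of \<open>\<rho>\<close> outside \<open>A\<close> and \<open>V\<close> are irrelevant.
\<close>

locale lie_module = lie_algebra scale A br + V: vector_space sV
  for scale :: "'k::field \<Rightarrow> 'a::ab_group_add \<Rightarrow> 'a" and A br
    and sV :: "'k \<Rightarrow> 'v::ab_group_add \<Rightarrow> 'v" +
  fixes V :: "'v set" and \<rho> :: "'a \<Rightarrow> 'v \<Rightarrow> 'v"
  assumes subspace_module: "subspace_of sV V"
    and endomorphism: "x \<in> A \<Longrightarrow> linear_on sV V sV V (\<rho> x)"
    and linear_action: "v \<in> V \<Longrightarrow> linear_on scale A sV V (\<lambda>x. \<rho> x v)"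
    and bracket_action: "\<lbrakk>x \<in> A; y \<in> A; v \<in> V\<rbrakk> \<Longrightarrow> \<rho> (br x y) v = \<rho> x (\<rho> y v) - \<rho> y (\<rho> x v)"

locale simple_lie_module = lie_module +
  assumes nonzero: "V \<noteq> {0}"
    and submodules_trivial:
      "\<lbrakk>subspace_of sV U; U \<subseteq> V; \<And>x u. \<lbrakk>x \<in> A; u \<in> U\<rbrakk> \<Longrightarrow> \<rho> x u \<in> U\<rbrakk> \<Longrightarrow> U = {0} \<or> U = V"

definition module_isomorphic :: "'a set \<Rightarrow> ('k::field \<Rightarrow> 'v::ab_group_add \<Rightarrow> 'v) \<Rightarrow> 'v set \<Rightarrow> ('a \<Rightarrow> 'v \<Rightarrow> 'v) \<Rightarrow>
    ('k \<Rightarrow> 'w::ab_group_add \<Rightarrow> 'w) \<Rightarrow> 'w set \<Rightarrow> ('a \<Rightarrow> 'w \<Rightarrow> 'w) \<Rightarrow> bool" where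
  "module_isomorphic A sV V \<rho> sW W \<sigma> \<longleftrightarrow>
     (\<exists>f. linear_on sV V sW W f \<and> bij_betw f V W \<and> (\<forall>x\<in>A. \<forall>v\<in>V. f (\<rho> x v) = \<sigma> x (f v)))"

text \<open>Linear forms on the subspace \<open>H\<close>, extended by zero so that each of them is a single function.\<close>

definition dual_space :: "('k::field \<Rightarrow> 'a::ab_group_add \<Rightarrow> 'a) \<Rightarrow> 'a set \<Rightarrow> ('a \<Rightarrow> 'k) set" where
  "dual_space s H = {\<mu>. linear_on s H (*) UNIV \<mu> \<and> (\<forall>x. x \<notin> H \<longrightarrow> \<mu> x = 0)}"

definition weight_space :: "'a set \<Rightarrow> ('k::field \<Rightarrow> 'v::ab_group_add \<Rightarrow> 'v) \<Rightarrow> 'v set \<Rightarrow> ('a \<Rightarrow> 'v \<Rightarrow> 'v) \<Rightarrow>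
    ('a \<Rightarrow> 'k) \<Rightarrow> 'v set" where
  "weight_space H sV V act \<mu> = {v \<in> V. \<forall>x\<in>H. act x v = sV (\<mu> x) v}"

text \<open>
  \<open>act\<close> is the action of \<open>H\<close>: that of \<open>x\<close> for a module over \<open>\<gg>\<close>, that of \<open>x \<otimes> 1\<close> for a module over
  \<open>\<gg> \<otimes> S\<close>.
\<close>

definition weight_decomposition :: "('k::field \<Rightarrow> 'a::ab_group_add \<Rightarrow> 'a) \<Rightarrow> 'a set \<Rightarrow>
    ('k \<Rightarrow> 'v::ab_group_add \<Rightarrow> 'v) \<Rightarrow> 'v set \<Rightarrow> ('a \<Rightarrow> 'v \<Rightarrow> 'v) \<Rightarrow> bool" where
  "weight_decomposition s H sV V act \<longleftrightarrow>
     internal_direct_sum V (dual_space s H) (weight_space H sV V act) \<and>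
     (\<forall>\<mu> \<in> dual_space s H. fin_dim sV (weight_space H sV V act \<mu>))"

definition direct_power :: "nat \<Rightarrow> (nat \<Rightarrow> 'a::zero) set" where
  "direct_power r = {x. \<forall>i\<ge>r. x i = 0}"

definition power_bracket :: "('a \<Rightarrow> 'a \<Rightarrow> 'a) \<Rightarrow> (nat \<Rightarrow> 'a) \<Rightarrow> (nat \<Rightarrow> 'a) \<Rightarrow> nat \<Rightarrow> 'a" where
  "power_bracket br x y = (\<lambda>i. br (x i) (y i))"


section \<open>The coordinate algebra\<close>

locale comm_algebra = vector_space scale
  for scale :: "'k::field \<Rightarrow> 's::comm_ring_1 \<Rightarrow> 's" +
  assumes scale_mult_left: "scale c x * y = scale c (x * y)"

definition subalgebra :: "('k::field \<Rightarrow> 's::comm_ring_1 \<Rightarrow> 's) \<Rightarrow> 's set \<Rightarrow> bool" where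
  "subalgebra sS B \<longleftrightarrow> subspace_of sS B \<and> 1 \<in> B \<and> (\<forall>x\<in>B. \<forall>y\<in>B. x * y \<in> B)"

locale finite_type_algebra = comm_algebra +
  assumes finite_type: "\<exists>G. finite G \<and> subalgebra scale hull G = UNIV"

abbreviation maximal_ideal :: "'s::comm_ring_1 set \<Rightarrow> bool" where
  "maximal_ideal M \<equiv> maximalideal M (ring_of_type_algebra :: 's ring)"

text \<open>\<open>s(M)\<close>: the scalar whose class in \<open>S/M\<close> is that of \<open>s\<close>. It exists and is unique when \<open>k \<rightarrow> S/M\<close>
  is bijective.\<close>

definition residue :: "('k::field \<Rightarrow> 's::comm_ring_1 \<Rightarrow> 's) \<Rightarrow> 's \<Rightarrow> 's set \<Rightarrow> 'k" where
  "residue sS s M = (THE c. s - sS c 1 \<in> M)"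


section \<open>The Lie algebra \<open>\<gg> \<otimes> S\<close> and evaluation modules\<close>

definition current_bracket :: "('k::field \<Rightarrow> 'g::ab_group_add \<Rightarrow> 'g) \<Rightarrow> ('g \<Rightarrow> 'g \<Rightarrow> 'g) \<Rightarrow>
    ('k \<Rightarrow> 's::comm_ring_1 \<Rightarrow> 's) \<Rightarrow>
    (('g \<Rightarrow> 's \<Rightarrow> 'k) \<Rightarrow> 'k) \<Rightarrow> (('g \<Rightarrow> 's \<Rightarrow> 'k) \<Rightarrow> 'k) \<Rightarrow> ('g \<Rightarrow> 's \<Rightarrow> 'k) \<Rightarrow> 'k" where
  "current_bracket sg br sS F G =
     tensor_lift sg sS tscale (\<lambda>x r.
       tensor_lift sg sS tscale (\<lambda>y s. tens sg sS (br x y) (r * s)) G) F"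

definition evaluation_map :: "('k::field \<Rightarrow> 'g::ab_group_add \<Rightarrow> 'g) \<Rightarrow> ('k \<Rightarrow> 's::comm_ring_1 \<Rightarrow> 's) \<Rightarrow>
    nat \<Rightarrow> (nat \<Rightarrow> 's set) \<Rightarrow> (('g \<Rightarrow> 's \<Rightarrow> 'k) \<Rightarrow> 'k) \<Rightarrow> nat \<Rightarrow> 'g" where
  "evaluation_map sg sS r M F =
     tensor_lift sg sS (pointwise sg) (\<lambda>x s i. if i < r then sg (residue sS s (M i)) x else 0) F"

definition evaluation_action :: "('k::field \<Rightarrow> 'g::ab_group_add \<Rightarrow> 'g) \<Rightarrow> ('k \<Rightarrow> 's::comm_ring_1 \<Rightarrow> 's) \<Rightarrow>
    nat \<Rightarrow> (nat \<Rightarrow> 's set) \<Rightarrow> ('k \<Rightarrow> 'w::ab_group_add \<Rightarrow> 'w) \<Rightarrow> (nat \<Rightarrow> 'w set) \<Rightarrow> (nat \<Rightarrow> 'g \<Rightarrow> 'w \<Rightarrow> 'w) \<Rightarrow>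
    (('g \<Rightarrow> 's \<Rightarrow> 'k) \<Rightarrow> 'k) \<Rightarrow> (((nat \<Rightarrow> 'w) \<Rightarrow> 'k) \<Rightarrow> 'k) \<Rightarrow> ((nat \<Rightarrow> 'w) \<Rightarrow> 'k) \<Rightarrow> 'k" where
  "evaluation_action sg sS r M sW W \<rho> F t =
     tensor_lift sg sS tscale (\<lambda>x s.
       mtensor_lift sW r W tscale (\<lambda>w.
         \<Sum>i<r. tscale (residue sS s (M i)) (mtens sW r W (w(i := \<rho> i x (w i))))) t) F"

text \<open>The data \<open>(M\<^sub>1, \<dots>, M\<^sub>r)\<close>, \<open>(W\<^sub>1, \<dots>, W\<^sub>r)\<close> of an evaluation weight module, indexed from zero;
  the module is \<^term>\<open>mtensor sW r W\<close> with \<^const>\<open>evaluation_action\<close>.\<close>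

definition evaluation_weight_data :: "('k::field \<Rightarrow> 'g::ab_group_add \<Rightarrow> 'g) \<Rightarrow> ('g \<Rightarrow> 'g \<Rightarrow> 'g) \<Rightarrow> 'g set \<Rightarrow>
    nat \<Rightarrow> (nat \<Rightarrow> 's::comm_ring_1 set) \<Rightarrow>
    ('k \<Rightarrow> 'w::ab_group_add \<Rightarrow> 'w) \<Rightarrow> (nat \<Rightarrow> 'w set) \<Rightarrow> (nat \<Rightarrow> 'g \<Rightarrow> 'w \<Rightarrow> 'w) \<Rightarrow> bool" where
  "evaluation_weight_data sg br H r M sW W \<rho> \<longleftrightarrow>
     0 < r \<and> inj_on M {..<r} \<and> (\<forall>i<r. maximal_ideal (M i)) \<and>
     (\<forall>i<r. simple_lie_module sg UNIV br sW (W i) (\<rho> i) \<and> weight_decomposition sg H sW (W i) (\<rho> i))"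


section \<open>The definitions have the expected universal properties and values\<close>

lemma linear_iff_additive:
  "Vector_Spaces.linear s1 s2 f \<longleftrightarrow> vector_space s1 \<and> vector_space s2 \<and>
     (\<forall>x y. f (x + y) = f x + f y) \<and> (\<forall>c x. f (s1 c x) = s2 c (f x))"
  unfolding linear_iff_module_hom module_hom_def module_hom_axioms_def module_iff_vector_space by blast

lemma vector_space_mult: "vector_space ((*) :: 'k::field \<Rightarrow> 'k \<Rightarrow> 'k)"
  by unfold_locales (simp_all add: algebra_simps)

lemma vector_space_pointwise:
  assumes "vector_space s" shows "vector_space (pointwise s)"
proof -
  interpret vector_space s by fact
  show ?thesis
    by unfold_locales (simp_all add: pointwise_def fun_eq_iff plus_fun_def algebra_simps)
qed

lemma vector_space_tscale: "vector_space (tscale :: 'k::field \<Rightarrow> ('i \<Rightarrow> 'k) \<Rightarrow> 'i \<Rightarrow> 'k)"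
  by (intro vector_space_pointwise vector_space_mult)

lemma forms_separate:
  fixes sC :: "'k::field \<Rightarrow> 'c::ab_group_add \<Rightarrow> 'c"
  assumes "vector_space sC" and "\<And>f. Vector_Spaces.linear sC (*) f \<Longrightarrow> f y = f z"
  shows "y = z"
proof (rule ccontr)
  assume ne: "y \<noteq> z"
  interpret C: vector_space sC by fact
  interpret K: vector_space "(*) :: 'k \<Rightarrow> 'k \<Rightarrow> 'k" by (rule vector_space_mult)
  interpret P: vector_space_pair sC "(*) :: 'k \<Rightarrow> 'k \<Rightarrow> 'k" ..
  have ind: "C.independent {y - z}" using ne by simp
  let ?f = "P.construct {y - z} (\<lambda>_. 1)"
  have l: "Vector_Spaces.linear sC (*) ?f" by (rule P.linear_construct[OF ind])
  then interpret F: Vector_Spaces.linear sC "(*)" ?f .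
  have "?f (y - z) = 1" by (simp add: P.construct_basis[OF ind])
  moreover have "?f (y - z) = 0" using assms(2)[OF l] by (simp add: F.diff)
  ultimately show False by simp
qed

lemma linear_on_if_linear:
  assumes "Vector_Spaces.linear s1 s2 T" shows "linear_on s1 U s2 UNIV T"
proof -
  interpret Vector_Spaces.linear s1 s2 T by fact
  show ?thesis by (simp add: linear_on_def add scale)
qed

text \<open>The common core of both universal properties: it suffices that every linear form on the target,
  composed with \<open>b\<close>, is evaluation of the family \<open>e\<close> at some point.\<close>

lemma lift_exists:
  fixes sC :: "'k::field \<Rightarrow> 'c::ab_group_add \<Rightarrow> 'c" and e :: "'x \<Rightarrow> 'd \<Rightarrow> 'k"
  assumes C: "vector_space sC"
    and b: "\<And>f. Vector_Spaces.linear sC (*) f \<Longrightarrow> \<exists>\<beta>. \<forall>x\<in>Z. e x \<beta> = f (b x)"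
  shows "\<exists>T. linear_on tscale (span_of tscale (e ` Z)) sC UNIV T \<and> (\<forall>x\<in>Z. T (e x) = b x)"
proof -
  interpret C: vector_space sC by fact
  interpret K: vector_space "(*) :: 'k \<Rightarrow> 'k \<Rightarrow> 'k" by (rule vector_space_mult)
  interpret E: vector_space "tscale :: 'k \<Rightarrow> ('d \<Rightarrow> 'k) \<Rightarrow> _" by (rule vector_space_tscale)
  interpret EC: vector_space_pair "tscale :: 'k \<Rightarrow> ('d \<Rightarrow> 'k) \<Rightarrow> _" sC ..
  interpret EK: vector_space_pair "tscale :: 'k \<Rightarrow> ('d \<Rightarrow> 'k) \<Rightarrow> _" "(*) :: 'k \<Rightarrow> 'k \<Rightarrow> 'k" ..
  obtain B where B: "B \<subseteq> e ` Z" "E.independent B" "e ` Z \<subseteq> E.span B"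
    using E.maximal_independent_subset[of "e ` Z"] by blast
  define g where "g = inv_into Z e"
  have g: "g u \<in> Z" "e (g u) = u" if "u \<in> B" for u
    using that B(1) unfolding g_def by (auto intro: inv_into_into f_inv_into_f)
  define T where "T = EC.construct B (\<lambda>u. b (g u))"
  have T: "Vector_Spaces.linear tscale sC T" unfolding T_def by (rule EC.linear_construct[OF B(2)])
  have "T (e x) = b x" if x: "x \<in> Z" for x
  proof (rule forms_separate[OF C])
    fix f assume f: "Vector_Spaces.linear sC (*) f"
    then obtain \<beta> where \<beta>: "\<And>x. x \<in> Z \<Longrightarrow> e x \<beta> = f (b x)" using b by blast
    have l1: "Vector_Spaces.linear tscale (*) (f \<circ> T)" by (rule Vector_Spaces.linear_compose[OF T f])
    have l2: "Vector_Spaces.linear tscale (*) (\<lambda>u. u \<beta>)"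
      unfolding linear_iff_additive using vector_space_mult vector_space_tscale by (simp add: pointwise_def)
    have "(f \<circ> T) (e x) = (\<lambda>u. u \<beta>) (e x)"
    proof (rule EK.linear_eq_on[OF l1 l2])
      show "e x \<in> E.span B" using B(3) x by blast
      fix u assume u: "u \<in> B"
      have "(f \<circ> T) u = f (b (g u))" unfolding T_def by (simp add: EC.construct_basis[OF B(2) u])
      also have "\<dots> = e (g u) \<beta>" using \<beta> g(1)[OF u] by simp
      finally show "(f \<circ> T) u = u \<beta>" using g(2)[OF u] by simp
    qed
    then show "f (T (e x)) = f (b x)" using \<beta> x by simp
  qed
  with linear_on_if_linear[OF T] show ?thesis by blast
qed

lemma linear_on_eq_span:
  assumes "vector_space s1" "linear_on s1 (span_of s1 E) s2 U S" "linear_on s1 (span_of s1 E) s2 U T"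
    "\<And>u. u \<in> E \<Longrightarrow> S u = T u" "x \<in> span_of s1 E"
    "vector_space s2"
  shows "S x = T x"
proof -
  interpret A: vector_space s1 by fact
  interpret B: vector_space s2 by fact
  have "x \<in> A.span E \<and> S x = T x" using assms(5)
  proof (induction rule: A.span_induct_alt)
    case base
    have "S (s1 0 0) = s2 0 (S 0)" "T (s1 0 0) = s2 0 (T 0)"
      using assms(2,3) A.span_zero unfolding linear_on_def by blast+
    then show ?case by (simp add: A.span_zero)
  next
    case (step c u y)
    have "s1 c u \<in> A.span E" "u \<in> A.span E" using step by (auto intro: A.span_scale A.span_base)
    then show ?case using step assms(2,3,4) unfolding linear_on_def by (auto intro: A.span_add)
  qed
  then show ?thesis by blast
qed

theorem tensor_universal:
  fixes sA :: "'k::field \<Rightarrow> 'a::ab_group_add \<Rightarrow> 'a" and sB :: "'k \<Rightarrow> 'b::ab_group_add \<Rightarrow> 'b"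
  assumes C: "vector_space sC" and b: "bilinear_map sA sB sC b"
  shows "linear_on tscale (tensor sA sB) sC UNIV (tensor_lift sA sB sC b)"
    and "tensor_lift sA sB sC b (tens sA sB x y) = b x y"
    and "\<lbrakk>linear_on tscale (tensor sA sB) sC UNIV T; \<And>x y. T (tens sA sB x y) = b x y;
      F \<in> tensor sA sB\<rbrakk> \<Longrightarrow> tensor_lift sA sB sC b F = T F"
proof -
  let ?e = "\<lambda>(x, y). tens sA sB x y"
  have gen: "tensor sA sB = span_of tscale (range ?e)"
    unfolding tensor_def by (rule arg_cong[where f="span_of tscale"]) auto
  have "\<exists>\<beta>. \<forall>z\<in>UNIV. ?e z \<beta> = f (case z of (x, y) \<Rightarrow> b x y)" if f: "Vector_Spaces.linear sC (*) f" for f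
  proof -
    have "bilinear_map sA sB (*) (\<lambda>x y. f (b x y))"
      using b f unfolding bilinear_map_def linear_iff_additive by simp
    then show ?thesis by (intro exI[of _ "\<lambda>x y. f (b x y)"]) (simp add: tens_def)
  qed
  from lift_exists[where e="?e" and b="\<lambda>(x, y). b x y" and Z=UNIV, OF C this]
  obtain T0 where T0: "linear_on tscale (tensor sA sB) sC UNIV T0"
    "\<And>x y. T0 (tens sA sB x y) = b x y" by (auto simp: gen)
  have uniq: "tensor_lift sA sB sC b F = T F"
    if T: "linear_on tscale (tensor sA sB) sC UNIV T" "\<And>x y. T (tens sA sB x y) = b x y"
      and F: "F \<in> tensor sA sB" for T F
    unfolding tensor_lift_def
  proof (rule the_equality)
    show "\<exists>T'. linear_on tscale (tensor sA sB) sC UNIV T' \<and> (\<forall>x y. T' (tens sA sB x y) = b x y) \<and> T F = T' F"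
      using T by blast
    fix z assume "\<exists>T'. linear_on tscale (tensor sA sB) sC UNIV T' \<and> (\<forall>x y. T' (tens sA sB x y) = b x y) \<and> z = T' F"
    then obtain T' where T': "linear_on tscale (tensor sA sB) sC UNIV T'" "\<And>x y. T' (tens sA sB x y) = b x y" "z = T' F"
      by blast
    have "T' F = T F"
      by (rule linear_on_eq_span[OF vector_space_tscale T'(1)[unfolded gen] T(1)[unfolded gen] _ F[unfolded gen] C])
        (auto simp: T' T)
    with T' show "z = T F" by simp
  qed
  then show "\<lbrakk>linear_on tscale (tensor sA sB) sC UNIV T; \<And>x y. T (tens sA sB x y) = b x y;
      F \<in> tensor sA sB\<rbrakk> \<Longrightarrow> tensor_lift sA sB sC b F = T F" by blast
  have eq: "tensor_lift sA sB sC b F = T0 F" if "F \<in> tensor sA sB" for F using uniq[OF T0 that] .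
  interpret E: vector_space "tscale :: 'k \<Rightarrow> (('a \<Rightarrow> 'b \<Rightarrow> 'k) \<Rightarrow> 'k) \<Rightarrow> _" by (rule vector_space_tscale)
  have "E.subspace (tensor sA sB)" unfolding gen by (rule E.subspace_span)
  then show "linear_on tscale (tensor sA sB) sC UNIV (tensor_lift sA sB sC b)"
    using T0(1) by (auto simp: linear_on_def eq E.subspace_add E.subspace_scale)
  have "tens sA sB x y \<in> tensor sA sB" unfolding gen by (rule E.span_base) auto
  then show "tensor_lift sA sB sC b (tens sA sB x y) = b x y" using eq T0(2) by simp
qed

lemma linear_on_compose:
  "\<lbrakk>linear_on s1 U s2 U' g; Vector_Spaces.linear s2 s3 f\<rbrakk> \<Longrightarrow> linear_on s1 U s3 UNIV (\<lambda>u. f (g u))"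
  unfolding linear_on_def linear_iff_additive by simp

theorem mtensor_universal:
  fixes sW :: "'k::field \<Rightarrow> 'w::ab_group_add \<Rightarrow> 'w"
  assumes C: "vector_space sC" and b: "multilinear_map sW r W sC b"
  shows "linear_on tscale (mtensor sW r W) sC UNIV (mtensor_lift sW r W sC b)"
    and "w \<in> Pi\<^sub>E {..<r} W \<Longrightarrow> mtensor_lift sW r W sC b (mtens sW r W w) = b w"
    and "\<lbrakk>linear_on tscale (mtensor sW r W) sC UNIV T; \<And>w. w \<in> Pi\<^sub>E {..<r} W \<Longrightarrow> T (mtens sW r W w) = b w;
      F \<in> mtensor sW r W\<rbrakk> \<Longrightarrow> mtensor_lift sW r W sC b F = T F"
proof -
  have "\<exists>\<beta>. \<forall>w\<in>Pi\<^sub>E {..<r} W. mtens sW r W w \<beta> = f (b w)" if "Vector_Spaces.linear sC (*) f" for f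
  proof -
    have "multilinear_map sW r W (*) (\<lambda>w. f (b w))"
      using b linear_on_compose[OF _ that] unfolding multilinear_map_def by blast
    then show ?thesis by (intro exI[of _ "\<lambda>w. f (b w)"]) (simp add: mtens_def)
  qed
  from lift_exists[where e="mtens sW r W" and b=b and Z="Pi\<^sub>E {..<r} W", OF C this]
  obtain T0 where T0: "linear_on tscale (mtensor sW r W) sC UNIV T0"
    "\<And>w. w \<in> Pi\<^sub>E {..<r} W \<Longrightarrow> T0 (mtens sW r W w) = b w" unfolding mtensor_def by blast
  have uniq: "mtensor_lift sW r W sC b F = T F"
    if T: "linear_on tscale (mtensor sW r W) sC UNIV T" "\<And>w. w \<in> Pi\<^sub>E {..<r} W \<Longrightarrow> T (mtens sW r W w) = b w"
      and F: "F \<in> mtensor sW r W" for T F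
    unfolding mtensor_lift_def
  proof (rule the_equality)
    show "\<exists>T'. linear_on tscale (mtensor sW r W) sC UNIV T' \<and> (\<forall>w\<in>Pi\<^sub>E {..<r} W. T' (mtens sW r W w) = b w) \<and> T F = T' F"
      using T by blast
    fix z assume "\<exists>T'. linear_on tscale (mtensor sW r W) sC UNIV T' \<and> (\<forall>w\<in>Pi\<^sub>E {..<r} W. T' (mtens sW r W w) = b w) \<and> z = T' F"
    then obtain T' where T': "linear_on tscale (mtensor sW r W) sC UNIV T'"
      "\<And>w. w \<in> Pi\<^sub>E {..<r} W \<Longrightarrow> T' (mtens sW r W w) = b w" "z = T' F"
      by blast
    have "T' F = T F"
      by (rule linear_on_eq_span[OF vector_space_tscale T'(1)[unfolded mtensor_def] T(1)[unfolded mtensor_def] _ F[unfolded mtensor_def] C])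
        (metis imageE T'(2) T(2))
    with T' show "z = T F" by simp
  qed
  then show "\<lbrakk>linear_on tscale (mtensor sW r W) sC UNIV T; \<And>w. w \<in> Pi\<^sub>E {..<r} W \<Longrightarrow> T (mtens sW r W w) = b w;
      F \<in> mtensor sW r W\<rbrakk> \<Longrightarrow> mtensor_lift sW r W sC b F = T F" by blast
  have eq: "mtensor_lift sW r W sC b F = T0 F" if "F \<in> mtensor sW r W" for F using uniq[OF T0 that] .
  interpret E: vector_space "tscale :: 'k \<Rightarrow> (((nat \<Rightarrow> 'w) \<Rightarrow> 'k) \<Rightarrow> 'k) \<Rightarrow> _" by (rule vector_space_tscale)
  have "E.subspace (mtensor sW r W)" unfolding mtensor_def by (rule E.subspace_span)
  then show "linear_on tscale (mtensor sW r W) sC UNIV (mtensor_lift sW r W sC b)"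
    using T0(1) by (simp add: linear_on_def eq E.subspace_add E.subspace_scale)
  assume w: "w \<in> Pi\<^sub>E {..<r} W"
  then have "mtens sW r W w \<in> mtensor sW r W" unfolding mtensor_def by (intro E.span_base imageI)
  then show "mtensor_lift sW r W sC b (mtens sW r W w) = b w" using eq T0(2) w by simp
qed


lemma tens_in_tensor [simp]:
  fixes sA :: "'k::field \<Rightarrow> 'a::ab_group_add \<Rightarrow> 'a" and sB :: "'k \<Rightarrow> 'b::ab_group_add \<Rightarrow> 'b"
  shows "tens sA sB x y \<in> tensor sA sB"
proof -
  interpret E: vector_space "tscale :: 'k \<Rightarrow> (('a \<Rightarrow> 'b \<Rightarrow> 'k) \<Rightarrow> 'k) \<Rightarrow> _" by (rule vector_space_tscale)
  show ?thesis unfolding tensor_def by (rule E.span_base) auto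
qed

lemma subspace_tensor:
  fixes sA :: "'k::field \<Rightarrow> 'a::ab_group_add \<Rightarrow> 'a" and sB :: "'k \<Rightarrow> 'b::ab_group_add \<Rightarrow> 'b"
  shows "subspace_of tscale (tensor sA sB)"
proof -
  interpret E: vector_space "tscale :: 'k \<Rightarrow> (('a \<Rightarrow> 'b \<Rightarrow> 'k) \<Rightarrow> 'k) \<Rightarrow> _" by (rule vector_space_tscale)
  show ?thesis unfolding tensor_def by (rule E.subspace_span)
qed

lemma bilinear_tens:
  assumes "vector_space sA" "vector_space sB"
  shows "bilinear_map sA sB tscale (tens sA sB)"
  using assms
  by (auto simp: bilinear_map_def linear_iff_additive vector_space_tscale tens_def fun_eq_iff pointwise_def)

text \<open>Case rules for functions produce eta-expanded terms, in which these rules would spread.\<close>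

declare plus_fun_apply [simp del] zero_fun_apply [simp del]

lemma tensor_induct [consumes 1, case_names tens add scale]:
  fixes sA :: "'k::field \<Rightarrow> 'a::ab_group_add \<Rightarrow> 'a" and sB :: "'k \<Rightarrow> 'b::ab_group_add \<Rightarrow> 'b"
  assumes "F \<in> tensor sA sB" and tens: "\<And>x y. P (tens sA sB x y)"
    and add: "\<And>F G. \<lbrakk>F \<in> tensor sA sB; G \<in> tensor sA sB; P F; P G\<rbrakk> \<Longrightarrow> P (F + G)"
    and scale: "\<And>c F. \<lbrakk>F \<in> tensor sA sB; P F\<rbrakk> \<Longrightarrow> P (tscale c F)"
  shows "P F"
proof -
  interpret E: vector_space "tscale :: 'k \<Rightarrow> (('a \<Rightarrow> 'b \<Rightarrow> 'k) \<Rightarrow> 'k) \<Rightarrow> _" by (rule vector_space_tscale)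
  have "F \<in> tensor sA sB \<and> P F" using assms(1) unfolding tensor_def
  proof (induction rule: E.span_induct_alt)
    case base
    have "P (tscale 0 (tens sA sB 0 0))" by (intro scale tens tens_in_tensor)
    then show ?case using E.span_zero by simp
  next
    case (step c u v)
    then obtain x y where u: "u = tens sA sB x y" by blast
    have "tscale c u \<in> tensor sA sB" "P (tscale c u)"
      unfolding u using E.subspace_scale[OF subspace_tensor] tens scale by auto
    then show ?case using step add E.subspace_add[OF subspace_tensor] unfolding tensor_def by blast
  qed
  then show ?thesis by blast
qed


lemma linear_onD:
  assumes "linear_on s1 U s2 U' f"
  shows "x \<in> U \<Longrightarrow> f x \<in> U'" "\<lbrakk>x \<in> U; y \<in> U\<rbrakk> \<Longrightarrow> f (x + y) = f x + f y"
    "x \<in> U \<Longrightarrow> f (s1 c x) = s2 c (f x)"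
  using assms unfolding linear_on_def by blast+

locale current_algebra = lie_algebra scale UNIV br + S: comm_algebra sS
  for scale :: "'k::field \<Rightarrow> 'g::ab_group_add \<Rightarrow> 'g" and br and sS :: "'k \<Rightarrow> 's::comm_ring_1 \<Rightarrow> 's"
begin

interpretation E: vector_space "tscale :: 'k \<Rightarrow> (('g \<Rightarrow> 's \<Rightarrow> 'k) \<Rightarrow> 'k) \<Rightarrow> _" by (rule vector_space_tscale)

abbreviation L where "L \<equiv> tensor scale sS"
abbreviation B where "B \<equiv> current_bracket scale br sS"

lemma tens_rules:
  "tens scale sS (x + x') r = tens scale sS x r + tens scale sS x' r"
  "tens scale sS x (r + r') = tens scale sS x r + tens scale sS x r'"
  "tens scale sS (scale c x) r = tscale c (tens scale sS x r)"
  "tens scale sS x (sS c r) = tscale c (tens scale sS x r)"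
  "tens scale sS 0 r = 0"
proof -
  show *: "tens scale sS (x + x') r = tens scale sS x r + tens scale sS x' r"
    "tens scale sS x (r + r') = tens scale sS x r + tens scale sS x r'"
    "tens scale sS (scale c x) r = tscale c (tens scale sS x r)"
    "tens scale sS x (sS c r) = tscale c (tens scale sS x r)" for c x x' r r'
    using bilinear_tens[OF vector_space_axioms S.vector_space_axioms]
    unfolding bilinear_map_def linear_iff_additive by blast+
  show "tens scale sS 0 r = 0" using *(3)[of 0 0 r] by simp
qed

lemma br_rules:
  "br (x + x') y = br x y + br x' y" "br x (y + y') = br x y + br x y'"
  "br (scale c x) y = scale c (br x y)" "br x (scale c y) = scale c (br x y)"
  using linear_left linear_right by (auto simp: linear_on_def)

lemma closed: "\<lbrakk>F \<in> L; G \<in> L\<rbrakk> \<Longrightarrow> F + G \<in> L" "F \<in> L \<Longrightarrow> tscale c F \<in> L"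
  using E.subspace_add[OF subspace_tensor] E.subspace_scale[OF subspace_tensor] by blast+

lemma scale_mult_right: "x * sS c y = sS c (x * y)"
  using S.scale_mult_left[of c y x] by (simp add: mult.commute)

definition inner where
  "inner x r = tensor_lift scale sS tscale (\<lambda>y s. tens scale sS (br x y) (r * s))"

lemma inner_bilinear: "bilinear_map scale sS tscale (\<lambda>y s. tens scale sS (br x y) (r * s))"
  by (simp add: bilinear_map_def linear_iff_additive vector_space_axioms S.vector_space_axioms vector_space_tscale
      br_rules tens_rules distrib_left scale_mult_right)

lemma inner_tens: "inner x r (tens scale sS y s) = tens scale sS (br x y) (r * s)"
  unfolding inner_def by (rule tensor_universal(2)[OF vector_space_tscale inner_bilinear])

lemma inner_lin:
  "\<lbrakk>F \<in> L; G \<in> L\<rbrakk> \<Longrightarrow> inner x r (F + G) = inner x r F + inner x r G"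
  "F \<in> L \<Longrightarrow> inner x r (tscale c F) = tscale c (inner x r F)"
  using linear_onD[OF tensor_universal(1)[OF vector_space_tscale inner_bilinear]]
  unfolding inner_def by blast+

lemma inner_outer:
  assumes "G \<in> L" shows "bilinear_map scale sS tscale (\<lambda>x r. inner x r G)"
proof -
  have "inner (x + x') r G = inner x r G + inner x' r G \<and> inner x (r + r') G = inner x r G + inner x r' G \<and>
    inner (scale c x) r G = tscale c (inner x r G) \<and> inner x (sS c r) G = tscale c (inner x r G)" for x x' r r' c
    using assms
  proof (induction rule: tensor_induct)
    case (tens y s)
    then show ?case by (simp add: inner_tens br_rules tens_rules distrib_right S.scale_mult_left)
  next
    case (add F G)
    then show ?case by (simp add: inner_lin E.scale_right_distrib)
  next
    case (scale a F)
    then show ?case by (simp add: inner_lin E.scale_right_distrib mult.commute)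
  qed
  then show ?thesis
    by (simp add: bilinear_map_def linear_iff_additive vector_space_axioms S.vector_space_axioms vector_space_tscale)
qed

lemma bracket_inner: "B F G = tensor_lift scale sS tscale (\<lambda>x r. inner x r G) F"
  unfolding current_bracket_def inner_def ..

lemma bracket_tens_left: "G \<in> L \<Longrightarrow> B (tens scale sS x r) G = inner x r G"
  unfolding bracket_inner by (rule tensor_universal(2)[OF vector_space_tscale inner_outer])

lemma bracket_tens: "B (tens scale sS x r) (tens scale sS y s) = tens scale sS (br x y) (r * s)"
  by (simp add: bracket_tens_left inner_tens)

lemma bracket_left:
  assumes "F \<in> L" "F' \<in> L" "G \<in> L"
  shows "B (F + F') G = B F G + B F' G" "B (tscale c F) G = tscale c (B F G)"
  using linear_onD[OF tensor_universal(1)[OF vector_space_tscale inner_outer[OF assms(3)]]] assms(1,2)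
  unfolding bracket_inner by blast+

lemma bracket_right:
  assumes F: "F \<in> L" and G: "G \<in> L" "G' \<in> L"
  shows "B F (G + G') = B F G + B F G'" "B F (tscale c G) = tscale c (B F G)"
proof -
  have "B F (G + G') = B F G + B F G' \<and> B F (tscale c G) = tscale c (B F G)" using F
  proof (induction rule: tensor_induct)
    case (tens x r)
    then show ?case by (simp add: bracket_tens_left inner_lin closed G)
  next
    case (add F F')
    then show ?case by (simp add: bracket_left closed G E.scale_right_distrib ac_simps)
  next
    case (scale a F)
    then show ?case by (simp add: bracket_left closed G E.scale_right_distrib mult.commute)
  qed
  then show "B F (G + G') = B F G + B F G'" "B F (tscale c G) = tscale c (B F G)" by auto
qed

lemmas bracket_rules = bracket_left bracket_right

lemma bracket_closed:
  assumes "F \<in> L" "G \<in> L" shows "B F G \<in> L"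
  using assms
proof (induction arbitrary: G rule: tensor_induct)
  case (tens x r)
  from tens show ?case
    by (induction rule: tensor_induct) (simp_all add: bracket_tens bracket_rules closed)
qed (simp_all add: bracket_rules closed)

lemma br_skew: "br x y + br y x = 0"
proof -
  have "br (x + y) (x + y) = 0" by (rule alternating) simp
  then show ?thesis using alternating[of x] alternating[of y] by (simp add: br_rules add.commute)
qed

lemma bracket_skew:
  assumes "F \<in> L" "G \<in> L" shows "B F G + B G F = 0"
proof -
  define J where "J F G = B F G + B G F" for F G
  have lin: "J (F + F') G = J F G + J F' G" "J (tscale c F) G = tscale c (J F G)"
    if "F \<in> L" "F' \<in> L" "G \<in> L" for F F' G c
    using that by (simp_all add: J_def bracket_rules E.scale_right_distrib ac_simps)
  have cyc: "J F G = J G F" for F G by (simp add: J_def add.commute)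
  have t: "J (tens scale sS x r) (tens scale sS y s) = 0" for x y r s
    by (simp add: J_def bracket_tens mult.commute[of s r] tens_rules(1)[symmetric] br_skew tens_rules(5))
  have 1: "J F (tens scale sS y s) = 0" if "F \<in> L" for F y s
    using that by (induction rule: tensor_induct) (simp_all add: t lin)
  have "J F G = 0" using assms
  proof (induction F rule: tensor_induct)
    case (tens x r)
    have "J G (tens scale sS x r) = 0" by (rule 1[OF tens])
    then show ?case by (simp only: cyc[of "tens scale sS x r"])
  qed (simp_all add: lin)
  then show ?thesis by (simp add: J_def)
qed

lemma bracket_alternating:
  assumes "F \<in> L" shows "B F F = 0"
  using assms
proof (induction rule: tensor_induct)
  case (tens x r) then show ?case by (simp add: bracket_tens alternating tens_rules)
next
  case (add F G) then show ?case using bracket_skew[of F G] by (simp add: bracket_rules closed add.commute)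
next
  case (scale c F) then show ?case by (simp add: bracket_rules closed)
qed

lemma bracket_jacobi:
  assumes "F \<in> L" "G \<in> L" "K \<in> L"
  shows "B F (B G K) + B G (B K F) + B K (B F G) = 0"
proof -
  define J where "J F G K = B F (B G K) + B G (B K F) + B K (B F G)" for F G K
  have cyc: "J F G K = J G K F" for F G K unfolding J_def by (simp add: add.assoc add.commute)
  have lin: "J (F + F') G K = J F G K + J F' G K" "J (tscale c F) G K = tscale c (J F G K)"
    if "F \<in> L" "F' \<in> L" "G \<in> L" "K \<in> L" for F F' G K c
    using that unfolding J_def
    by (simp_all add: bracket_rules bracket_closed E.scale_right_distrib algebra_simps)
  have t: "J (tens scale sS x r) (tens scale sS y s) (tens scale sS z t) = 0" for x y z r s t
  proof -
    have *: "s * (t * r) = r * (s * t)" "t * (r * s) = r * (s * t)" by (simp_all add: ac_simps)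
    show ?thesis using jacobi[of x y z]
      by (simp add: J_def bracket_tens * tens_rules(1)[symmetric] tens_rules(5))
  qed
  have 1: "J F (tens scale sS y s) (tens scale sS z t) = 0" if "F \<in> L" for F y z s t
    using that by (induction rule: tensor_induct) (auto simp: t lin)
  have 2: "J F G (tens scale sS z t) = 0" if "F \<in> L" "G \<in> L" for F G z t
    using that
  proof (induction F arbitrary: G rule: tensor_induct)
    case (tens x r)
    have "J G (tens scale sS z t) (tens scale sS x r) = 0" by (rule 1[OF tens])
    then show ?case by (simp only: cyc[of "tens scale sS x r"])
  qed (simp_all add: lin)
  have "J F G K = 0" using assms
  proof (induction F rule: tensor_induct)
    case (tens x r)
    have "J G K (tens scale sS x r) = 0" by (rule 2[OF tens])
    then show ?case by (simp only: cyc[of "tens scale sS x r"])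
  qed (simp_all add: lin)
  then show ?thesis by (simp add: J_def)
qed

theorem lie_algebra_current: "lie_algebra tscale L B"
  by unfold_locales
    (auto simp: subspace_tensor linear_on_def bracket_rules bracket_closed bracket_alternating bracket_jacobi)

text \<open>Linearity of the residues holds when every \<open>k \<rightarrow> S/M\<^sub>i\<close> is bijective.\<close>

theorem evaluation_map_tens:
  assumes "\<And>i. i < r \<Longrightarrow> Vector_Spaces.linear sS (*) (\<lambda>s. residue sS s (M i))"
  shows "evaluation_map scale sS r M (tens scale sS x s) = (\<lambda>i. if i < r then scale (residue sS s (M i)) x else 0)"
proof -
  have "bilinear_map scale sS (pointwise scale) (\<lambda>x s i. if i < r then scale (residue sS s (M i)) x else 0)"
    using assms
    by (auto simp: bilinear_map_def linear_iff_additive vector_space_axioms S.vector_space_axioms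
        vector_space_pointwise pointwise_def fun_eq_iff plus_fun_apply scale_right_distrib scale_left_distrib mult.commute)
  from tensor_universal(2)[OF vector_space_pointwise[OF vector_space_axioms] this]
  show ?thesis by (simp add: evaluation_map_def)
qed

end

lemma multilinear_mtens: "multilinear_map sW r W tscale (mtens sW r W)"
  by (auto simp: multilinear_map_def linear_on_def mtens_def fun_eq_iff pointwise_def plus_fun_apply)

lemma linear_on_sum:
  fixes s2 :: "'k::field \<Rightarrow> 'b::ab_group_add \<Rightarrow> 'b"
  assumes "vector_space s2" "\<And>i. i \<in> I \<Longrightarrow> linear_on s1 U s2 UNIV (f i)"
  shows "linear_on s1 U s2 UNIV (\<lambda>u. \<Sum>i\<in>I. f i u)"
proof -
  interpret vector_space s2 by fact
  have "f i (x + y) = f i x + f i y" "f i (s1 c x) = s2 c (f i x)"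
    if "i \<in> I" "x \<in> U" "y \<in> U" for i x y c
    using assms(2)[OF that(1)] that(2,3) by (auto simp: linear_on_def)
  then show ?thesis
    by (simp add: linear_on_def sum.distrib[symmetric] scale_sum_right)
qed

lemma linear_on_scale:
  fixes s2 :: "'k::field \<Rightarrow> 'b::ab_group_add \<Rightarrow> 'b"
  assumes "vector_space s2" "linear_on s1 U s2 UNIV f"
  shows "linear_on s1 U s2 UNIV (\<lambda>u. s2 c (f u))"
proof -
  interpret vector_space s2 by fact
  show ?thesis using assms(2) by (simp add: linear_on_def scale_right_distrib mult.commute)
qed

theorem evaluation_action_tens:
  fixes sg :: "'k::field \<Rightarrow> 'g::ab_group_add \<Rightarrow> 'g" and sS :: "'k \<Rightarrow> 's::comm_ring_1 \<Rightarrow> 's"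
    and sW :: "'k \<Rightarrow> 'w::ab_group_add \<Rightarrow> 'w"
  assumes W: "\<And>i. i < r \<Longrightarrow> lie_module sg UNIV br sW (W i) (\<rho> i)"
    and res: "\<And>i. i < r \<Longrightarrow> Vector_Spaces.linear sS (*) (\<lambda>s. residue sS s (M i))"
    and sg: "vector_space sg" and sS: "vector_space sS"
  shows "linear_on tscale (mtensor sW r W) tscale UNIV (evaluation_action sg sS r M sW W \<rho> (tens sg sS x s))"
    and "w \<in> Pi\<^sub>E {..<r} W \<Longrightarrow> evaluation_action sg sS r M sW W \<rho> (tens sg sS x s) (mtens sW r W w) =
      (\<Sum>i<r. tscale (residue sS s (M i)) (mtens sW r W (w(i := \<rho> i x (w i)))))"
proof -
  interpret E: vector_space "tscale :: 'k \<Rightarrow> (((nat \<Rightarrow> 'w) \<Rightarrow> 'k) \<Rightarrow> 'k) \<Rightarrow> _" by (rule vector_space_tscale)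
  let ?m = "mtens sW r W"
  define b where "b x s w = (\<Sum>i<r. tscale (residue sS s (M i)) (?m (w(i := \<rho> i x (w i)))))" for x s w
  have upd: "w(i := u) \<in> Pi\<^sub>E {..<r} W" if "w \<in> Pi\<^sub>E {..<r} W" "i < r" "u \<in> W i" for w i u
    using that by (auto simp: PiE_iff extensional_def)
  have \<rho>1: "linear_on sW (W i) sW (W i) (\<rho> i x)" if "i < r" for i x
    using lie_module.endomorphism[OF W[OF that]] by simp
  have \<rho>2: "\<rho> i (x + y) v = \<rho> i x v + \<rho> i y v" "\<rho> i (sg c x) v = sW c (\<rho> i x v)"
    if "i < r" "v \<in> W i" for i x y c v
    using lie_module.linear_action[OF W[OF that(1)] that(2)] by (auto simp: linear_on_def)
  have \<rho>3: "\<rho> i x v \<in> W i" if "i < r" "v \<in> W i" for i x v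
    using linear_onD(1)[OF \<rho>1 that(2)] that(1) by blast
  have m: "linear_on sW (W i) tscale UNIV (\<lambda>u. ?m (w(i := u)))" if "i < r" "w \<in> Pi\<^sub>E {..<r} W" for i w
    using multilinear_mtens that unfolding multilinear_map_def by blast
  have wW: "w i \<in> W i" if "i < r" "w \<in> Pi\<^sub>E {..<r} W" for i w using that by auto
  have multi: "multilinear_map sW r W tscale (b x s)" for x s
    unfolding multilinear_map_def b_def
  proof (intro allI impI ballI linear_on_sum linear_on_scale vector_space_tscale)
    fix j w i assume j: "j < r" and w: "w \<in> Pi\<^sub>E {..<r} W" and i: "i \<in> {..<r}"
    show "linear_on sW (W j) tscale UNIV (\<lambda>u. ?m ((w(j := u))(i := \<rho> i x ((w(j := u)) i))))"
    proof (cases "i = j")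
      case True
      have "linear_on sW (W j) tscale UNIV (\<lambda>u. ?m (w(j := \<rho> j x u)))"
        using m[OF j w] \<rho>1[OF j, of x] unfolding linear_on_def by (auto simp: Pi_iff)
      then show ?thesis using True by simp
    next
      case False
      then have "?m ((w(j := u))(i := \<rho> i x ((w(j := u)) i))) = ?m ((w(i := \<rho> i x (w i)))(j := u))" for u
        by (simp add: fun_upd_twist)
      then show ?thesis using m[OF j upd[OF w]] \<rho>3 wW w i by simp
    qed
  qed
  note lift = mtensor_universal[OF vector_space_tscale multi]
  have bx: "b (x + y) s w = b x s w + b y s w" "b (sg c x) s w = tscale c (b x s w)"
    "b x (s + t) w = b x s w + b x t w" "b x (sS c s) w = tscale c (b x s w)"
    if w: "w \<in> Pi\<^sub>E {..<r} W" for x y s t c w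
  proof -
    have mw: "?m (w(i := u + v)) = ?m (w(i := u)) + ?m (w(i := v))"
      if "i < r" "u \<in> W i" "v \<in> W i" for i u v
      using m[OF that(1) w] that(2,3) by (auto simp: linear_on_def)
    have mw': "?m (w(i := sW c u)) = tscale c (?m (w(i := u)))" if "i < r" "u \<in> W i" for i u c
      using m[OF that(1) w] that(2) by (auto simp: linear_on_def)
    show "b (x + y) s w = b x s w + b y s w"
      by (simp add: b_def \<rho>2 \<rho>3 mw wW[OF _ w] sum.distrib E.scale_right_distrib)
    show "b (sg c x) s w = tscale c (b x s w)"
      by (simp add: b_def \<rho>2 \<rho>3 mw' wW[OF _ w] E.scale_sum_right mult.commute)
    have r: "residue sS (s + t) (M i) = residue sS s (M i) + residue sS t (M i)"
      "residue sS (sS c s) (M i) = c * residue sS s (M i)" if "i < r" for i c s t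
      using res[OF that] unfolding linear_iff_additive by auto
    show "b x (s + t) w = b x s w + b x t w"
      by (simp add: b_def r sum.distrib E.scale_left_distrib)
    show "b x (sS c s) w = tscale c (b x s w)"
      by (simp add: b_def r E.scale_sum_right)
  qed
  define \<Phi> where "\<Phi> x s = mtensor_lift sW r W tscale (b x s)" for x s
  have sub: "E.subspace (mtensor sW r W)" unfolding mtensor_def by (rule E.subspace_span)
  note \<Phi>D = linear_onD[OF lift(1), folded \<Phi>_def]
  have \<Phi>w: "\<Phi> x s (?m w) = b x s w" if "w \<in> Pi\<^sub>E {..<r} W" for x s w
    unfolding \<Phi>_def by (rule lift(2)[OF that])
  have ext: "\<Phi> x s t = T t" if "linear_on tscale (mtensor sW r W) tscale UNIV T"
    "\<And>w. w \<in> Pi\<^sub>E {..<r} W \<Longrightarrow> T (?m w) = b x s w" "t \<in> mtensor sW r W" for x s t T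
    unfolding \<Phi>_def using that by (rule lift(3))
  have add: "linear_on tscale (mtensor sW r W) tscale UNIV (\<lambda>t. \<Phi> x s t + \<Phi> y u t)" for x s y u
    unfolding linear_on_def by (simp add: \<Phi>D E.scale_right_distrib ac_simps)
  have scale: "linear_on tscale (mtensor sW r W) tscale UNIV (\<lambda>t. tscale c (\<Phi> x s t))" for c x s
    unfolding linear_on_def by (simp add: \<Phi>D E.scale_right_distrib mult.commute)
  have "\<Phi> (x + y) s t = \<Phi> x s t + \<Phi> y s t" "\<Phi> x (s + u) t = \<Phi> x s t + \<Phi> x u t"
    "\<Phi> (sg c x) s t = tscale c (\<Phi> x s t)" "\<Phi> x (sS c s) t = tscale c (\<Phi> x s t)"
    if t: "t \<in> mtensor sW r W" for x y s u c t
    by (rule ext[OF _ _ t], rule add scale, simp add: \<Phi>w bx)+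
  then have "bilinear_map sg sS tscale (\<lambda>x s. \<Phi> x s t)" if "t \<in> mtensor sW r W" for t
    using that by (simp add: bilinear_map_def linear_iff_additive sg sS vector_space_tscale)
  from tensor_universal(2)[OF vector_space_tscale this]
  have act: "evaluation_action sg sS r M sW W \<rho> (tens sg sS x s) t = \<Phi> x s t"
    if "t \<in> mtensor sW r W" for t
    using that unfolding evaluation_action_def \<Phi>_def b_def .
  show "linear_on tscale (mtensor sW r W) tscale UNIV (evaluation_action sg sS r M sW W \<rho> (tens sg sS x s))"
    unfolding linear_on_def by (simp add: act \<Phi>D E.subspace_add[OF sub] E.subspace_scale[OF sub])
  assume w: "w \<in> Pi\<^sub>E {..<r} W"
  then have "?m w \<in> mtensor sW r W" unfolding mtensor_def by (intro E.span_base imageI)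
  then show "evaluation_action sg sS r M sW W \<rho> (tens sg sS x s) (?m w) =
      (\<Sum>i<r. tscale (residue sS s (M i)) (?m (w(i := \<rho> i x (w i)))))"
    by (simp add: act \<Phi>w[OF w] b_def)
qed

declare plus_fun_apply [simp] zero_fun_apply [simp]

end

theory Submission
  imports Defs
begin

text \<open>
  Write \<open>\<rho>\<^sub>i\<close> for the restriction of \<open>\<psi>\<close> to the \<open>i\<close>-th summand, so that
  \<open>\<phi>(x \<otimes> s) = \<Sum>\<^sub>i s(M\<^sub>i) \<rho>\<^sub>i(x)\<close> and \<open>V\<close> is simple under the commuting actions \<open>\<rho>\<^sub>i\<close>. Since \<open>\<hh>\<close> acts diagonally
  through \<open>\<Sum>\<^sub>i \<rho>\<^sub>i\<close>, the elements of \<open>[\<hh>, \<hh>]\<close> act by zero, and simplicity of \<open>\<gg>\<close> makes each of them act by zero in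
  every \<open>\<rho>\<^sub>i\<close>; hence a weight space contains a joint eigenvector \<open>v\<close> of all \<open>\<rho>\<^sub>i(h)\<close>. The submodule \<open>A\<^sub>i v\<close> that it
  generates under \<open>\<rho>\<^sub>i\<close> is a weight module, because \<open>\<rho>\<^sub>j(h)\<close> acts on it by a scalar for \<open>j \<noteq> i\<close>. Every nonzero
  submodule of \<open>A\<^sub>i v\<close> meets the finite-dimensional space \<open>E\<close> of vectors with the joint weight of \<open>v\<close>, so minimality of
  \<open>A\<^sub>i v \<inter> E\<close> yields a \<open>v\<close> for which all \<open>W\<^sub>i = A\<^sub>i v\<close> are simple. Then \<open>a\<^sub>0 v \<otimes> a\<^sub>1 v \<otimes> \<dots> \<mapsto> a\<^sub>0 a\<^sub>1 \<dots> v\<close> is an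
  isomorphism \<open>\<Otimes>\<^sub>i W\<^sub>i \<rightarrow> V\<close>: it is onto because \<open>V\<close> is simple, and injective by Schur's lemma and the density theorem.

  This applies if the residues \<open>s \<mapsto> s(M\<^sub>i)\<close> are linear; otherwise the evaluation map is constant, \<open>\<phi> = 0\<close> and \<open>V\<close> is
  one-dimensional.
\<close>

section \<open>Finite-dimensional subspaces and eigenvectors\<close>

context vector_space
begin

text \<open>A basis of \<open>U\<close> stays independent when a vector of \<open>T\<close> outside
  \<open>U\<close> is added. The bound \<open>T \<subseteq> span B\<close> stands in for finite
  dimension of the ambient space.\<close>

lemma dim_less_if_psubset:
  assumes U: "subspace U" "U \<subset> T" and T: "T \<subseteq> span B" "finite B"
  shows "dim U < dim T"
proof -
  obtain C where C: "C \<subseteq> U" "independent C" "U \<subseteq> span C" "card C = dim U"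
    by (rule basis_exists)
  obtain D where D: "D \<subseteq> T" "independent D" "T \<subseteq> span D" "card D = dim T"
    by (rule basis_exists)
  have finD: "finite D" using independent_span_bound[OF T(2) D(2)] D(1) T(1) by blast
  obtain x where x: "x \<in> T" "x \<notin> U" using U(2) by blast
  have "span C \<subseteq> U" using C(1) U(1) by (rule span_minimal)
  then have nx: "x \<notin> span C" using x by blast
  then have ind: "independent (insert x C)" using C(2) by (rule independent_insertI)
  have "insert x C \<subseteq> span D" using x(1) C(1) U(2) D(3) by blast
  from independent_span_bound[OF finD ind this]
  have "finite (insert x C)" "card (insert x C) \<le> card D" by auto
  moreover have "x \<notin> C" using nx span_base by blast
  ultimately show ?thesis using C(4) D(4) by simp
qed

text \<open>A member of least dimension contains no smaller member. This descending chain condition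
  is used for invariant subspaces and for weight spaces of submodules.\<close>

lemma minimal_subspace_exists:
  assumes "\<U> \<noteq> {}" "\<And>U. U \<in> \<U> \<Longrightarrow> subspace U \<and> U \<subseteq> span B" "finite B"
  shows "\<exists>U\<in>\<U>. \<forall>U'\<in>\<U>. U' \<subseteq> U \<longrightarrow> U' = U"
proof -
  obtain U where U: "U \<in> \<U>" "\<And>U'. U' \<in> \<U> \<Longrightarrow> dim U \<le> dim U'"
    using ex_has_least_nat[of "\<lambda>U. U \<in> \<U>" _ dim] assms(1) by blast
  have "U' = U" if "U' \<in> \<U>" "U' \<subseteq> U" for U'
    using local.dim_less_if_psubset[of U' U B] assms(2,3) U that by (meson leD psubsetI)
  then show ?thesis using U(1) by blast
qed

lemma fin_dim_iff_subspace:
  "subspace U \<Longrightarrow> fin_dim scale U \<longleftrightarrow> (\<exists>B. finite B \<and> U \<subseteq> span B)"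
proof
  assume U: "subspace U" and "\<exists>B. finite B \<and> U \<subseteq> span B"
  then obtain B where B: "finite B" "U \<subseteq> span B" by blast
  obtain C where C: "C \<subseteq> U" "independent C" "U \<subseteq> span C"
    using maximal_independent_subset by blast
  have "finite C" using independent_span_bound[OF B(1) C(2)] C(1) B(2) by blast
  moreover have "U = span C" using C span_minimal[OF C(1) U] by blast
  ultimately show "fin_dim scale U" unfolding fin_dim_def by blast
qed (auto simp: fin_dim_def)

end

section \<open>Polynomials in an endomorphism of a subspace\<close>

locale subspace_endomorphism = vector_space scale
  for scale :: "'k::field \<Rightarrow> 'v::ab_group_add \<Rightarrow> 'v" +
  fixes U :: "'v set" and f :: "'v \<Rightarrow> 'v"
  assumes subspace_U: "subspace U" and linear_f: "linear_on scale U scale U f"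
begin

lemma iterate_mem: "v \<in> U \<Longrightarrow> (f ^^ i) v \<in> U"
  using linear_f by (induction i) (auto simp: linear_on_def)

definition poly_map :: "'k poly \<Rightarrow> 'v \<Rightarrow> 'v" where
  "poly_map p v = (\<Sum>i\<le>degree p. scale (coeff p i) ((f ^^ i) v))"

text \<open>Coefficients beyond the degree vanish, so two polynomials can share one range of
  summation.\<close>

lemma poly_map_eq:
  fixes p :: "'k poly"
  assumes "degree p \<le> n"
  shows "poly_map p v = (\<Sum>i\<le>n. scale (coeff p i) ((f ^^ i) v))"
  unfolding poly_map_def
  using assms by (intro sum.mono_neutral_left) (auto simp: coeff_eq_0)

lemma poly_map_add: "poly_map (p + q) v = poly_map p v + poly_map q v"
proof -
  let ?n = "max (degree p) (degree q)"
  have "degree (p + q) \<le> ?n" by (rule degree_add_le_max)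
  then show ?thesis
    by (simp add: poly_map_eq[of _ ?n] scale_left_distrib sum.distrib)
qed

lemma poly_map_smult: "poly_map (smult c p) v = scale c (poly_map p v)"
  by (simp add: poly_map_eq[of "smult c p" "degree p"] degree_smult_le poly_map_def scale_sum_right)

lemma poly_map_monom: "poly_map (monom c n) v = scale c ((f ^^ n) v)"
proof -
  have "poly_map (monom c n) v = (\<Sum>i\<le>n. if i = n then scale c ((f ^^ n) v) else 0)"
    unfolding poly_map_eq[OF degree_monom_le] by (rule sum.cong) auto
  then show ?thesis by simp
qed

lemma poly_map_mem: "v \<in> U \<Longrightarrow> poly_map p v \<in> U"
  unfolding poly_map_def by (intro subspace_sum subspace_scale subspace_U iterate_mem)

text \<open>\<open>pCons 0 p\<close> is \<open>X\<close> times \<open>p\<close>: multiplication by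
  \<open>X\<close> becomes application of \<open>f\<close>.\<close>

lemma poly_map_pCons_0:
  assumes v: "v \<in> U"
  shows "poly_map (pCons 0 p) v = f (poly_map p v)"
proof -
  have sum_mem: "(\<Sum>i\<le>n. scale (c i) ((f ^^ i) v)) \<in> U" for n :: nat and c
    by (intro subspace_sum subspace_scale subspace_U iterate_mem v)
  have "(\<Sum>i\<le>n. scale (c i) (f ((f ^^ i) v))) = f (\<Sum>i\<le>n. scale (c i) ((f ^^ i) v))" for n c
    by (induction n) (simp_all add: linear_onD(2,3)[OF linear_f] v sum_mem iterate_mem[OF v] subspace_scale[OF subspace_U]
        del: funpow.simps)
  moreover have "poly_map (pCons 0 p) v = (\<Sum>i\<le>degree p. scale (coeff p i) (f ((f ^^ i) v)))"
    by (simp add: poly_map_eq[OF degree_pCons_le] sum.atMost_Suc_shift del: sum.atMost_Suc)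
  ultimately show ?thesis by (simp add: poly_map_def)
qed

end

text \<open>In finite dimension some nonzero polynomial annihilates a given \<open>v\<close>. One of
  least degree has a root \<open>c\<close>; its quotient by \<open>X - c\<close> no longer
  annihilates \<open>v\<close>, and the vector it yields is an eigenvector for
  \<open>c\<close>.\<close>

lemma eigenvector_exists:
  fixes s :: "'k::alg_closed_field \<Rightarrow> 'v::ab_group_add \<Rightarrow> 'v"
  assumes "vector_space s" and U: "subspace_of s U" "U \<noteq> {0}" "U \<subseteq> span_of s B" "finite B"
    and f: "linear_on s U s U f"
  shows "\<exists>c. \<exists>x\<in>U. x \<noteq> 0 \<and> f x = s c x"
proof -
  interpret subspace_endomorphism s U f
    using assms by (intro subspace_endomorphism.intro subspace_endomorphism_axioms.intro)
  obtain v where v: "v \<in> U" "v \<noteq> 0" using subspace_0[OF U(1)] U(2) by blast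
  have "\<exists>n. (f ^^ n) v \<in> span ((\<lambda>i. (f ^^ i) v) ` {..<n})"
  proof (rule ccontr)
    assume *: "\<not> ?thesis"
    have no: "(f ^^ n) v \<notin> span ((\<lambda>i. (f ^^ i) v) ` {..<n})" for n
      using * by simp
    have "independent ((\<lambda>i. (f ^^ i) v) ` {..<n}) \<and> card ((\<lambda>i. (f ^^ i) v) ` {..<n}) = n" for n
    proof (induction n)
      case (Suc n)
      have "(f ^^ n) v \<notin> (\<lambda>i. (f ^^ i) v) ` {..<n}" by (rule contra_subsetD[OF span_superset no])
      then show ?case using Suc independent_insertI[OF no[of n]]
        by (simp add: lessThan_Suc)
    qed (simp add: independent_empty)
    note * = this[of "Suc (card B)"]
    have "(\<lambda>i. (f ^^ i) v) ` {..<Suc (card B)} \<subseteq> span B" using iterate_mem v(1) U(3) by blast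
    from independent_span_bound[OF U(4) conjunct1[OF *] this] * show False by simp
  qed
  then obtain n where n: "(f ^^ n) v \<in> span ((\<lambda>i. (f ^^ i) v) ` {..<n})" by blast
  \<comment> \<open>Degree less than \<open>n\<close> is expressed by vanishing coefficients, which
    gives the zero space for \<open>n = 0\<close>.\<close>
  let ?P = "{poly_map p v | p. \<forall>i\<ge>n. coeff p i = 0}"
  have "span ((\<lambda>i. (f ^^ i) v) ` {..<n}) \<subseteq> ?P"
  proof (rule span_minimal)
    show "(\<lambda>i. (f ^^ i) v) ` {..<n} \<subseteq> ?P"
    proof clarify
      fix i assume "i < n"
      then show "\<exists>p. (f ^^ i) v = poly_map p v \<and> (\<forall>i\<ge>n. coeff p i = 0)"
        by (intro exI[of _ "monom 1 i"]) (simp add: poly_map_monom)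
    qed
    show "subspace ?P"
      unfolding subspace_def
    proof (intro conjI ballI allI)
      show "0 \<in> ?P" by (rule CollectI, rule exI[of _ 0]) (simp add: poly_map_def)
    next
      fix x y assume "x \<in> ?P" "y \<in> ?P"
      then obtain p q where "x = poly_map p v" "y = poly_map q v"
        "\<forall>i\<ge>n. coeff p i = 0" "\<forall>i\<ge>n. coeff q i = 0" by blast
      then show "x + y \<in> ?P"
        by (intro CollectI exI[of _ "p + q"]) (simp add: poly_map_add)
    next
      fix c x assume "x \<in> ?P"
      then obtain p where "x = poly_map p v" "\<forall>i\<ge>n. coeff p i = 0" by blast
      then show "s c x \<in> ?P"
        by (intro CollectI exI[of _ "smult c p"]) (simp add: poly_map_smult)
    qed
  qed
  then obtain q where q: "(f ^^ n) v = poly_map q v" "\<forall>i\<ge>n. coeff q i = 0" using n by blast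
  \<comment> \<open>The polynomial is \<open>X^n - q\<close>; its coefficient at \<open>n\<close> is
    1 because that of \<open>q\<close> vanishes.\<close>
  let ?p = "monom 1 n + smult (-1) q"
  have "coeff ?p n = 1" using q(2) by simp
  then have "?p \<noteq> 0" by force
  moreover have "poly_map ?p v = 0"
    by (simp add: poly_map_add poly_map_smult poly_map_monom q(1)[symmetric] del: smult_minus_left)
  ultimately obtain p where p: "p \<noteq> 0" "poly_map p v = 0"
    and min: "\<And>q. q \<noteq> 0 \<Longrightarrow> poly_map q v = 0 \<Longrightarrow> degree p \<le> degree q"
    using ex_has_least_nat[of "\<lambda>p. p \<noteq> 0 \<and> poly_map p v = 0" ?p degree] by blast
  have "degree p > 0"
  proof (rule ccontr)
    assume "\<not> ?thesis"
    then obtain a where a: "p = monom a 0" using degree_eq_zeroE[of p] by (auto simp: monom_0)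
    then have "a \<noteq> 0" using p(1) by auto
    then show False using p(2) v(2) by (simp add: a poly_map_monom)
  qed
  then obtain c where "poly p c = 0" using alg_closed_imp_poly_has_root by blast
  then obtain q where pq: "p = [:- c, 1:] * q" unfolding poly_eq_0_iff_dvd by (elim dvdE)
  have q0: "q \<noteq> 0" using p(1) pq by auto
  have "degree p = Suc (degree q)" unfolding pq by (subst degree_mult_eq) (use q0 in auto)
  then have "poly_map q v \<noteq> 0" using min[OF q0] by auto
  moreover have "poly_map q v \<in> U" using v(1) by (rule poly_map_mem)
  moreover have "f (poly_map q v) = s c (poly_map q v)"
    using p(2) unfolding pq
    by (simp add: poly_map_add poly_map_smult poly_map_pCons_0[OF v(1)] del: smult_minus_left)
  ultimately show ?thesis by blast
qed

text \<open>Let \<open>Z\<close> be minimal among the nonzero subspaces stable under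
  \<open>\<F>\<close>. An eigenspace of one operator in \<open>Z\<close> is stable under the others
  since they commute, hence equals \<open>Z\<close>; so every operator is scalar on
  \<open>Z\<close>.\<close>

lemma common_eigenvector_exists:
  fixes s :: "'k::alg_closed_field \<Rightarrow> 'v::ab_group_add \<Rightarrow> 'v"
  assumes "vector_space s" and U: "subspace_of s U" "U \<noteq> {0}" "U \<subseteq> span_of s B" "finite B"
    and f: "\<And>f. f \<in> \<F> \<Longrightarrow> linear_on s U s U f"
    and comm: "\<And>f g x. \<lbrakk>f \<in> \<F>; g \<in> \<F>; x \<in> U\<rbrakk> \<Longrightarrow> f (g x) = g (f x)"
  shows "\<exists>x\<in>U. x \<noteq> 0 \<and> (\<forall>f\<in>\<F>. \<exists>c. f x = s c x)"
proof -
  interpret vector_space s by fact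
  define K where "K = {Z. subspace Z \<and> Z \<subseteq> U \<and> Z \<noteq> {0} \<and> (\<forall>f\<in>\<F>. \<forall>x\<in>Z. f x \<in> Z)}"
  have "U \<in> K" using U(1,2) linear_onD(1)[OF f] by (simp add: K_def)
  then have "\<exists>Z\<in>K. \<forall>Y\<in>K. Y \<subseteq> Z \<longrightarrow> Y = Z"
    using U(3,4) by (intro minimal_subspace_exists[of K B]) (auto simp: K_def)
  then obtain Z where Z: "Z \<in> K" and min: "\<And>Y. Y \<in> K \<Longrightarrow> Y \<subseteq> Z \<Longrightarrow> Y = Z" by blast
  have Z': "subspace Z" "Z \<subseteq> U" "Z \<noteq> {0}" "\<And>f x. f \<in> \<F> \<Longrightarrow> x \<in> Z \<Longrightarrow> f x \<in> Z"
    using Z by (auto simp: K_def)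
  have "\<exists>c. \<forall>x\<in>Z. f x = s c x" if F: "f \<in> \<F>" for f
  proof -
    have fZ: "linear_on s Z s Z f" using f[OF F] Z'(2,4) F unfolding linear_on_def by blast
    obtain c x where c: "x \<in> Z" "x \<noteq> 0" "f x = s c x"
      using eigenvector_exists[OF assms(1) Z'(1,3) _ U(4) fZ] Z'(2) U(3) by blast
    let ?Y = "{x \<in> Z. f x = s c x}"
    have "subspace ?Y"
      unfolding subspace_def using linear_onD(2,3)[OF fZ] linear_onD(3)[OF fZ, of 0 0]
      by (simp add: subspace_0 subspace_add subspace_scale Z'(1) scale_right_distrib mult.commute)
    moreover have "g x \<in> ?Y" if "g \<in> \<F>" "x \<in> ?Y" for g x
    proof -
      have x: "x \<in> Z" "f x = s c x" using that(2) by auto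
      have "f (g x) = g (f x)" using comm[OF F that(1)] x(1) Z'(2) by blast
      also have "\<dots> = s c (g x)" using linear_onD(3)[OF f[OF that(1)]] x Z'(2) by auto
      finally show ?thesis using Z'(4) that(1) x(1) by simp
    qed
    moreover have "?Y \<noteq> {0}" using c by auto
    ultimately have "?Y \<in> K" using Z'(2) by (auto simp: K_def)
    then have "?Y = Z" by (rule min) simp
    then show ?thesis by blast
  qed
  moreover obtain x where "x \<in> Z" "x \<noteq> 0" using subspace_0[OF Z'(1)] Z'(3) by blast
  ultimately show ?thesis using Z'(2) by blast
qed

section \<open>Algebras of operators\<close>

locale operator_set = vector_space scale
  for scale :: "'k::field \<Rightarrow> 'v::ab_group_add \<Rightarrow> 'v" +
  fixes R :: "('v \<Rightarrow> 'v) set"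
  assumes linear_gen: "f \<in> R \<Longrightarrow> linear_on scale UNIV scale UNIV f"
begin

text \<open>The unital associative algebra generated by \<open>R\<close>. Only generators are
  composed on the left, which keeps inductions short; \<open>alg_mult\<close> recovers all
  products.\<close>

inductive_set alg :: "('v \<Rightarrow> 'v) set" where
  id: "(\<lambda>v. v) \<in> alg"
| comp: "\<lbrakk>f \<in> R; a \<in> alg\<rbrakk> \<Longrightarrow> (\<lambda>v. f (a v)) \<in> alg"
| add: "\<lbrakk>a \<in> alg; b \<in> alg\<rbrakk> \<Longrightarrow> (\<lambda>v. a v + b v) \<in> alg"
| smult: "a \<in> alg \<Longrightarrow> (\<lambda>v. scale c (a v)) \<in> alg"

lemma alg_gen: "f \<in> R \<Longrightarrow> f \<in> alg"
  using alg.comp[OF _ alg.id] by simp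

lemma alg_linear: "a \<in> alg \<Longrightarrow> linear_on scale UNIV scale UNIV a"
proof (induction rule: alg.induct)
  case (comp f a)
  then show ?case using linear_gen[of f] by (simp add: linear_on_def)
qed (simp_all add: linear_on_def scale_right_distrib ac_simps)

lemma alg_rules:
  assumes "a \<in> alg"
  shows "a (x + y) = a x + a y" "a (scale c x) = scale c (a x)" "a 0 = 0" "a (x - y) = a x - a y"
proof -
  show *: "a (x + y) = a x + a y" "a (scale c x) = scale c (a x)" for x y c
    using alg_linear[OF assms] by (simp_all add: linear_on_def)
  show "a 0 = 0" using *(2)[of 0 0] by simp
  show "a (x - y) = a x - a y" using *(1)[of "x - y" y] by simp
qed

lemma alg_mult: "\<lbrakk>a \<in> alg; b \<in> alg\<rbrakk> \<Longrightarrow> (\<lambda>v. a (b v)) \<in> alg"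
  by (induction rule: alg.induct) (auto intro: alg.intros)

lemma alg_diff: "\<lbrakk>a \<in> alg; b \<in> alg\<rbrakk> \<Longrightarrow> (\<lambda>v. a v - b v) \<in> alg"
  using alg.add[OF _ alg.smult[of b "- 1"]] by simp

lemma alg_stable:
  assumes "subspace N" "\<And>f x. f \<in> R \<Longrightarrow> x \<in> N \<Longrightarrow> f x \<in> N" "a \<in> alg"
  shows "x \<in> N \<Longrightarrow> a x \<in> N"
  using assms(3)
  by (induction arbitrary: x rule: alg.induct) (auto intro: subspace_add subspace_scale assms)

lemma alg_commute:
  assumes g: "linear_on scale UNIV scale UNIV g" and "\<And>f x. f \<in> R \<Longrightarrow> g (f x) = f (g x)" and "a \<in> alg"
  shows "g (a x) = a (g x)"
  using assms(3) by (induction arbitrary: x rule: alg.induct) (simp_all add: assms(2) linear_onD(2,3)[OF g])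

text \<open>The cyclic submodule generated by \<open>v\<close>.\<close>

definition orbit where "orbit v = (\<lambda>a. a v) ` alg"

lemma orbitI: "a \<in> alg \<Longrightarrow> a v \<in> orbit v"
  by (simp add: orbit_def)

lemma orbitE: assumes "x \<in> orbit v" obtains a where "a \<in> alg" "x = a v"
  using assms by (auto simp: orbit_def)

lemma orbit_refl: "v \<in> orbit v"
  using orbitI[OF alg.id] .

lemma orbit_stable: "\<lbrakk>a \<in> alg; x \<in> orbit v\<rbrakk> \<Longrightarrow> a x \<in> orbit v"
  by (elim orbitE) (use orbitI[OF alg_mult] in simp)

lemma subspace_orbit: "subspace (orbit v)"
  unfolding subspace_def
proof (intro conjI ballI allI)
  have "scale 0 v \<in> orbit v" by (rule orbitI[OF alg.smult[OF alg.id]])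
  then show "0 \<in> orbit v" by simp
  show "x + y \<in> orbit v" if "x \<in> orbit v" "y \<in> orbit v" for x y
    using that by (elim orbitE) (use orbitI[OF alg.add] in simp)
  show "scale c x \<in> orbit v" if "x \<in> orbit v" for c x
    using that by (elim orbitE) (use orbitI[OF alg.smult] in simp)
qed

lemma orbit_minimal:
  assumes "subspace N" "\<And>f x. f \<in> R \<Longrightarrow> x \<in> N \<Longrightarrow> f x \<in> N" "v \<in> N"
  shows "orbit v \<subseteq> N"
  using alg_stable[of N _ v] assms by (auto simp: orbit_def)

lemma orbit_trans: "x \<in> orbit v \<Longrightarrow> orbit x \<subseteq> orbit v"
  by (rule orbit_minimal[OF subspace_orbit]) (auto intro: orbit_stable alg_gen)

text \<open>Simplicity phrased through generators; stability under \<open>R\<close> follows, see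
  \<open>irreducible_stable\<close>.\<close>

definition irreducible_subspace where
  "irreducible_subspace W \<longleftrightarrow> subspace W \<and> W \<noteq> {0} \<and> (\<forall>w\<in>W. w \<noteq> 0 \<longrightarrow> orbit w = W)"

lemma irreducible_stable:
  assumes "irreducible_subspace W" "a \<in> alg" "w \<in> W"
  shows "a w \<in> W"
proof (cases "w = 0")
  case True
  then show ?thesis using assms by (simp add: alg_rules)
next
  case False
  then have "orbit w = W" using assms by (simp add: irreducible_subspace_def)
  then show ?thesis using orbitI[OF assms(2)] by blast
qed

text \<open>Here \<open>b\<close> is a homomorphism of modules. For nonzero \<open>w\<close> in the
  orbit some \<open>a\<close> brings \<open>w\<close> back to \<open>v\<close>, so
  \<open>b w = 0\<close> would force \<open>b v = a (b w) = 0\<close>. The same \<open>a\<close>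
  recovers \<open>b v\<close> from \<open>b w\<close>.\<close>

lemma irreducible_image:
  assumes irr: "irreducible_subspace (orbit v)"
    and b: "linear_on scale UNIV scale UNIV b" "\<And>f x. f \<in> R \<Longrightarrow> b (f x) = f (b x)" "b v \<noteq> 0"
  shows "irreducible_subspace (orbit (b v))" and "\<lbrakk>w \<in> orbit v; w \<noteq> 0\<rbrakk> \<Longrightarrow> b w \<noteq> 0"
proof -
  have comm: "b (a x) = a (b x)" if "a \<in> alg" for a x using alg_commute[OF b(1) _ that] b(2) by blast
  have returns: "\<exists>a\<in>alg. v = a w" if "w \<in> orbit v" "w \<noteq> 0" for w
    using irr that orbit_refl[of v] unfolding irreducible_subspace_def by (metis orbitE)
  have b0: "b 0 = 0" using linear_onD(3)[OF b(1), of 0 0] by simp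
  show "b w \<noteq> 0" if w: "w \<in> orbit v" "w \<noteq> 0"
  proof
    assume "b w = 0"
    obtain a where "a \<in> alg" "v = a w" using returns[OF w] by blast
    then show False using comm[of a w] b(3) \<open>b w = 0\<close> by (simp add: alg_rules)
  qed
  have "orbit x = orbit (b v)" if x: "x \<in> orbit (b v)" "x \<noteq> 0" for x
  proof
    show "orbit x \<subseteq> orbit (b v)" by (rule orbit_trans[OF x(1)])
    obtain a where a: "a \<in> alg" "x = a (b v)" using x(1) by (rule orbitE)
    then have xa: "x = b (a v)" using comm by simp
    then have "a v \<noteq> 0" using x(2) b0 by auto
    then obtain a' where "a' \<in> alg" "v = a' (a v)" using returns[OF orbitI[OF a(1)]] by blast
    then have "b v = a' x" using comm[of a' "a v"] xa by simp
    then have "b v \<in> orbit x" using orbitI[OF \<open>a' \<in> alg\<close>] by simp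
    then show "orbit (b v) \<subseteq> orbit x" by (rule orbit_trans)
  qed
  moreover have "orbit (b v) \<noteq> {0}" using orbit_refl[of "b v"] b(3) by auto
  ultimately show "irreducible_subspace (orbit (b v))"
    unfolding irreducible_subspace_def using subspace_orbit by blast
qed

text \<open>The eigenvector \<open>x\<close> generates \<open>W\<close>, and \<open>f\<close>
  commutes with the operators that carry \<open>x\<close> to the other vectors, so its eigenvalue
  spreads over \<open>W\<close>.\<close>

lemma schur:
  assumes "irreducible_subspace W" and comm: "\<And>a w. \<lbrakk>a \<in> alg; w \<in> W\<rbrakk> \<Longrightarrow> f (a w) = a (f w)"
    and x: "x \<in> W" "x \<noteq> 0" "f x = scale c x" and w: "w \<in> W"
  shows "f w = scale c w"
proof -
  have "w \<in> orbit x" using assms by (simp add: irreducible_subspace_def)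
  then obtain a where "a \<in> alg" "w = a x" by (rule orbitE)
  then show ?thesis using comm x by (simp add: alg_rules)
qed

text \<open>Jacobson's density theorem for a simple module whose endomorphisms are scalars. If all
  operators killing \<open>insert y F\<close> also killed \<open>u\<close>, then
  \<open>a y \<mapsto> a u\<close>, for \<open>a\<close> killing \<open>F\<close>, would be an
  endomorphism, hence a scalar \<open>c\<close>, and \<open>u - scale c y\<close> would lie in
  \<open>span F\<close>.\<close>

lemma density:
  assumes irr: "irreducible_subspace W"
    and schur: "\<And>f. \<lbrakk>linear_on scale W scale W f; \<And>a w. \<lbrakk>a \<in> alg; w \<in> W\<rbrakk> \<Longrightarrow> f (a w) = a (f w)\<rbrakk>
      \<Longrightarrow> \<exists>c. \<forall>w\<in>W. f w = scale c w"
    and "finite F" "F \<subseteq> W" "u \<in> W" "u \<notin> span F"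
  shows "\<exists>a\<in>alg. (\<forall>x\<in>F. a x = 0) \<and> a u \<noteq> 0"
  using assms(3-6)
proof (induction F arbitrary: u rule: finite_induct)
  case empty
  then show ?case using alg.id by auto
next
  case (insert y F)
  have sub: "subspace W" using irr by (simp add: irreducible_subspace_def)
  have IH: "\<exists>a\<in>alg. (\<forall>x\<in>F. a x = 0) \<and> a w \<noteq> 0" if "w \<in> W" "w \<notin> span F" for w
    using insert.IH insert.prems(1) that by simp
  show ?case
  proof (cases "y \<in> span F")
    case True
    then have "u \<notin> span F" using insert.prems(3) by (simp add: span_redundant)
    then obtain a where a: "a \<in> alg" "\<And>x. x \<in> F \<Longrightarrow> a x = 0" "a u \<noteq> 0"
      using IH insert.prems(2) by blast
    have "span F \<subseteq> {x. a x = 0}"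
      by (rule span_minimal) (auto simp: subspace_def alg_rules[OF a(1)] a(2))
    then show ?thesis using a True by auto
  next
    case False
    then have "\<exists>a\<in>alg. (\<forall>x\<in>F. a x = 0) \<and> a y \<noteq> 0" using IH insert.prems(1) by simp
    then obtain a0 where a0: "a0 \<in> alg" "\<And>x. x \<in> F \<Longrightarrow> a0 x = 0" "a0 y \<noteq> 0" by blast
    \<comment> \<open>The annihilator of \<open>F\<close> is a left ideal; since \<open>a0 y\<close>
      is nonzero, it carries \<open>y\<close> to every vector of \<open>W\<close>.\<close>
    define I where "I = {a \<in> alg. \<forall>x\<in>F. a x = 0}"
    have I: "a \<in> alg" if "a \<in> I" for a using that by (simp add: I_def)
    show ?thesis
    proof (rule ccontr)
      assume "\<not> ?thesis"
      then have kill: "a u = 0" if "a \<in> I" "a y = 0" for a using that by (auto simp: I_def)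
      have surj: "\<exists>a. a \<in> I \<and> a y = w" if "w \<in> W" for w
      proof -
        have "a0 y \<in> W" using irreducible_stable[OF irr a0(1)] insert.prems by simp
        then have "w \<in> orbit (a0 y)" using irr a0(3) that by (simp add: irreducible_subspace_def)
        then obtain b where b: "b \<in> alg" "w = b (a0 y)" by (rule orbitE)
        then have "(\<lambda>v. b (a0 v)) \<in> I" using a0 by (simp add: I_def alg_mult alg_rules)
        then show ?thesis using b by auto
      qed
      \<comment> \<open>By \<open>kill\<close>, the value at \<open>u\<close> does not depend on the
        operator that is chosen.\<close>
      define f where "f w = (SOME a. a \<in> I \<and> a y = w) u" for w
      have f: "f (a y) = a u" if "a \<in> I" for a
      proof -
        define b where "b = (SOME b. b \<in> I \<and> b y = a y)"
        have "b \<in> I \<and> b y = a y"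
          unfolding b_def by (rule someI[of _ a]) (simp add: that)
        then have "(\<lambda>v. b v - a v) \<in> I" "b y - a y = 0" using that by (auto simp: I_def alg_diff)
        then have "b u - a u = 0" by (rule kill)
        then show ?thesis by (simp add: f_def b_def)
      qed
      have "linear_on scale W scale W f"
        unfolding linear_on_def
      proof (intro conjI funcsetI ballI allI)
        fix w assume "w \<in> W"
        then obtain a where a: "a \<in> I" "a y = w" using surj by blast
        then show "f w \<in> W" using f[OF a(1)] irreducible_stable[OF irr I[OF a(1)]] insert.prems by simp
        fix c
        have "(\<lambda>v. scale c (a v)) \<in> I" using a by (simp add: I_def alg.smult)
        from f[OF this] show "f (scale c w) = scale c (f w)" using f[OF a(1)] a(2) by simp
      next
        fix w w' assume "w \<in> W" "w' \<in> W"
        then obtain a a' where a: "a \<in> I" "a y = w" "a' \<in> I" "a' y = w'" using surj by blast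
        have "(\<lambda>v. a v + a' v) \<in> I" using a by (simp add: I_def alg.add)
        from f[OF this] show "f (w + w') = f w + f w'" using f[OF a(1)] f[OF a(3)] a by simp
      qed
      moreover have "f (b w) = b (f w)" if b: "b \<in> alg" and w: "w \<in> W" for b w
      proof -
        obtain a where a: "a \<in> I" "a y = w" using surj[OF w] by blast
        then have "(\<lambda>v. b (a v)) \<in> I" using b by (simp add: I_def alg_mult alg_rules)
        from f[OF this] show ?thesis using f[OF a(1)] a(2) by simp
      qed
      ultimately obtain c where c: "\<And>w. w \<in> W \<Longrightarrow> f w = scale c w" using schur by blast
      have "u - scale c y \<in> span F"
      proof (rule ccontr)
        assume no: "u - scale c y \<notin> span F"
        have "u - scale c y \<in> W"
          using insert.prems sub by (simp add: subspace_diff subspace_scale)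
        from IH[OF this no] obtain a
          where a: "a \<in> alg" "\<And>x. x \<in> F \<Longrightarrow> a x = 0" "a (u - scale c y) \<noteq> 0" by blast
        then have aI: "a \<in> I" by (simp add: I_def)
        have "a y \<in> W" using irreducible_stable[OF irr a(1)] insert.prems by simp
        then show False using f[OF aI] c a by (simp add: alg_rules[OF a(1)])
      qed
      then have "u \<in> span (insert y F)" by (auto simp: span_insert)
      then show False using insert.prems(3) by contradiction
    qed
  qed
qed

end

text \<open>Subtracting the scalar \<open>\<nu> h\<close> from \<open>act h\<close> removes the
  component of weight \<open>\<nu>\<close> and rescales the others, so induction on \<open>F\<close>
  applies. With \<open>N = {0}\<close> this is the linear independence of weight vectors.\<close>

lemma (in vector_space) weight_components:
  assumes "finite F" and N: "subspace N" "\<And>h x. \<lbrakk>h \<in> H; x \<in> N\<rbrakk> \<Longrightarrow> act h x \<in> N"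
    and act: "\<And>h. h \<in> H \<Longrightarrow> linear_on scale UNIV scale UNIV (act h)"
    and "\<And>\<mu> h. \<lbrakk>\<mu> \<in> F; h \<in> H\<rbrakk> \<Longrightarrow> act h (y \<mu>) = scale (\<mu> h) (y \<mu>)"
    and "\<And>\<mu> \<nu>. \<lbrakk>\<mu> \<in> F; \<nu> \<in> F; \<mu> \<noteq> \<nu>\<rbrakk> \<Longrightarrow> \<exists>h\<in>H. \<mu> h \<noteq> \<nu> h"
    and "(\<Sum>\<mu>\<in>F. y \<mu>) \<in> N"
  shows "\<forall>\<mu>\<in>F. y \<mu> \<in> N"
  using assms(1,5-)
proof (induction F arbitrary: y rule: finite_induct)
  case (insert \<nu> F)
  have y: "y \<mu> \<in> N" if \<mu>: "\<mu> \<in> F" for \<mu>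
  proof -
    have "\<mu> \<noteq> \<nu>" using \<mu> insert.hyps by auto
    then obtain h where h: "h \<in> H" "\<mu> h \<noteq> \<nu> h" using insert.prems(2)[of \<mu> \<nu>] \<mu> by blast
    let ?s = "\<Sum>\<kappa>\<in>insert \<nu> F. y \<kappa>"
    \<comment> \<open>Other factors \<open>\<kappa> h - \<nu> h\<close> may vanish; \<open>h\<close>
      is chosen so that the one at \<open>\<mu>\<close> does not, and only that one is
      inverted.\<close>
    define z where "z \<kappa> = scale (\<kappa> h - \<nu> h) (y \<kappa>)" for \<kappa>
    have sum: "act h (\<Sum>\<kappa>\<in>G. y \<kappa>) = (\<Sum>\<kappa>\<in>G. act h (y \<kappa>))" for G
    proof (induction G rule: infinite_finite_induct)
      case empty
      show ?case using linear_onD(3)[OF act[OF h(1)], of 0 0] by simp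
    next
      case (infinite G)
      then show ?case using linear_onD(3)[OF act[OF h(1)], of 0 0] by simp
    qed (simp add: linear_onD(2)[OF act[OF h(1)]])
    have "act h ?s - scale (\<nu> h) ?s = (\<Sum>\<kappa>\<in>insert \<nu> F. z \<kappa>)"
      unfolding sum scale_sum_right sum_subtractf[symmetric]
      by (rule sum.cong) (use insert.prems(1) h in \<open>auto simp: z_def scale_left_diff_distrib\<close>)
    also have "\<dots> = (\<Sum>\<kappa>\<in>F. z \<kappa>)" using insert.hyps by (simp add: z_def)
    finally have "(\<Sum>\<kappa>\<in>F. z \<kappa>) \<in> N"
      using N h(1) insert.prems(3) by (metis subspace_diff subspace_scale)
    moreover have "act h' (z \<kappa>) = scale (\<kappa> h') (z \<kappa>)" if "\<kappa> \<in> F" "h' \<in> H" for \<kappa> h'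
      using insert.prems(1)[of \<kappa> h'] that by (simp add: z_def linear_onD(3)[OF act] mult.commute)
    ultimately have "z \<mu> \<in> N" using insert.IH[of z] insert.prems(2) \<mu> by blast
    then have "scale (inverse (\<mu> h - \<nu> h)) (z \<mu>) \<in> N" by (rule subspace_scale[OF N(1)])
    then show ?thesis using h(2) by (simp add: z_def)
  qed
  then have "(\<Sum>\<mu>\<in>F. y \<mu>) \<in> N" by (intro subspace_sum N(1))
  then have "(\<Sum>\<mu>\<in>insert \<nu> F. y \<mu>) - (\<Sum>\<mu>\<in>F. y \<mu>) \<in> N" using N(1) insert.prems(3) by (intro subspace_diff)
  then have "y \<nu> \<in> N" using insert.hyps by simp
  then show ?case using y by simp
qed simp

section \<open>Modules with commuting actions\<close>

lemma (in vector_space) span_Union_subspaces: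
  assumes "\<And>i. i \<in> I \<Longrightarrow> subspace (U i)" and "v \<in> span (\<Union>i\<in>I. U i)"
  shows "\<exists>F y. finite F \<and> F \<subseteq> I \<and> (\<forall>i\<in>F. y i \<in> U i) \<and> v = (\<Sum>i\<in>F. y i)"
  using assms(2)
proof (induction rule: span_induct_alt)
  case base
  then show ?case by (intro exI[of _ "{}"]) simp
next
  case (step c x v)
  then obtain i F y where i: "i \<in> I" "x \<in> U i"
    and F: "finite F" "F \<subseteq> I" "\<forall>i\<in>F. y i \<in> U i" "v = (\<Sum>i\<in>F. y i)" by blast
  \<comment> \<open>The new term is merged into the summand with index \<open>i\<close>;
    \<open>y i\<close> is arbitrary if \<open>i\<close> is not yet in \<open>F\<close>, hence the
    conditional.\<close>
  define y' where "y' = y(i := scale c x + (if i \<in> F then y i else 0))"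
  have "(\<Sum>j\<in>F - {i}. y' j) = (\<Sum>j\<in>F - {i}. y j)" by (rule sum.cong) (auto simp: y'_def)
  then have "scale c x + v = (\<Sum>j\<in>insert i F. y' j)"
    using F(1,4) by (cases "i \<in> F") (simp_all add: sum.insert_remove sum.remove[of F i] y'_def add.assoc)
  moreover have "\<forall>j\<in>insert i F. y' j \<in> U j"
    using F(3) i assms(1)[OF i(1)] by (auto simp: y'_def intro: subspace_add subspace_scale)
  ultimately show ?case using F(1,2) i(1) by (intro exI[of _ "insert i F"] exI[of _ y']) auto
qed

lemma (in vector_space) linear_on_span:
  assumes f: "linear_on scale UNIV scale UNIV f" and "\<And>x. x \<in> S \<Longrightarrow> f x \<in> T" "subspace T"
    and "x \<in> span S"
  shows "f x \<in> T"
  using assms(4)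
proof (induction rule: span_induct_alt)
  case base
  have "f 0 = 0" using linear_onD(3)[OF f, of 0 0] by simp
  then show ?case using subspace_0[OF assms(3)] by simp
next
  case (step c x y)
  then show ?case using linear_onD(2,3)[OF f] assms(2,3) by (simp add: subspace_add subspace_scale)
qed

text \<open>Forms in \<open>dual_space\<close> vanish outside \<open>H\<close>, so a difference must
  show on \<open>H\<close>.\<close>

lemma dual_space_neq:
  "\<lbrakk>\<mu> \<in> dual_space s H; \<nu> \<in> dual_space s H; \<mu> \<noteq> \<nu>\<rbrakk> \<Longrightarrow> \<exists>h\<in>H. \<mu> h \<noteq> \<nu> h"
  unfolding dual_space_def fun_eq_iff by force

lemma dual_space_add: "\<lbrakk>\<mu> \<in> dual_space s H; \<nu> \<in> dual_space s H\<rbrakk> \<Longrightarrow> (\<lambda>h. \<mu> h + \<nu> h) \<in> dual_space s H"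
  by (auto simp: dual_space_def linear_on_def algebra_simps)

lemma dual_space_diff: "\<lbrakk>\<mu> \<in> dual_space s H; \<nu> \<in> dual_space s H\<rbrakk> \<Longrightarrow> (\<lambda>h. \<mu> h - \<nu> h) \<in> dual_space s H"
  by (auto simp: dual_space_def linear_on_def algebra_simps)

lemma dual_space_sum: "(\<And>i. i \<in> I \<Longrightarrow> \<mu> i \<in> dual_space s H) \<Longrightarrow> (\<lambda>h. \<Sum>i\<in>I. \<mu> i h) \<in> dual_space s H"
  by (induction I rule: infinite_finite_induct) (simp_all add: dual_space_add, auto simp: dual_space_def linear_on_def)

text \<open>One action \<open>\<rho> i\<close> for each summand of the direct power:
  \<open>jointly_simple\<close> is simplicity over the direct power, while \<open>weights\<close>
  concerns only the diagonal action of \<open>H\<close>.\<close>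

locale commuting_modules = vector_space sV
  for sV :: "'k::alg_closed_field \<Rightarrow> 'v::ab_group_add \<Rightarrow> 'v" +
  fixes sg :: "'k \<Rightarrow> 'g::ab_group_add \<Rightarrow> 'g" and br :: "'g \<Rightarrow> 'g \<Rightarrow> 'g" and H :: "'g set"
    and r :: nat and \<rho> :: "nat \<Rightarrow> 'g \<Rightarrow> 'v \<Rightarrow> 'v"
  assumes lie_modules: "i < r \<Longrightarrow> lie_module sg UNIV br sV UNIV (\<rho> i)"
    and commute: "\<lbrakk>i < r; j < r; i \<noteq> j\<rbrakk> \<Longrightarrow> \<rho> i x (\<rho> j y v) = \<rho> j y (\<rho> i x v)"
    and commute_H: "\<lbrakk>i < r; h \<in> H; h' \<in> H\<rbrakk> \<Longrightarrow> \<rho> i h (\<rho> i h' v) = \<rho> i h' (\<rho> i h v)"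
    and jointly_simple: "\<lbrakk>subspace U; \<And>i x u. \<lbrakk>i < r; u \<in> U\<rbrakk> \<Longrightarrow> \<rho> i x u \<in> U\<rbrakk> \<Longrightarrow> U = {0} \<or> U = UNIV"
    and nontrivial: "\<exists>v::'v. v \<noteq> 0"
    and subspace_H: "subspace_of sg H"
    and weights: "weight_decomposition sg H sV UNIV (\<lambda>x v. \<Sum>i<r. \<rho> i x v)"
begin

abbreviation "dual \<equiv> dual_space sg H"

definition act where "act h v = (\<Sum>i<r. \<rho> i h v)"

text \<open>\<open>J\<close> selects factors: \<open>{i}\<close> yields the submodules for one
  action, its complement in \<open>{..<r}\<close> the operators that commute with that
  action.\<close>

abbreviation "gens J \<equiv> (\<Union>i\<in>J. range (\<rho> i))"
abbreviation "alg J \<equiv> operator_set.alg sV (gens J)"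
abbreviation "orbit J \<equiv> operator_set.orbit sV (gens J)"
abbreviation "irreducible_under J \<equiv> operator_set.irreducible_subspace sV (gens J)"

lemma \<rho>_linear: "i < r \<Longrightarrow> linear_on sV UNIV sV UNIV (\<rho> i x)"
  using lie_module.endomorphism[OF lie_modules] by simp

lemma \<rho>_rules:
  assumes "i < r"
  shows "\<rho> i x (v + w) = \<rho> i x v + \<rho> i x w" "\<rho> i x (sV c v) = sV c (\<rho> i x v)"
    "\<rho> i (x + y) v = \<rho> i x v + \<rho> i y v" "\<rho> i (sg c x) v = sV c (\<rho> i x v)"
  using \<rho>_linear[OF assms] lie_module.linear_action[OF lie_modules[OF assms], of v]
  by (simp_all add: linear_on_def)

lemma operators: "J \<subseteq> {..<r} \<Longrightarrow> operator_set sV (gens J)"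
  by unfold_locales (use \<rho>_linear in auto)

lemma \<rho>_in_alg: "\<lbrakk>J \<subseteq> {..<r}; i \<in> J\<rbrakk> \<Longrightarrow> \<rho> i x \<in> alg J"
  by (rule operator_set.alg_gen[OF operators]) auto

lemma alg_linear: "\<lbrakk>J \<subseteq> {..<r}; a \<in> alg J\<rbrakk> \<Longrightarrow> linear_on sV UNIV sV UNIV a"
  by (rule operator_set.alg_linear[OF operators])

lemma alg_commute:
  assumes "J \<subseteq> {..<r}" "K \<subseteq> {..<r}" "J \<inter> K = {}" "a \<in> alg J" "b \<in> alg K"
  shows "a (b v) = b (a v)"
proof -
  have "\<rho> i x (b v) = b (\<rho> i x v)" if "i \<in> J" for i x v
  proof (rule operator_set.alg_commute[OF operators[OF assms(2)] _ _ assms(5)])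
    show "linear_on sV UNIV sV UNIV (\<rho> i x)" using assms(1) that by (intro \<rho>_linear) auto
    fix f v assume "f \<in> gens K"
    then obtain j y where "j \<in> K" "f = \<rho> j y" by auto
    then show "\<rho> i x (f v) = f (\<rho> i x v)" using commute[of i j x y v] assms(1-3) that by auto
  qed
  then have "b (f v) = f (b v)" if "f \<in> gens J" for f v using that by auto
  from operator_set.alg_commute[OF operators[OF assms(1)] alg_linear[OF assms(2,5)] this assms(4)]
  show ?thesis by simp
qed

lemma orbit_\<rho>_stable:
  assumes "i < r" "w \<in> orbit {i} v" shows "\<rho> i x w \<in> orbit {i} v"
proof -
  have J: "{i} \<subseteq> {..<r}" using assms(1) by simp
  show ?thesis by (rule operator_set.orbit_stable[OF operators[OF J] \<rho>_in_alg[OF J] assms(2)]) simp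
qed

lemma act_linear: "linear_on sV UNIV sV UNIV (act h)"
  unfolding act_def by (intro linear_on_sum vector_space_axioms \<rho>_linear) simp

section \<open>Weights of the diagonal action and joint weights\<close>

lemma weight_decomposition_exists:
  "\<exists>F f. finite F \<and> F \<subseteq> dual \<and> (\<forall>\<mu>\<in>F. f \<mu> \<noteq> 0 \<and> (\<forall>h\<in>H. act h (f \<mu>) = sV (\<mu> h) (f \<mu>))) \<and> v = (\<Sum>\<mu>\<in>F. f \<mu>)"
proof -
  have "\<exists>f. finite {\<mu>. f \<mu> \<noteq> 0} \<and> (\<forall>\<mu>\<in>dual. f \<mu> \<in> weight_space H sV UNIV act \<mu>) \<and>
      (\<forall>\<mu>. \<mu> \<notin> dual \<longrightarrow> f \<mu> = 0) \<and> v = (\<Sum>\<mu> | f \<mu> \<noteq> 0. f \<mu>)"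
    using weights unfolding weight_decomposition_def internal_direct_sum_def act_def[abs_def] by blast
  then obtain f where f: "finite {\<mu>. f \<mu> \<noteq> 0}" "\<forall>\<mu>\<in>dual. f \<mu> \<in> weight_space H sV UNIV act \<mu>"
    "\<forall>\<mu>. \<mu> \<notin> dual \<longrightarrow> f \<mu> = 0" "v = (\<Sum>\<mu> | f \<mu> \<noteq> 0. f \<mu>)" by blast
  show ?thesis
    by (intro exI[of _ "{\<mu>. f \<mu> \<noteq> 0}"] exI[of _ f]) (use f in \<open>auto simp: weight_space_def\<close>)
qed

lemma stable_weight_decomposition:
  assumes N: "subspace N" "\<And>h x. \<lbrakk>h \<in> H; x \<in> N\<rbrakk> \<Longrightarrow> act h x \<in> N" and v: "v \<in> N"
  shows "\<exists>F f. finite F \<and> F \<subseteq> dual \<and>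
    (\<forall>\<mu>\<in>F. f \<mu> \<noteq> 0 \<and> f \<mu> \<in> N \<and> (\<forall>h\<in>H. act h (f \<mu>) = sV (\<mu> h) (f \<mu>))) \<and> v = (\<Sum>\<mu>\<in>F. f \<mu>)"
proof -
  obtain F f where f: "finite F" "F \<subseteq> dual" "\<forall>\<mu>\<in>F. f \<mu> \<noteq> 0 \<and> (\<forall>h\<in>H. act h (f \<mu>) = sV (\<mu> h) (f \<mu>))"
    "v = (\<Sum>\<mu>\<in>F. f \<mu>)"
    using weight_decomposition_exists[of v] by blast
  have "\<exists>h\<in>H. \<mu> h \<noteq> \<nu> h" if "\<mu> \<in> F" "\<nu> \<in> F" "\<mu> \<noteq> \<nu>" for \<mu> \<nu>
    using dual_space_neq[of \<mu> sg H \<nu>] f(2) that by blast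
  moreover have "(\<Sum>\<mu>\<in>F. f \<mu>) \<in> N" using v f(4) by simp
  ultimately have "\<forall>\<mu>\<in>F. f \<mu> \<in> N"
    using f(3) by (intro weight_components[of F N H act f] f(1) N act_linear) auto
  with f show ?thesis by (intro exI[of _ F] exI[of _ f]) auto
qed

text \<open>A weight space for the \<open>r\<close> separate actions of \<open>H\<close>; the
  diagonal action has the sum of the \<open>\<kappa> i\<close> as its weight there.\<close>

definition joint :: "(nat \<Rightarrow> 'g \<Rightarrow> 'k) \<Rightarrow> 'v set" where
  "joint \<kappa> = {v. \<forall>i<r. \<forall>h\<in>H. \<rho> i h v = sV (\<kappa> i h) v}"

lemma jointD: "\<lbrakk>v \<in> joint \<kappa>; i < r; h \<in> H\<rbrakk> \<Longrightarrow> \<rho> i h v = sV (\<kappa> i h) v"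
  by (simp add: joint_def)

lemma \<rho>_zero: "i < r \<Longrightarrow> \<rho> i x 0 = 0"
  using \<rho>_rules(2)[of i x 0 0] by simp

lemma subspace_joint: "subspace (joint \<kappa>)"
  by (auto simp: subspace_def joint_def \<rho>_rules \<rho>_zero scale_right_distrib mult.commute)

lemma act_joint: "\<lbrakk>v \<in> joint \<kappa>; h \<in> H\<rbrakk> \<Longrightarrow> act h v = sV (\<Sum>i<r. \<kappa> i h) v"
  by (simp add: act_def jointD scale_sum_left)

lemma fin_dim_weight_space: "\<mu> \<in> dual \<Longrightarrow> fin_dim sV (weight_space H sV UNIV act \<mu>)"
  using weights unfolding weight_decomposition_def act_def[abs_def] by blast

text \<open>The joint weight space sits inside a single weight space of the diagonal action.\<close>

lemma joint_finite_dimensional: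
  assumes "\<And>i. i < r \<Longrightarrow> \<kappa> i \<in> dual"
  shows "\<exists>B. finite B \<and> joint \<kappa> \<subseteq> span B"
proof -
  have "(\<lambda>h. \<Sum>i<r. \<kappa> i h) \<in> dual" using assms by (intro dual_space_sum) simp
  then have "fin_dim sV (weight_space H sV UNIV act (\<lambda>h. \<Sum>i<r. \<kappa> i h))" by (rule fin_dim_weight_space)
  moreover have "joint \<kappa> \<subseteq> weight_space H sV UNIV act (\<lambda>h. \<Sum>i<r. \<kappa> i h)"
    by (auto simp: weight_space_def act_joint)
  ultimately show ?thesis unfolding fin_dim_def by auto
qed

text \<open>A nonzero weight space of the diagonal action is finite-dimensional, and the operators
  \<open>\<rho> i h\<close> preserve it and commute. They have a common eigenvector, whose
  eigenvalues are linear in \<open>h\<close>.\<close>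

lemma joint_eigenvector_exists:
  obtains \<kappa> v where "\<And>i. i < r \<Longrightarrow> \<kappa> i \<in> dual" "v \<in> joint \<kappa>" "v \<noteq> 0"
proof -
  obtain v0 :: 'v where "v0 \<noteq> 0" using nontrivial by blast
  obtain F f where F: "F \<subseteq> dual" "\<forall>\<mu>\<in>F. f \<mu> \<noteq> 0 \<and> (\<forall>h\<in>H. act h (f \<mu>) = sV (\<mu> h) (f \<mu>))"
    "v0 = (\<Sum>\<mu>\<in>F. f \<mu>)"
    using weight_decomposition_exists[of v0] by blast
  have "F \<noteq> {}" using F(3) \<open>v0 \<noteq> 0\<close> by auto
  then obtain \<mu> where \<mu>: "\<mu> \<in> F" by blast
  define U where "U = weight_space H sV UNIV act \<mu>"
  have U: "u \<in> U \<longleftrightarrow> (\<forall>h\<in>H. act h u = sV (\<mu> h) u)" for u by (simp add: U_def weight_space_def)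
  have "fin_dim sV U" unfolding U_def using \<mu> F(1) by (intro fin_dim_weight_space) auto
  then obtain B where B: "finite B" "U = span B" by (auto simp: fin_dim_def)
  have sub: "subspace U" by (simp add: B(2))
  have "f \<mu> \<in> U" "f \<mu> \<noteq> 0" using F(2) \<mu> by (auto simp: U)
  then have nz: "U \<noteq> {0}" by blast
  let ?F = "{\<rho> i h | i h. i < r \<and> h \<in> H}"
  have "\<exists>v\<in>U. v \<noteq> 0 \<and> (\<forall>f\<in>?F. \<exists>c. f v = sV c v)"
  proof (rule common_eigenvector_exists[OF vector_space_axioms sub nz _ B(1)])
    show "U \<subseteq> span B" by (simp add: B(2))
    have comm: "\<rho> i h (\<rho> j h' u) = \<rho> j h' (\<rho> i h u)" if "i < r" "j < r" "h \<in> H" "h' \<in> H" for i j h h' u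
      using commute commute_H that by (cases "i = j") auto
    show "g (g' u) = g' (g u)" if "g \<in> ?F" "g' \<in> ?F" for g g' u
      using that comm by auto
    show "linear_on sV U sV U g" if "g \<in> ?F" for g
    proof -
      obtain i h where g: "g = \<rho> i h" "i < r" "h \<in> H" using \<open>g \<in> ?F\<close> by blast
      have sum: "\<rho> i h (\<Sum>j\<in>J. y j) = (\<Sum>j\<in>J. \<rho> i h (y j))" for J :: "nat set" and y
        by (induction J rule: infinite_finite_induct) (simp_all add: \<rho>_rules \<rho>_zero g(2))
      have "\<rho> i h u \<in> U" if u: "u \<in> U" for u
        unfolding U
      proof
        fix h' assume h': "h' \<in> H"
        have "act h' (\<rho> i h u) = \<rho> i h (act h' u)"
          unfolding act_def sum by (rule sum.cong) (use comm g h' in auto)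
        also have "\<dots> = sV (\<mu> h') (\<rho> i h u)" using u h' by (simp add: U \<rho>_rules g(2))
        finally show "act h' (\<rho> i h u) = sV (\<mu> h') (\<rho> i h u)" .
      qed
      then show ?thesis using g(1,2) by (auto simp: linear_on_def \<rho>_rules)
    qed
  qed
  then obtain v where v: "v \<noteq> 0" "\<And>i h. \<lbrakk>i < r; h \<in> H\<rbrakk> \<Longrightarrow> \<exists>c. \<rho> i h v = sV c v" by blast
  \<comment> \<open>For \<open>i < r\<close> and \<open>h\<close> in \<open>H\<close> the eigenvalue
    is unique since \<open>v\<close> is nonzero; outside \<open>H\<close> it is set to zero, as
    \<open>dual_space\<close> demands.\<close>
  define \<kappa> where "\<kappa> i h = (if h \<in> H then (SOME c. \<rho> i h v = sV c v) else 0)" for i h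
  have \<kappa>: "\<rho> i h v = sV (\<kappa> i h) v" if "i < r" "h \<in> H" for i h
    using someI_ex[OF v(2)[OF that]] that by (simp add: \<kappa>_def)
  show thesis
  proof (rule that)
    show "v \<in> joint \<kappa>" using \<kappa> by (simp add: joint_def)
    show "v \<noteq> 0" by fact
    fix i assume i: "i < r"
    interpret g: lie_module sg UNIV br sV UNIV "\<rho> i" using i by (rule lie_modules)
    have "\<kappa> i (h + h') = \<kappa> i h + \<kappa> i h'" if "h \<in> H" "h' \<in> H" for h h'
    proof -
      have "sV (\<kappa> i (h + h')) v = \<rho> i (h + h') v"
        using \<kappa>[OF i, of "h + h'"] g.subspace_add[OF subspace_H that] by simp
      also have "\<dots> = sV (\<kappa> i h + \<kappa> i h') v"
        using i \<kappa> that by (simp add: \<rho>_rules scale_left_distrib)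
      finally show ?thesis using v(1) by simp
    qed
    moreover have "\<kappa> i (sg c h) = c * \<kappa> i h" if "h \<in> H" for c h
    proof -
      have "sV (\<kappa> i (sg c h)) v = \<rho> i (sg c h) v"
        using \<kappa>[OF i, of "sg c h"] g.subspace_scale[OF subspace_H that] by simp
      also have "\<dots> = sV (c * \<kappa> i h) v"
        using i \<kappa> that by (simp add: \<rho>_rules)
      finally show ?thesis using v(1) by simp
    qed
    ultimately show "\<kappa> i \<in> dual" by (auto simp: dual_space_def linear_on_def \<kappa>_def)
  qed
qed

text \<open>Since \<open>w = a v\<close> with \<open>a\<close> from the \<open>i\<close>-th action
  alone, \<open>\<rho> j h\<close> passes through \<open>a\<close> and meets
  \<open>v\<close>.\<close>

lemma orbit_other_weight:
  assumes v: "v \<in> joint \<kappa>" and i: "i < r" and w: "w \<in> orbit {i} v"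
    and j: "j < r" "j \<noteq> i" and h: "h \<in> H"
  shows "\<rho> j h w = sV (\<kappa> j h) w"
proof -
  have J: "{i} \<subseteq> {..<r}" "{j} \<subseteq> {..<r}" using i j by auto
  obtain a where a: "a \<in> alg {i}" "w = a v"
    using w by (rule operator_set.orbitE[OF operators[OF J(1)]])
  have "\<rho> j h w = a (\<rho> j h v)"
    unfolding a(2) using alg_commute[OF J(2,1) _ \<rho>_in_alg[OF J(2)] a(1)] j(2) by auto
  also have "\<dots> = sV (\<kappa> j h) w"
    using jointD[OF v j(1) h] operator_set.alg_rules(2)[OF operators[OF J(1)] a(1)] a(2) by simp
  finally show ?thesis .
qed

text \<open>The other actions of \<open>H\<close> are scalar on the submodule generated by
  \<open>v\<close>, so weights for \<open>act\<close> and for \<open>\<rho> i\<close> differ there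
  by a fixed form.\<close>

lemma orbit_weight_shift:
  assumes "v \<in> joint \<kappa>" "i < r" "w \<in> orbit {i} v" "h \<in> H"
  shows "act h w = \<rho> i h w + sV (\<Sum>j\<in>{..<r} - {i}. \<kappa> j h) w"
proof -
  have "(\<Sum>j\<in>{..<r} - {i}. \<rho> j h w) = (\<Sum>j\<in>{..<r} - {i}. sV (\<kappa> j h) w)"
    using orbit_other_weight[OF assms(1-3) _ _ assms(4)] by (intro sum.cong) auto
  then show ?thesis
    using assms(2) by (simp add: act_def sum.remove[of "{..<r}" i] scale_sum_left)
qed

text \<open>All of \<open>V\<close> is obtained from a submodule \<open>N\<close> of the \<open>i\<close>-th action by means of the other actions, which
  preserve the weights of the \<open>i\<close>-th one; hence all these weights occur in \<open>N\<close>.\<close>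

lemma submodule_meets_joint:
  assumes \<kappa>: "\<And>i. i < r \<Longrightarrow> \<kappa> i \<in> dual" and u: "u \<in> joint \<kappa>" "u \<noteq> 0" and i: "i < r"
    and N: "subspace N" "N \<subseteq> orbit {i} u" "\<And>x w. w \<in> N \<Longrightarrow> \<rho> i x w \<in> N" "N \<noteq> {0}"
  shows "\<exists>w\<in>N \<inter> joint \<kappa>. w \<noteq> 0"
proof (rule ccontr)
  assume none: "\<not> ?thesis"
  \<comment> \<open>\<open>U \<nu>\<close> are the weight spaces of the \<open>i\<close>-th action
    on the whole module, and \<open>Y\<close> is the sum of those for weights other than
    \<open>\<kappa> i\<close>. The aim is to force \<open>u\<close> into \<open>Y\<close>.\<close>
  define U where "U \<nu> = {w. \<forall>h\<in>H. \<rho> i h w = sV (\<nu> h) w}" for \<nu>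
  define I where "I = dual - {\<kappa> i}"
  define Y where "Y = span (\<Union>\<nu>\<in>I. U \<nu>)"
  let ?J = "{..<r} - {i}"
  have subU: "subspace (U \<nu>)" for \<nu>
    by (auto simp: subspace_def U_def \<rho>_rules \<rho>_zero i scale_right_distrib mult.commute)
  have subY: "subspace Y" by (simp add: Y_def)
  define \<kappa>' where "\<kappa>' h = (\<Sum>j\<in>?J. \<kappa> j h)" for h
  have \<kappa>': "\<kappa>' \<in> dual" using dual_space_sum[of ?J \<kappa> sg H] \<kappa> by (simp add: \<kappa>'_def[abs_def])
  have shift: "act h w = \<rho> i h w + sV (\<kappa>' h) w" if "w \<in> N" "h \<in> H" for w h
    unfolding \<kappa>'_def using orbit_weight_shift[OF u(1) i] N(2) that by blast
  have "N \<subseteq> Y"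
  proof
    fix n assume n: "n \<in> N"
    have "act h w \<in> N" if "h \<in> H" "w \<in> N" for h w
      using shift that N(1,3) by (simp add: subspace_add subspace_scale)
    then have "\<exists>F f. finite F \<and> F \<subseteq> dual \<and>
      (\<forall>\<mu>\<in>F. f \<mu> \<noteq> 0 \<and> f \<mu> \<in> N \<and> (\<forall>h\<in>H. act h (f \<mu>) = sV (\<mu> h) (f \<mu>))) \<and> n = (\<Sum>\<mu>\<in>F. f \<mu>)"
      by (intro stable_weight_decomposition[OF N(1) _ n])
    then obtain F f where F: "finite F" "F \<subseteq> dual"
      "\<forall>\<mu>\<in>F. f \<mu> \<noteq> 0 \<and> f \<mu> \<in> N \<and> (\<forall>h\<in>H. act h (f \<mu>) = sV (\<mu> h) (f \<mu>))" "n = (\<Sum>\<mu>\<in>F. f \<mu>)" by blast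
    have f: "f \<mu> \<noteq> 0" "f \<mu> \<in> N" "\<And>h. h \<in> H \<Longrightarrow> act h (f \<mu>) = sV (\<mu> h) (f \<mu>)" if "\<mu> \<in> F" for \<mu>
      using F(3) that by auto
    have "f \<mu> \<in> Y" if \<mu>: "\<mu> \<in> F" for \<mu>
    proof -
      define \<nu> where "\<nu> h = \<mu> h - \<kappa>' h" for h
      have \<nu>: "\<nu> \<in> dual" using dual_space_diff[of \<mu> sg H \<kappa>'] F(2) \<mu> \<kappa>' by (auto simp: \<nu>_def[abs_def])
      have w: "\<rho> i h (f \<mu>) = sV (\<nu> h) (f \<mu>)" if "h \<in> H" for h
        using shift[OF f(2)[OF \<mu>] that] f(3)[OF \<mu> that] by (simp add: \<nu>_def scale_left_diff_distrib)
      \<comment> \<open>A component of this weight would lie in \<open>joint \<kappa>\<close>,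
        because the other actions already have the weights of \<open>u\<close> on
        \<open>N\<close>.\<close>
      have "\<nu> \<noteq> \<kappa> i"
      proof
        assume eq: "\<nu> = \<kappa> i"
        have "f \<mu> \<in> joint \<kappa>"
          unfolding joint_def
        proof (intro CollectI allI impI ballI)
          fix j h assume j: "j < r" "h \<in> H"
          show "\<rho> j h (f \<mu>) = sV (\<kappa> j h) (f \<mu>)"
          proof (cases "j = i")
            case True
            then show ?thesis using w j eq by simp
          next
            case False
            then show ?thesis using orbit_other_weight[OF u(1) i _ j(1) _ j(2)] N(2) f(2)[OF \<mu>] by blast
          qed
        qed
        then show False using none f(1,2)[OF \<mu>] by blast
      qed
      then have "f \<mu> \<in> (\<Union>\<nu>\<in>I. U \<nu>)" using \<nu> w by (auto simp: I_def U_def)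
      then show ?thesis unfolding Y_def by (rule span_base)
    qed
    then show "n \<in> Y" unfolding F(4) by (rule subspace_sum[OF subY])
  qed
  \<comment> \<open>\<open>Z\<close> is stable under every action: \<open>\<rho> i x\<close> passes
    through \<open>b\<close> and acts inside \<open>N\<close>, the other \<open>\<rho> j x\<close>
    are absorbed into \<open>b\<close>. As it contains \<open>N\<close>, it is the whole
    module.\<close>
  define Z where "Z = span {b n | b n. b \<in> alg ?J \<and> n \<in> N}"
  have J: "?J \<subseteq> {..<r}" "{i} \<subseteq> {..<r}" using i by auto
  interpret O: operator_set sV "gens ?J" by (rule operators[OF J(1)])
  have "Z = {0} \<or> Z = UNIV"
  proof (rule jointly_simple)
    show "subspace Z" by (simp add: Z_def)
    fix j x v assume j: "j < r" and v: "v \<in> Z"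
    show "\<rho> j x v \<in> Z"
    proof (rule linear_on_span[OF \<rho>_linear[OF j]])
      show "v \<in> span {b n | b n. b \<in> alg ?J \<and> n \<in> N}" using v by (simp add: Z_def)
      show "subspace Z" by (simp add: Z_def)
      fix w assume "w \<in> {b n | b n. b \<in> alg ?J \<and> n \<in> N}"
      then obtain b n where b: "w = b n" "b \<in> alg ?J" "n \<in> N" by blast
      show "\<rho> j x w \<in> Z"
      proof (cases "j = i")
        case True
        have "\<rho> i x (b n) = b (\<rho> i x n)"
          using alg_commute[OF J(2,1) _ \<rho>_in_alg[OF J(2)] b(2)] by auto
        then show ?thesis using True b N(3) unfolding Z_def by (intro span_base) auto
      next
        case False
        then have "\<rho> j x \<in> alg ?J" using j by (intro \<rho>_in_alg) auto
        then have "(\<lambda>v. \<rho> j x (b v)) \<in> alg ?J" using b(2) by (rule O.alg_mult)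
        then show ?thesis unfolding Z_def b(1) using b(3) by (intro span_base CollectI exI conjI) auto
      qed
    qed
  qed
  moreover have "N \<subseteq> Z"
  proof
    fix n assume "n \<in> N"
    then show "n \<in> Z" unfolding Z_def by (intro span_base CollectI exI[of _ "\<lambda>v. v"] exI[of _ n]) (simp add: O.alg.id)
  qed
  moreover have "0 \<in> N" using N(1) by (rule subspace_0)
  ultimately have "Z = UNIV" using N(4) by blast
  \<comment> \<open>The actions other than the \<open>i\<close>-th commute with
    \<open>\<rho> i h\<close>, so they preserve each \<open>U \<nu>\<close>.\<close>
  moreover have "Z \<subseteq> Y"
    unfolding Z_def
  proof (rule span_minimal[OF _ subY])
    have stable: "f v \<in> Y" if f: "f \<in> gens ?J" and v: "v \<in> Y" for f v
    proof -
      obtain j x where j: "j \<in> ?J" "f = \<rho> j x" using f by blast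
      show ?thesis unfolding j(2)
      proof (rule linear_on_span[OF \<rho>_linear _ subY])
        show "j < r" using j by simp
        show "v \<in> span (\<Union>\<nu>\<in>I. U \<nu>)" using v by (simp add: Y_def)
        fix w assume "w \<in> (\<Union>\<nu>\<in>I. U \<nu>)"
        then obtain \<nu> where \<nu>: "\<nu> \<in> I" "w \<in> U \<nu>" by blast
        have "\<rho> j x w \<in> U \<nu>"
          using \<nu>(2) j commute[OF i, of j] by (auto simp: U_def \<rho>_rules)
        then show "\<rho> j x w \<in> Y" unfolding Y_def using \<nu>(1) by (intro span_base) auto
      qed
    qed
    show "{b n | b n. b \<in> alg ?J \<and> n \<in> N} \<subseteq> Y"
    proof clarify
      fix b n assume b: "b \<in> alg ?J" and n: "n \<in> N"
      show "b n \<in> Y" by (rule O.alg_stable[OF subY _ b]) (use stable n \<open>N \<subseteq> Y\<close> in blast)+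
    qed
  qed
  ultimately have "u \<in> span (\<Union>\<nu>\<in>I. U \<nu>)" by (auto simp: Y_def)
  then obtain F y where F: "finite F" "F \<subseteq> I" "\<forall>\<nu>\<in>F. y \<nu> \<in> U \<nu>" "u = (\<Sum>\<nu>\<in>F. y \<nu>)"
    using span_Union_subspaces[of I U u] subU by blast
  have ni: "\<kappa> i \<notin> F" using F(2) by (auto simp: I_def)
  \<comment> \<open>With \<open>- u\<close> at the weight \<open>\<kappa> i\<close>, weight vectors
    of distinct weights sum to zero; their independence gives \<open>u = 0\<close>.\<close>
  define y' where "y' = y(\<kappa> i := - u)"
  have "(\<Sum>\<nu>\<in>F. y' \<nu>) = u" unfolding F(4) by (rule sum.cong) (use ni in \<open>auto simp: y'_def\<close>)
  then have "(\<Sum>\<nu>\<in>insert (\<kappa> i) F. y' \<nu>) = 0" using F(1) ni by (simp add: y'_def)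
  moreover have "- u \<in> U (\<kappa> i)" using jointD[OF u(1) i] by (intro subspace_neg subU) (simp add: U_def)
  then have "\<forall>\<nu>\<in>insert (\<kappa> i) F. y' \<nu> \<in> U \<nu>" using F(3) by (auto simp: y'_def)
  moreover have "\<exists>h\<in>H. \<mu> h \<noteq> \<nu> h" if "\<mu> \<in> insert (\<kappa> i) F" "\<nu> \<in> insert (\<kappa> i) F" "\<mu> \<noteq> \<nu>" for \<mu> \<nu>
    using that F(2) \<kappa>[OF i] by (intro dual_space_neq[of \<mu> sg]) (auto simp: I_def)
  ultimately have "\<forall>\<nu>\<in>insert (\<kappa> i) F. y' \<nu> \<in> {0}"
    using F(1) \<rho>_linear[OF i] by (intro weight_components[of _ _ H "\<rho> i"]) (auto simp: U_def \<rho>_zero i)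
  then show False using u(2) by (simp add: y'_def)
qed

text \<open>Choose \<open>u\<close> so that its orbit has minimal intersection with
  \<open>joint \<kappa>\<close>. For nonzero \<open>x\<close> in that orbit,
  \<open>submodule_meets_joint\<close> finds a nonzero \<open>w\<close> of joint weight in the orbit
  of \<open>x\<close>; minimality puts \<open>u\<close> into the orbit of \<open>w\<close>, so
  \<open>x\<close> generates \<open>u\<close>.\<close>

lemma irreducible_orbit_exists:
  assumes \<kappa>: "\<And>i. i < r \<Longrightarrow> \<kappa> i \<in> dual" and v: "v \<in> joint \<kappa>" "v \<noteq> 0" and i: "i < r"
  shows "\<exists>u\<in>orbit {i} v \<inter> joint \<kappa>. u \<noteq> 0 \<and> irreducible_under {i} (orbit {i} u)"
proof -
  have J: "{i} \<subseteq> {..<r}" using i by simp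
  interpret O: operator_set sV "gens {i}" by (rule operators[OF J])
  define K where "K = {O.orbit u \<inter> joint \<kappa> | u. u \<in> O.orbit v \<inter> joint \<kappa> \<and> u \<noteq> 0}"
  obtain B where B: "finite B" "joint \<kappa> \<subseteq> span B" using joint_finite_dimensional \<kappa> by blast
  have "O.orbit v \<inter> joint \<kappa> \<in> K" using v O.orbit_refl by (auto simp: K_def)
  then have "K \<noteq> {}" by blast
  moreover have "subspace S \<and> S \<subseteq> span B" if "S \<in> K" for S
    using that B(2) O.subspace_orbit subspace_joint by (auto simp: K_def intro!: subspace_inter)
  ultimately obtain S where S: "S \<in> K" "\<And>T. T \<in> K \<Longrightarrow> T \<subseteq> S \<Longrightarrow> T = S"
    using minimal_subspace_exists[of K B] B(1) by meson
  then obtain u where u: "S = O.orbit u \<inter> joint \<kappa>" "u \<in> O.orbit v" "u \<in> joint \<kappa>" "u \<noteq> 0"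
    by (auto simp: K_def)
  have "O.orbit x = O.orbit u" if x: "x \<in> O.orbit u" "x \<noteq> 0" for x
  proof
    show sub: "O.orbit x \<subseteq> O.orbit u" using x(1) by (rule O.orbit_trans)
    have "O.orbit x \<noteq> {0}" using x(2) O.orbit_refl[of x] by auto
    then obtain w where w: "w \<in> O.orbit x" "w \<in> joint \<kappa>" "w \<noteq> 0"
      using submodule_meets_joint[OF \<kappa> u(3,4) i O.subspace_orbit sub] orbit_\<rho>_stable[OF i] by blast
    have wu: "O.orbit w \<subseteq> O.orbit u" using w(1) sub by (intro O.orbit_trans) auto
    then have "O.orbit w \<inter> joint \<kappa> \<in> K"
      using w(2,3) O.orbit_refl[of w] O.orbit_trans[OF u(2)] by (auto simp: K_def)
    then have "O.orbit w \<inter> joint \<kappa> = S" by (rule S(2)) (use u(1) wu in auto)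
    then have "u \<in> O.orbit w" using u(1,3) O.orbit_refl[of u] by blast
    then have "u \<in> O.orbit x" using O.orbit_trans[OF w(1)] by blast
    then show "O.orbit u \<subseteq> O.orbit x" by (rule O.orbit_trans)
  qed
  moreover have "O.orbit u \<noteq> {0}" using u(4) O.orbit_refl[of u] by auto
  ultimately have "O.irreducible_subspace (O.orbit u)"
    unfolding O.irreducible_subspace_def using O.subspace_orbit by blast
  then show ?thesis using u by blast
qed

text \<open>The factors are treated one after another. Passing to \<open>a u\<close> with
  \<open>a\<close> from factor \<open>m\<close> keeps the orbits for earlier factors irreducible,
  since \<open>a\<close> commutes with those actions.\<close>

lemma irreducible_generator_exists:
  assumes \<kappa>: "\<And>i. i < r \<Longrightarrow> \<kappa> i \<in> dual" and v: "v \<in> joint \<kappa>" "v \<noteq> 0"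
  shows "\<exists>u\<in>joint \<kappa>. u \<noteq> 0 \<and> (\<forall>i<r. irreducible_under {i} (orbit {i} u))"
proof -
  have "\<exists>u\<in>joint \<kappa>. u \<noteq> 0 \<and> (\<forall>i<m. irreducible_under {i} (orbit {i} u))" if "m \<le> r" for m
    using that
  proof (induction m)
    case 0
    then show ?case using v by auto
  next
    case (Suc m)
    then obtain u where u: "u \<in> joint \<kappa>" "u \<noteq> 0" "\<And>i. i < m \<Longrightarrow> irreducible_under {i} (orbit {i} u)" by auto
    have m: "m < r" "{m} \<subseteq> {..<r}" using Suc.prems by auto
    obtain u' where u': "u' \<in> orbit {m} u" "u' \<in> joint \<kappa>" "u' \<noteq> 0" "irreducible_under {m} (orbit {m} u')"
      using irreducible_orbit_exists[OF \<kappa> u(1,2) m(1)] by blast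
    obtain a where a: "a \<in> alg {m}" "u' = a u"
      using u'(1) by (rule operator_set.orbitE[OF operators[OF m(2)]])
    have "irreducible_under {i} (orbit {i} u')" if i: "i < m" for i
    proof -
      have J: "{i} \<subseteq> {..<r}" using i m by auto
      interpret O: operator_set sV "gens {i}" by (rule operators[OF J])
      have "a (f x) = f (a x)" if "f \<in> gens {i}" for f x
        using alg_commute[OF m(2) J _ a(1) O.alg_gen[OF that]] i by auto
      then show ?thesis
        unfolding a(2) using O.irreducible_image(1)[OF u(3)[OF i] alg_linear[OF m(2) a(1)]] u'(3) a(2) by blast
    qed
    then have "\<forall>i<Suc m. irreducible_under {i} (orbit {i} u')" using u'(4) by (auto simp: less_Suc_eq)
    then show ?case using u'(2,3) by blast
  qed
  then show ?thesis by blast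
qed

end

declare plus_fun_apply [simp del] zero_fun_apply [simp del]

section \<open>The tensor product of the generated submodules\<close>

text \<open>The operator \<open>a 0\<close> is applied first; the operators used below belong to
  different factors and commute.\<close>

fun product_op :: "nat \<Rightarrow> (nat \<Rightarrow> 'v \<Rightarrow> 'v) \<Rightarrow> 'v \<Rightarrow> 'v" where
  "product_op 0 a v = v"
| "product_op (Suc m) a v = a m (product_op m a v)"

lemma product_op_cong: "(\<And>i. i < m \<Longrightarrow> a i = a' i) \<Longrightarrow> product_op m a v = product_op m a' v"
  by (induction m) auto

text \<open>Multilinearity expands one slot after another in the given spanning sets.\<close>

lemma mtensor_spanned_by_bases:
  fixes sW :: "'k::field \<Rightarrow> 'w::ab_group_add \<Rightarrow> 'w"
  assumes W: "vector_space sW" "\<And>i. i < r \<Longrightarrow> subspace_of sW (W i)"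
    and B: "\<And>i. i < r \<Longrightarrow> B i \<subseteq> W i" "\<And>i. i < r \<Longrightarrow> W i \<subseteq> span_of sW (B i)"
  shows "mtensor sW r W \<subseteq> span_of tscale (mtens sW r W ` Pi\<^sub>E {..<r} B)"
proof -
  interpret W: vector_space sW by fact
  interpret E: vector_space "tscale :: 'k \<Rightarrow> (((nat \<Rightarrow> 'w) \<Rightarrow> 'k) \<Rightarrow> 'k) \<Rightarrow> _" by (rule vector_space_tscale)
  define S where "S = E.span (mtens sW r W ` Pi\<^sub>E {..<r} B)"
  have subS: "E.subspace S" by (simp add: S_def)
  have "mtens sW r W w \<in> S" if "m \<le> r" "w \<in> Pi\<^sub>E {..<r} W" "\<forall>i. m \<le> i \<and> i < r \<longrightarrow> w i \<in> B i" for m w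
    using that
  proof (induction m arbitrary: w)
    case 0
    then have "w \<in> Pi\<^sub>E {..<r} B" by (auto simp: PiE_iff)
    then show ?case unfolding S_def by (intro E.span_base imageI)
  next
    case (Suc m)
    have m: "m < r" using Suc.prems(1) by simp
    have upd: "w(m := u) \<in> Pi\<^sub>E {..<r} W" if "u \<in> W m" for u
      using that Suc.prems(2) m by (auto simp: PiE_iff extensional_def)
    define g where "g u = mtens sW r W (w(m := u))" for u
    have lin: "linear_on sW (W m) tscale UNIV g"
      using multilinear_mtens m Suc.prems(2) unfolding multilinear_map_def g_def[abs_def] by blast
    have base: "g u \<in> S" if u: "u \<in> B m" for u
      unfolding g_def
    proof (rule Suc.IH)
      show "w(m := u) \<in> Pi\<^sub>E {..<r} W" using u B(1)[OF m] by (intro upd) auto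
    qed (use m u Suc.prems(3) in auto)
    have subW: "W.subspace (W m)" using W(2) m by simp
    have "u \<in> W m \<and> g u \<in> S" if "u \<in> W.span (B m)" for u
      using that
    proof (induction rule: W.span_induct_alt)
      case base
      have z: "0 \<in> W m" using subW by (rule W.subspace_0)
      have "g 0 = 0" using linear_onD(3)[OF lin z, of 0] by simp
      then show ?case using z E.subspace_0[OF subS] by metis
    next
      case (step c x y)
      have x: "x \<in> W m" using step(1) B(1)[OF m] by auto
      have cx: "sW c x \<in> W m" "sW c x + y \<in> W m"
        using x step(2) subW by (auto intro: W.subspace_add W.subspace_scale)
      have "g (sW c x + y) = tscale c (g x) + g y"
        using linear_onD(2)[OF lin cx(1), of y] linear_onD(3)[OF lin x] step(2) by metis
      also have "\<dots> \<in> S"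
        using step(2) base[OF step(1)] by (intro E.subspace_add[OF subS] E.subspace_scale[OF subS]) auto
      finally show ?case using cx(2) by (rule conjI[rotated])
    qed
    then have "g (w m) \<in> S" using B(2)[OF m] Suc.prems(2) m by blast
    then show ?case by (simp add: g_def)
  qed
  from this[OF order_refl] have "mtens sW r W ` Pi\<^sub>E {..<r} W \<subseteq> S"
    by (intro image_subsetI) (meson not_le)
  then have "E.span (mtens sW r W ` Pi\<^sub>E {..<r} W) \<subseteq> S" using subS by (rule E.span_minimal)
  then show ?thesis by (simp add: mtensor_def S_def)
qed

text \<open>The difference of two decompositions is a vanishing sum of weight vectors, so
  \<open>weight_components\<close> with \<open>{0}\<close> turns existence into unique
  existence.\<close>

lemma (in vector_space) weight_decompositionI:
  assumes V: "subspace V"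
    and act: "\<And>h. h \<in> H \<Longrightarrow> linear_on scale UNIV scale UNIV (act h)"
    and ex: "\<And>v. v \<in> V \<Longrightarrow> \<exists>F f. finite F \<and> F \<subseteq> dual_space s H \<and>
      (\<forall>\<mu>\<in>F. f \<mu> \<in> weight_space H scale V act \<mu>) \<and> v = (\<Sum>\<mu>\<in>F. f \<mu>)"
    and fin: "\<And>\<mu>. \<mu> \<in> dual_space s H \<Longrightarrow> fin_dim scale (weight_space H scale V act \<mu>)"
  shows "weight_decomposition s H scale V act"
  unfolding weight_decomposition_def internal_direct_sum_def
proof (intro conjI ballI)
  fix \<mu> assume "\<mu> \<in> dual_space s H"
  then show "fin_dim scale (weight_space H scale V act \<mu>)" by (rule fin)
  show "weight_space H scale V act \<mu> \<subseteq> V" by (auto simp: weight_space_def)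
next
  fix v assume v: "v \<in> V"
  let ?P = "\<lambda>f. finite {\<mu>. f \<mu> \<noteq> 0} \<and> (\<forall>\<mu>\<in>dual_space s H. f \<mu> \<in> weight_space H scale V act \<mu>) \<and>
    (\<forall>\<mu>. \<mu> \<notin> dual_space s H \<longrightarrow> f \<mu> = 0) \<and> v = (\<Sum>\<mu> | f \<mu> \<noteq> 0. f \<mu>)"
  have act0: "act h 0 = 0" if "h \<in> H" for h using linear_onD(3)[OF act[OF that], of 0 0] by simp
  obtain F f where f: "finite F" "F \<subseteq> dual_space s H" "\<forall>\<mu>\<in>F. f \<mu> \<in> weight_space H scale V act \<mu>"
    "v = (\<Sum>\<mu>\<in>F. f \<mu>)" using ex[OF v] by blast
  let ?f = "\<lambda>\<mu>. if \<mu> \<in> F then f \<mu> else 0"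
  show "\<exists>!f. ?P f"
  proof (rule ex1I[of _ ?f])
    have "v = (\<Sum>\<mu>\<in>F. ?f \<mu>)" using f(4) by simp
    also have "\<dots> = (\<Sum>\<mu> | ?f \<mu> \<noteq> 0. ?f \<mu>)" using f(1) by (intro sum.mono_neutral_right) auto
    finally have sum: "v = (\<Sum>\<mu> | ?f \<mu> \<noteq> 0. ?f \<mu>)" .
    have "{\<mu>. ?f \<mu> \<noteq> 0} \<subseteq> F" by auto
    then have "finite {\<mu>. ?f \<mu> \<noteq> 0}" using f(1) by (rule finite_subset)
    moreover have "\<forall>\<mu>\<in>dual_space s H. ?f \<mu> \<in> weight_space H scale V act \<mu>"
      using f(3) act0 subspace_0[OF V] by (auto simp: weight_space_def)
    moreover have "\<forall>\<mu>. \<mu> \<notin> dual_space s H \<longrightarrow> ?f \<mu> = 0" using f(2) by auto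
    ultimately show "?P ?f" using sum by blast
  next
    fix g assume g: "?P g"
    let ?G = "F \<union> {\<mu>. g \<mu> \<noteq> 0}"
    have fin_g: "finite {\<mu>. g \<mu> \<noteq> 0}" and v_g: "v = (\<Sum>\<mu> | g \<mu> \<noteq> 0. g \<mu>)" using g by auto
    have "(\<Sum>\<mu> | g \<mu> \<noteq> 0. g \<mu>) = (\<Sum>\<mu>\<in>?G. g \<mu>)"
      by (rule sum.mono_neutral_left) (use fin_g f(1) in auto)
    with v_g have sum_g: "v = (\<Sum>\<mu>\<in>?G. g \<mu>)" by simp
    have "v = (\<Sum>\<mu>\<in>F. ?f \<mu>)" using f(4) by simp
    also have "\<dots> = (\<Sum>\<mu>\<in>?G. ?f \<mu>)" using fin_g f(1) by (intro sum.mono_neutral_left) auto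
    finally have "(\<Sum>\<mu>\<in>?G. g \<mu> - ?f \<mu>) = 0" using sum_g by (simp add: sum_subtractf)
    moreover have dual: "?G \<subseteq> dual_space s H" using f(2) g by blast
    have "act h (g \<mu> - ?f \<mu>) = scale (\<mu> h) (g \<mu> - ?f \<mu>)" if "\<mu> \<in> ?G" "h \<in> H" for \<mu> h
    proof -
      have "act h x = scale (\<mu> h) x" if "x \<in> weight_space H scale V act \<mu>" for x
        using that \<open>h \<in> H\<close> by (auto simp: weight_space_def)
      moreover have "g \<mu> \<in> weight_space H scale V act \<mu>" using g dual that by blast
      ultimately have "act h (g \<mu>) = scale (\<mu> h) (g \<mu>)" "act h (?f \<mu>) = scale (\<mu> h) (?f \<mu>)"
        using f(3) act0 that by auto
      moreover have "act h (g \<mu> - ?f \<mu>) = act h (g \<mu>) - act h (?f \<mu>)"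
        using linear_onD(2)[OF act[OF \<open>h \<in> H\<close>], of "g \<mu> - ?f \<mu>" "?f \<mu>"] by simp
      ultimately show ?thesis by (simp add: scale_right_diff_distrib)
    qed
    moreover have "\<exists>h\<in>H. \<mu> h \<noteq> \<nu> h" if "\<mu> \<in> ?G" "\<nu> \<in> ?G" "\<mu> \<noteq> \<nu>" for \<mu> \<nu>
      using dual_space_neq[of \<mu> s H \<nu>] dual that by blast
    ultimately have zero: "\<forall>\<mu>\<in>?G. g \<mu> - ?f \<mu> \<in> {0}"
      using f(1) g act0 by (intro weight_components[of _ _ H act] act) auto
    show "g = ?f"
    proof (rule ext)
      fix \<mu>
      show "g \<mu> = ?f \<mu>"
      proof (cases "\<mu> \<in> ?G")
        case True
        then have "g \<mu> - ?f \<mu> \<in> {0}" by (rule bspec[OF zero])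
        then show ?thesis by (simp split: if_splits)
      qed simp
    qed
  qed
qed

section \<open>Simple submodules generated by one vector under the separate actions\<close>

locale irreducible_generator = commuting_modules sV sg br H r \<rho>
  for sV :: "'k::alg_closed_field \<Rightarrow> 'v::ab_group_add \<Rightarrow> 'v"
    and sg :: "'k \<Rightarrow> 'g::ab_group_add \<Rightarrow> 'g" and br H r \<rho> +
  fixes \<kappa> :: "nat \<Rightarrow> 'g \<Rightarrow> 'k" and v0 :: 'v
  assumes dual: "i < r \<Longrightarrow> \<kappa> i \<in> dual_space sg H"
    and generator: "v0 \<in> joint \<kappa>" "v0 \<noteq> 0"
    and irreducible: "i < r \<Longrightarrow> irreducible_under {i} (orbit {i} v0)"
begin

definition W where "W i = orbit {i} v0"

lemma operators1: "i < r \<Longrightarrow> operator_set sV (gens {i})"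
  by (rule operators) simp

lemma subspace_W: "i < r \<Longrightarrow> subspace (W i)"
  unfolding W_def by (rule operator_set.subspace_orbit[OF operators1])

lemma generator_in_W: "i < r \<Longrightarrow> v0 \<in> W i"
  unfolding W_def by (rule operator_set.orbit_refl[OF operators1])

lemma \<rho>_W: "\<lbrakk>i < r; w \<in> W i\<rbrakk> \<Longrightarrow> \<rho> i x w \<in> W i"
  unfolding W_def by (rule orbit_\<rho>_stable)

lemma alg_W: "\<lbrakk>i < r; a \<in> alg {i}; w \<in> W i\<rbrakk> \<Longrightarrow> a w \<in> W i"
  unfolding W_def by (rule operator_set.orbit_stable[OF operators1])

theorem simple_W:
  assumes i: "i < r"
  shows "simple_lie_module sg UNIV br sV (W i) (\<rho> i)"
proof -
  interpret M: lie_module sg UNIV br sV UNIV "\<rho> i" by (rule lie_modules[OF i])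
  interpret O: operator_set sV "gens {i}" by (rule operators1[OF i])
  show ?thesis
  proof unfold_locales
    show "subspace (W i)" by (rule subspace_W[OF i])
    show "linear_on sV (W i) sV (W i) (\<rho> i x)" for x
      using \<rho>_W[OF i] \<rho>_rules[OF i] by (auto simp: linear_on_def)
    show "linear_on sg UNIV sV (W i) (\<lambda>x. \<rho> i x v)" if "v \<in> W i" for v
      using \<rho>_W[OF i that] \<rho>_rules[OF i] by (auto simp: linear_on_def)
    show "\<rho> i (br x y) v = \<rho> i x (\<rho> i y v) - \<rho> i y (\<rho> i x v)" for x y v
      by (rule M.bracket_action) auto
    show "W i \<noteq> {0}" using generator_in_W[OF i] generator(2) by blast
    fix U assume U: "subspace U" "U \<subseteq> W i" "\<And>x u. \<lbrakk>x \<in> UNIV; u \<in> U\<rbrakk> \<Longrightarrow> \<rho> i x u \<in> U"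
    show "U = {0} \<or> U = W i"
    proof (cases "U = {0}")
      case False
      then obtain u where u: "u \<in> U" "u \<noteq> 0" using subspace_0[OF U(1)] by blast
      then have "O.orbit u = W i"
        using irreducible[OF i] U(2) unfolding O.irreducible_subspace_def W_def by blast
      moreover have "O.orbit u \<subseteq> U" using U(1,3) u(1) by (intro O.orbit_minimal) auto
      ultimately show ?thesis using U(2) by blast
    qed simp
  qed
qed

text \<open>By \<open>orbit_weight_shift\<close>, weights for \<open>\<rho> i\<close> on
  \<open>W i\<close> are weights for \<open>act\<close> moved by a fixed form; existence of
  decompositions and finite dimension are transported along this shift.\<close>

theorem weights_W:
  assumes i: "i < r"
  shows "weight_decomposition sg H sV (W i) (\<rho> i)"
proof (rule weight_decompositionI[OF subspace_W[OF i] \<rho>_linear[OF i]])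
  define \<kappa>' where "\<kappa>' h = (\<Sum>j\<in>{..<r} - {i}. \<kappa> j h)" for h
  have \<kappa>': "\<kappa>' \<in> dual_space sg H"
    using dual_space_sum[of "{..<r} - {i}" \<kappa> sg H] dual by (simp add: \<kappa>'_def[abs_def])
  have shift: "act h w = \<rho> i h w + sV (\<kappa>' h) w" if "w \<in> W i" "h \<in> H" for w h
    unfolding \<kappa>'_def using orbit_weight_shift[OF generator(1) i] that by (simp add: W_def)
  {
    fix \<mu> assume \<mu>: "\<mu> \<in> dual_space sg H"
    have "weight_space H sV (W i) (\<rho> i) \<mu> \<subseteq> weight_space H sV UNIV act (\<lambda>h. \<mu> h + \<kappa>' h)"
      using shift by (auto simp: weight_space_def scale_left_distrib)
    moreover have "fin_dim sV (weight_space H sV UNIV act (\<lambda>h. \<mu> h + \<kappa>' h))"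
      by (intro fin_dim_weight_space dual_space_add \<mu> \<kappa>')
    moreover have "subspace (weight_space H sV (W i) (\<rho> i) \<mu>)"
      using subspace_W[OF i]
      by (auto simp: weight_space_def subspace_def \<rho>_rules[OF i] \<rho>_zero[OF i] scale_right_distrib mult.commute)
    ultimately show "fin_dim sV (weight_space H sV (W i) (\<rho> i) \<mu>)"
      using fin_dim_iff_subspace unfolding fin_dim_def by metis
  next
    fix v assume v: "v \<in> W i"
    have "act h w \<in> W i" if "h \<in> H" "w \<in> W i" for h w
      using shift that subspace_W[OF i] \<rho>_W[OF i] by (simp add: subspace_add subspace_scale)
    then have "\<exists>F f. finite F \<and> F \<subseteq> dual_space sg H \<and>
      (\<forall>\<mu>\<in>F. f \<mu> \<noteq> 0 \<and> f \<mu> \<in> W i \<and> (\<forall>h\<in>H. act h (f \<mu>) = sV (\<mu> h) (f \<mu>))) \<and> v = (\<Sum>\<mu>\<in>F. f \<mu>)"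
      by (intro stable_weight_decomposition[OF subspace_W[OF i] _ v])
    then obtain F f where F: "finite F" "F \<subseteq> dual_space sg H"
      "\<forall>\<mu>\<in>F. f \<mu> \<noteq> 0 \<and> f \<mu> \<in> W i \<and> (\<forall>h\<in>H. act h (f \<mu>) = sV (\<mu> h) (f \<mu>))" "v = (\<Sum>\<mu>\<in>F. f \<mu>)" by blast
    define d where "d \<mu> = (\<lambda>h. \<mu> h - \<kappa>' h)" for \<mu> :: "'g \<Rightarrow> 'k"
    define e where "e \<nu> = (\<lambda>h. \<nu> h + \<kappa>' h)" for \<nu> :: "'g \<Rightarrow> 'k"
    have ed: "e (d \<mu>) = \<mu>" for \<mu> by (simp add: d_def e_def)
    then have inj: "inj_on d F" by (metis inj_onI)
    show "\<exists>F f. finite F \<and> F \<subseteq> dual_space sg H \<and>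
      (\<forall>\<mu>\<in>F. f \<mu> \<in> weight_space H sV (W i) (\<rho> i) \<mu>) \<and> v = (\<Sum>\<mu>\<in>F. f \<mu>)"
    proof (intro exI[of _ "d ` F"] exI[of _ "\<lambda>\<nu>. f (e \<nu>)"] conjI ballI)
      show "finite (d ` F)" using F(1) by simp
      show "d ` F \<subseteq> dual_space sg H" using F(2) \<kappa>' by (auto simp: d_def intro: dual_space_diff)
      show "v = (\<Sum>\<nu>\<in>d ` F. f (e \<nu>))" by (simp add: F(4) sum.reindex[OF inj] ed)
      fix \<nu> assume "\<nu> \<in> d ` F"
      then obtain \<mu> where \<mu>: "\<mu> \<in> F" "\<nu> = d \<mu>" by blast
      have "\<rho> i h (f \<mu>) = sV (d \<mu> h) (f \<mu>)" if "h \<in> H" for h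
        using shift[of "f \<mu>" h] F(3) \<mu>(1) that by (auto simp: d_def scale_left_diff_distrib)
      then show "f (e \<nu>) \<in> weight_space H sV (W i) (\<rho> i) \<nu>"
        using F(3) \<mu> by (simp add: ed weight_space_def)
    qed
  }
qed

text \<open>To apply \<open>density\<close>, an endomorphism of \<open>W i\<close> has to be scalar.
  It preserves the finite-dimensional space \<open>W i \<inter> joint \<kappa>\<close>, which
  contains \<open>v0\<close>, so it has an eigenvector there and \<open>schur\<close>
  applies.\<close>

lemma density_W:
  assumes i: "i < r" and F: "finite F" "F \<subseteq> W i" "u \<in> W i" "u \<notin> span F"
  shows "\<exists>a\<in>alg {i}. (\<forall>x\<in>F. a x = 0) \<and> a u \<noteq> 0"
proof -
  interpret O: operator_set sV "gens {i}" by (rule operators1[OF i])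
  have irr: "O.irreducible_subspace (W i)" using irreducible[OF i] by (simp add: W_def)
  show ?thesis
  proof (rule O.density[OF irr _ F])
    fix f assume f: "linear_on sV (W i) sV (W i) f" and comm: "\<And>a w. \<lbrakk>a \<in> O.alg; w \<in> W i\<rbrakk> \<Longrightarrow> f (a w) = a (f w)"
    let ?U = "W i \<inter> joint \<kappa>"
    obtain B where B: "finite B" "joint \<kappa> \<subseteq> span B" using joint_finite_dimensional dual by blast
    have "f w \<in> ?U" if w: "w \<in> ?U" for w
    proof
      show fw: "f w \<in> W i" using linear_onD(1)[OF f] w by simp
      show "f w \<in> joint \<kappa>"
        unfolding joint_def
      proof (intro CollectI allI impI ballI)
        fix j h assume j: "j < r" "h \<in> H"
        show "\<rho> j h (f w) = sV (\<kappa> j h) (f w)"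
        proof (cases "j = i")
          case True
          have "\<rho> i h \<in> O.alg" by (rule O.alg_gen) simp
          then have "\<rho> i h (f w) = f (\<rho> i h w)" using comm w by simp
          also have "\<dots> = sV (\<kappa> i h) (f w)"
            using jointD[of w \<kappa> i h] w i j(2) linear_onD(3)[OF f] by simp
          finally show ?thesis using True by simp
        next
          case False
          show ?thesis using fw j False by (intro orbit_other_weight[OF generator(1) i]) (auto simp: W_def)
        qed
      qed
    qed
    then have fU: "linear_on sV ?U sV ?U f" using linear_onD(2,3)[OF f] by (simp add: linear_on_def)
    have "v0 \<in> ?U" using generator(1) generator_in_W[OF i] by simp
    then have "?U \<noteq> {0}" using generator(2) by blast
    moreover have "subspace ?U" by (intro subspace_inter subspace_W[OF i] subspace_joint)
    moreover have "?U \<subseteq> span B" using B(2) by blast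
    ultimately obtain c x where x: "x \<in> ?U" "x \<noteq> 0" "f x = sV c x"
      using eigenvector_exists[OF vector_space_axioms _ _ _ B(1) fU] by blast
    have "f w = sV c w" if "w \<in> W i" for w
      using O.schur[OF irr comm _ x(2,3) that] x(1) by blast
    then show "\<exists>c. \<forall>w\<in>W i. f w = sV c w" by blast
  qed
qed

section \<open>Products of operators that belong to different factors\<close>

lemma alg_mono:
  assumes "J \<subseteq> K" "K \<subseteq> {..<r}" "a \<in> alg J"
  shows "a \<in> alg K"
proof -
  interpret J: operator_set sV "gens J" using assms by (intro operators) auto
  interpret K: operator_set sV "gens K" using assms by (intro operators) auto
  show ?thesis using assms(3) by (induction rule: J.alg.induct) (use assms(1) in \<open>auto intro: K.alg.intros\<close>)
qed

lemma product_op_in_alg: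
  assumes J: "J \<subseteq> {..<r}"
  shows "(\<And>j. j < m \<Longrightarrow> a j \<in> alg J) \<Longrightarrow> product_op m a \<in> alg J"
proof (induction m)
  case 0
  then show ?case using operator_set.alg.id[OF operators[OF J]] by simp
next
  case (Suc m)
  then show ?case using operator_set.alg_mult[OF operators[OF J], of "a m" "product_op m a"] by simp
qed

lemma product_op_lessThan:
  assumes "m \<le> r" "\<And>j. j < m \<Longrightarrow> a j \<in> alg {j}"
  shows "product_op m a \<in> alg {..<m}"
proof (rule product_op_in_alg)
  show "a j \<in> alg {..<m}" if "j < m" for j by (rule alg_mono[of "{j}"]) (use assms that in auto)
qed (use assms in auto)

lemma product_op_commute:
  assumes "i < r" "m \<le> i" "\<And>j. j < m \<Longrightarrow> a j \<in> alg {j}" "f \<in> alg {i}"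
  shows "f (product_op m a v) = product_op m a (f v)"
proof -
  have "product_op m a \<in> alg {..<m}" using assms by (intro product_op_lessThan) auto
  then show ?thesis using assms(1,2,4) by (intro alg_commute[of "{i}" "{..<m}"]) auto
qed

text \<open>Commutation moves the operator of slot \<open>i\<close> to the innermost place, which
  isolates how the product depends on that slot.\<close>

lemma product_op_slot:
  assumes "i < m" "m \<le> r" "\<And>j. j < m \<Longrightarrow> a j \<in> alg {j}"
  shows "product_op m a v = product_op m (a(i := \<lambda>v. v)) (a i v)"
  using assms
proof (induction m)
  case (Suc m)
  show ?case
  proof (cases "i = m")
    case True
    have "product_op m (a(m := \<lambda>v. v)) x = product_op m a x" for x by (rule product_op_cong) auto
    moreover have "a m (product_op m a v) = product_op m a (a m v)"
      using Suc.prems by (intro product_op_commute) auto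
    ultimately show ?thesis by (simp only: True product_op.simps fun_upd_same)
  next
    case False
    then have "product_op m a v = product_op m (a(i := \<lambda>v. v)) (a i v)"
      by (intro Suc.IH) (use Suc.prems in auto)
    moreover have "(a(i := \<lambda>v. v)) m = a m" using False by simp
    ultimately show ?thesis by (simp only: product_op.simps)
  qed
qed simp

lemma product_op_compose:
  assumes "m \<le> r" "\<And>j. j < m \<Longrightarrow> a j \<in> alg {j}" "\<And>j. j < m \<Longrightarrow> c j \<in> alg {j}"
  shows "product_op m (\<lambda>j v. a j (c j v)) v = product_op m a (product_op m c v)"
  using assms
proof (induction m)
  case (Suc m)
  have "c m (product_op m a x) = product_op m a (c m x)" for x
    using Suc.prems by (intro product_op_commute) auto
  then show ?case using Suc by simp
qed simp

text \<open>Each \<open>a j\<close> can be moved next to \<open>v0\<close> and exchanged there for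
  \<open>c j\<close>. This makes \<open>mul\<close> independent of chosen representatives.\<close>

lemma product_op_generator_cong:
  assumes "m \<le> r" "\<And>j. j < m \<Longrightarrow> a j \<in> alg {j}" "\<And>j. j < m \<Longrightarrow> c j \<in> alg {j}"
    "\<And>j. j < m \<Longrightarrow> a j v0 = c j v0"
  shows "product_op m a v0 = product_op m c v0"
  using assms
proof (induction m)
  case (Suc m)
  have "a m (product_op m c v0) = product_op m c (a m v0)"
    using Suc.prems by (intro product_op_commute) auto
  also have "\<dots> = product_op m c (c m v0)" using Suc.prems(4) by simp
  also have "\<dots> = c m (product_op m c v0)"
    by (rule product_op_commute[symmetric]) (use Suc.prems in auto)
  finally show ?case using Suc by simp
qed simp

text \<open>The product over the first \<open>m\<close> factors commutes with factor
  \<open>m\<close> and does not kill \<open>v0\<close>; by \<open>irreducible_image\<close> it kills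
  no nonzero vector of the orbit of \<open>v0\<close> under that factor.\<close>

lemma product_op_nonzero:
  assumes "m \<le> r" "\<And>j. j < m \<Longrightarrow> c j \<in> alg {j}" "\<And>j. j < m \<Longrightarrow> c j v0 \<noteq> 0"
  shows "product_op m c v0 \<noteq> 0"
  using assms
proof (induction m)
  case 0
  then show ?case using generator(2) by simp
next
  case (Suc m)
  have m: "m < r" using Suc.prems by simp
  interpret O: operator_set sV "gens {m}" by (rule operators1[OF m])
  have c: "c m \<in> O.alg" using Suc.prems by simp
  have Q: "product_op m c \<in> alg {..<m}" using Suc.prems by (intro product_op_lessThan) auto
  have sub: "{..<m} \<subseteq> {..<r}" using m by auto
  have "product_op m c (c m v0) \<noteq> 0"
  proof (rule O.irreducible_image(2)[OF irreducible[OF m] alg_linear[OF sub Q]])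
    show "product_op m c (f x) = f (product_op m c x)" if "f \<in> gens {m}" for f x
      by (rule product_op_commute[symmetric]) (use m Suc.prems O.alg_gen[OF that] in auto)
    show "product_op m c v0 \<noteq> 0" using Suc by simp
    show "c m v0 \<in> O.orbit v0" using c by (rule O.orbitI)
    show "c m v0 \<noteq> 0" using Suc.prems by simp
  qed
  then show ?case using product_op_commute[OF m order_refl _ c] Suc.prems by simp
qed

text \<open>The map \<open>a\<^sub>0 v\<^sub>0 \<otimes> \<dots> \<otimes> a\<^sub>r\<^sub>-\<^sub>1 v\<^sub>0 \<mapsto> a\<^sub>0 \<dots> a\<^sub>r\<^sub>-\<^sub>1 v\<^sub>0\<close>; it does not depend on the choice of the \<open>a\<^sub>i\<close> because
  they commute.\<close>

definition rep where "rep i w = (SOME a. a \<in> alg {i} \<and> a v0 = w)"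
definition mul where "mul w = product_op r (\<lambda>i. rep i (w i)) v0"

lemma rep: assumes "i < r" "w \<in> W i" shows "rep i w \<in> alg {i}" "rep i w v0 = w"
proof -
  have "\<exists>a. a \<in> alg {i} \<and> a v0 = w"
    using operator_set.orbitE[OF operators1[OF assms(1)]] assms(2) unfolding W_def by metis
  then have "rep i w \<in> alg {i} \<and> rep i w v0 = w" unfolding rep_def by (rule someI_ex)
  then show "rep i w \<in> alg {i}" "rep i w v0 = w" by auto
qed

lemma mul_eq:
  assumes "\<And>i. i < r \<Longrightarrow> a i \<in> alg {i}" "\<And>i. i < r \<Longrightarrow> w i = a i v0"
  shows "mul w = product_op r a v0"
proof -
  have w: "w i \<in> W i" if "i < r" for i
    using operator_set.orbitI[OF operators1[OF that] assms(1)[OF that]] assms(2)[OF that] by (simp add: W_def)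
  show ?thesis unfolding mul_def
    by (rule product_op_generator_cong) (use rep[OF _ w] assms in auto)
qed

text \<open>Composing \<open>a i\<close> with \<open>rep i (w i)\<close> produces
  \<open>a i (w i)\<close> from \<open>v0\<close>. This serves to suppress all but one term of a
  linear relation.\<close>

lemma mul_apply:
  assumes w: "w \<in> Pi\<^sub>E {..<r} W" and a: "\<And>i. i < r \<Longrightarrow> a i \<in> alg {i}" and w': "\<And>i. i < r \<Longrightarrow> w' i = a i (w i)"
  shows "mul w' = product_op r a (mul w)"
proof -
  have wi: "rep i (w i) \<in> alg {i}" "rep i (w i) v0 = w i" if "i < r" for i
    using rep[OF that, of "w i"] w that by auto
  have "(\<lambda>v. a i (rep i (w i) v)) \<in> alg {i}" if "i < r" for i
    by (rule operator_set.alg_mult[OF operators1[OF that] a[OF that] wi(1)[OF that]])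
  then have "mul w' = product_op r (\<lambda>i v. a i (rep i (w i) v)) v0"
    by (rule mul_eq) (simp_all add: wi(2) w')
  also have "\<dots> = product_op r a (mul w)"
    unfolding mul_def by (rule product_op_compose) (use a wi in auto)
  finally show ?thesis .
qed

lemma update_W: "\<lbrakk>w \<in> Pi\<^sub>E {..<r} W; i < r; u \<in> W i\<rbrakk> \<Longrightarrow> w(i := u) \<in> Pi\<^sub>E {..<r} W"
  by (auto simp: PiE_iff extensional_def)

text \<open>With the other slots fixed, \<open>mul\<close> is an operator \<open>Q\<close> built
  from the other factors. Such an operator is linear and commutes with \<open>\<rho> i\<close>,
  which gives \<open>mul_linear\<close> and \<open>mul_\<rho>\<close>.\<close>

lemma mul_slot:
  assumes w: "w \<in> Pi\<^sub>E {..<r} W" and i: "i < r"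
  shows "\<exists>Q\<in>alg ({..<r} - {i}). \<forall>u\<in>W i. mul (w(i := u)) = Q u"
proof
  let ?a = "\<lambda>j. rep j (w j)"
  let ?Q = "product_op r (?a(i := \<lambda>v. v))"
  have wj: "w j \<in> W j" if "j < r" for j using w that by auto
  interpret O: operator_set sV "gens ({..<r} - {i})" by (rule operators) auto
  show "?Q \<in> O.alg"
  proof (rule product_op_in_alg)
    fix j assume j: "j < r"
    show "(?a(i := \<lambda>v. v)) j \<in> O.alg"
    proof (cases "j = i")
      case True
      then show ?thesis using O.alg.id by simp
    next
      case False
      have "rep j (w j) \<in> O.alg"
        by (rule alg_mono[of "{j}"]) (use rep[OF j wj[OF j]] j False in auto)
      then show ?thesis using False by simp
    qed
  qed auto
  show "\<forall>u\<in>W i. mul (w(i := u)) = ?Q u"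
  proof
    fix u assume u: "u \<in> W i"
    let ?c = "\<lambda>j. rep j ((w(i := u)) j)"
    have c: "?c j \<in> alg {j}" if "j < r" for j using rep(1)[OF that] wj[OF that] u by (cases "j = i") auto
    have eq: "?c(i := \<lambda>v. v) = ?a(i := \<lambda>v. v)" by auto
    have "mul (w(i := u)) = product_op r (?c(i := \<lambda>v. v)) (?c i v0)"
      unfolding mul_def by (rule product_op_slot) (use i c in auto)
    also have "?c i v0 = u" using rep(2)[OF i u] by simp
    finally show "mul (w(i := u)) = ?Q u" by (simp only: eq)
  qed
qed

lemma mul_linear:
  assumes "w \<in> Pi\<^sub>E {..<r} W" "i < r"
  shows "linear_on sV (W i) sV UNIV (\<lambda>u. mul (w(i := u)))"
proof -
  obtain Q where Q: "Q \<in> alg ({..<r} - {i})" "\<And>u. u \<in> W i \<Longrightarrow> mul (w(i := u)) = Q u"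
    using mul_slot[OF assms] by blast
  have "linear_on sV UNIV sV UNIV Q" using Q(1) by (intro alg_linear) auto
  then show ?thesis
    using Q(2) subspace_W[OF assms(2)] by (auto simp: linear_on_def subspace_add subspace_scale)
qed

lemma multilinear_mul: "multilinear_map sV r W sV mul"
  using mul_linear by (simp add: multilinear_map_def)

lemma mul_\<rho>:
  assumes "w \<in> Pi\<^sub>E {..<r} W" "i < r"
  shows "mul (w(i := \<rho> i x (w i))) = \<rho> i x (mul w)"
proof -
  obtain Q where Q: "Q \<in> alg ({..<r} - {i})" "\<And>u. u \<in> W i \<Longrightarrow> mul (w(i := u)) = Q u"
    using mul_slot[OF assms] by blast
  have wi: "w i \<in> W i" using assms by auto
  have "mul (w(i := \<rho> i x (w i))) = Q (\<rho> i x (w i))" using Q(2) \<rho>_W[OF assms(2) wi] by simp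
  also have "\<dots> = \<rho> i x (Q (w i))"
    by (rule alg_commute[OF _ _ _ Q(1) \<rho>_in_alg[of "{i}" i]]) (use assms(2) in auto)
  also have "Q (w i) = mul w" using Q(2)[OF wi] by simp
  finally show ?thesis .
qed

lemma mul_zero:
  assumes "w \<in> Pi\<^sub>E {..<r} W" "i < r" "w i = 0"
  shows "mul w = 0"
proof -
  have "0 \<in> W i" by (rule subspace_0[OF subspace_W[OF assms(2)]])
  from linear_onD(3)[OF mul_linear[OF assms(1,2)] this, of 0]
  have "mul (w(i := 0)) = 0" by (simp only: scale_zero_left)
  moreover have "w(i := 0) = w" using assms(3) by (metis fun_upd_triv)
  ultimately show ?thesis by metis
qed

lemma mul_nonzero:
  assumes "w \<in> Pi\<^sub>E {..<r} W" "\<And>i. i < r \<Longrightarrow> w i \<noteq> 0"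
  shows "mul w \<noteq> 0"
proof -
  have "w i \<in> W i" if "i < r" for i using assms(1) that by auto
  then show ?thesis unfolding mul_def
    by (intro product_op_nonzero) (use rep assms(2) in auto)
qed

text \<open>In each factor \<open>density_W\<close> gives an operator that does not kill
  \<open>u i\<close> but kills the other entries of slot \<open>i\<close>. Their product annihilates
  every term of the relation except that of \<open>u\<close>, where \<open>mul_nonzero\<close>
  forces the coefficient to vanish.\<close>

lemma mul_bases_independent:
  assumes B: "\<And>i. i < r \<Longrightarrow> B i \<subseteq> W i" "\<And>i. i < r \<Longrightarrow> independent (B i)"
    and F: "finite F" "F \<subseteq> Pi\<^sub>E {..<r} B" "(\<Sum>w\<in>F. sV (c w) (mul w)) = 0" and u: "u \<in> F"
  shows "c u = 0"
proof -
  have FW: "w \<in> Pi\<^sub>E {..<r} W" if "w \<in> F" for w using that F(2) B(1) by (auto simp: PiE_iff subset_iff)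
  have "\<forall>i. \<exists>a. i < r \<longrightarrow> a \<in> alg {i} \<and> (\<forall>w\<in>F. w i \<noteq> u i \<longrightarrow> a (w i) = 0) \<and> a (u i) \<noteq> 0"
  proof
    fix i
    show "\<exists>a. i < r \<longrightarrow> a \<in> alg {i} \<and> (\<forall>w\<in>F. w i \<noteq> u i \<longrightarrow> a (w i) = 0) \<and> a (u i) \<noteq> 0"
    proof (cases "i < r")
      case i: True
      let ?G = "(\<lambda>w. w i) ` F - {u i}"
      have GB: "(\<lambda>w. w i) ` F \<subseteq> B i" using F(2) i by auto
      then have "u i \<in> B i" using u by auto
      moreover have "?G \<subseteq> B i - {u i}" using GB by auto
      ultimately have "u i \<notin> span ?G"
        using B(2)[OF i] span_mono[of ?G "B i - {u i}"] by (auto simp: dependent_def)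
      moreover have "?G \<subseteq> W i" using GB B(1)[OF i] by auto
      ultimately have "\<exists>a\<in>alg {i}. (\<forall>x\<in>?G. a x = 0) \<and> a (u i) \<noteq> 0"
        using F(1) B(1)[OF i] \<open>u i \<in> B i\<close> by (intro density_W[OF i]) auto
      then show ?thesis by auto
    qed simp
  qed
  then obtain a where a: "\<And>i. i < r \<Longrightarrow> a i \<in> alg {i}"
    "\<And>i w. \<lbrakk>i < r; w \<in> F; w i \<noteq> u i\<rbrakk> \<Longrightarrow> a i (w i) = 0" "\<And>i. i < r \<Longrightarrow> a i (u i) \<noteq> 0" by metis
  define w' where "w' w = (\<lambda>i\<in>{..<r}. a i (w i))" for w :: "nat \<Rightarrow> 'v"
  have w': "w' w \<in> Pi\<^sub>E {..<r} W" if "w \<in> F" for w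
    unfolding w'_def using alg_W[OF _ a(1)] FW[OF that] by (auto simp: PiE_iff)
  have Q: "product_op r a \<in> alg {..<r}" using a(1) by (intro product_op_lessThan) auto
  interpret O: operator_set sV "gens {..<r}" by (rule operators) simp
  have Qsum: "product_op r a (\<Sum>w\<in>G. sV (c w) (mul w)) = (\<Sum>w\<in>G. sV (c w) (product_op r a (mul w)))" for G
    by (induction G rule: infinite_finite_induct) (simp_all add: O.alg_rules[OF Q])
  have Qw: "product_op r a (mul w) = mul (w' w)" if "w \<in> F" for w
    by (rule mul_apply[symmetric]) (use FW[OF that] a(1) in \<open>auto simp: w'_def\<close>)
  have zero: "mul (w' w) = 0" if w: "w \<in> F" "w \<noteq> u" for w
  proof -
    obtain i where i: "i < r" "w i \<noteq> u i"
      using w F(2) u PiE_ext[of w "{..<r}" B u] by auto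
    then have "w' w i = 0" using a(2) w(1) by (simp add: w'_def)
    then show ?thesis using mul_zero[OF w'[OF w(1)] i(1)] by simp
  qed
  have "0 = (\<Sum>w\<in>F. sV (c w) (mul (w' w)))"
    using Qsum[of F] F(3) by (simp add: Qw O.alg_rules[OF Q])
  also have "\<dots> = sV (c u) (mul (w' u))"
    using zero F(1) u by (simp add: sum.remove[of F u])
  finally have "sV (c u) (mul (w' u)) = 0" by simp
  moreover have "mul (w' u) \<noteq> 0" using a(3) by (intro mul_nonzero w'[OF u]) (simp add: w'_def)
  ultimately show ?thesis by simp
qed

text \<open>The span is stable under every action by \<open>mul_\<rho>\<close> and contains the
  nonzero value at the constant family \<open>v0\<close>, so joint simplicity applies.\<close>

lemma mul_spans: "span (mul ` Pi\<^sub>E {..<r} W) = UNIV"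
proof -
  let ?Y = "span (mul ` Pi\<^sub>E {..<r} W)"
  have "?Y = {0} \<or> ?Y = UNIV"
  proof (rule jointly_simple)
    fix i x y assume i: "i < r" and y: "y \<in> ?Y"
    show "\<rho> i x y \<in> ?Y"
    proof (rule linear_on_span[OF \<rho>_linear[OF i] _ _ y])
      fix z assume "z \<in> mul ` Pi\<^sub>E {..<r} W"
      then obtain w where w: "w \<in> Pi\<^sub>E {..<r} W" "z = mul w" by blast
      have "w(i := \<rho> i x (w i)) \<in> Pi\<^sub>E {..<r} W" using w(1) i by (intro update_W \<rho>_W) auto
      then show "\<rho> i x z \<in> ?Y"
        unfolding w(2) mul_\<rho>[OF w(1) i, symmetric] by (intro span_base imageI)
    qed simp
  qed simp
  moreover have w: "(\<lambda>i\<in>{..<r}. v0) \<in> Pi\<^sub>E {..<r} W"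
    using generator_in_W by (simp add: restrict_PiE_iff)
  then have "mul (\<lambda>i\<in>{..<r}. v0) \<in> ?Y" by (intro span_base imageI)
  moreover have "mul (\<lambda>i\<in>{..<r}. v0) \<noteq> 0"
    using generator(2) by (intro mul_nonzero[OF w]) simp
  ultimately show ?thesis by blast
qed

text \<open>A tensor in the kernel is a combination of elementary tensors of basis vectors, whose
  coefficients vanish by \<open>mul_bases_independent\<close>. Surjectivity is
  \<open>mul_spans\<close>.\<close>

theorem mul_bij: "bij_betw (mtensor_lift sV r W sV mul) (mtensor sV r W) UNIV"
proof -
  interpret E: vector_space "tscale :: 'k \<Rightarrow> (((nat \<Rightarrow> 'v) \<Rightarrow> 'k) \<Rightarrow> 'k) \<Rightarrow> _" by (rule vector_space_tscale)
  let ?m = "mtens sV r W" and ?T = "mtensor_lift sV r W sV mul" and ?M = "mtensor sV r W"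
  note T = mtensor_universal(1,2)[OF vector_space_axioms multilinear_mul]
  have subM: "E.subspace ?M" unfolding mtensor_def by (rule E.subspace_span)
  have mM: "?m w \<in> ?M" if "w \<in> Pi\<^sub>E {..<r} W" for w
    unfolding mtensor_def using that by (intro E.span_base imageI)
  have T0: "?T 0 = 0" using linear_onD(3)[OF T(1) E.subspace_0[OF subM], of 0] by simp
  have Tsum: "(\<Sum>w\<in>G. tscale (c w) (?m w)) \<in> ?M \<and>
      ?T (\<Sum>w\<in>G. tscale (c w) (?m w)) = (\<Sum>w\<in>G. sV (c w) (mul w))"
    if "finite G" "G \<subseteq> Pi\<^sub>E {..<r} W" for G c
    using that
  proof (induction G)
    case empty
    show ?case unfolding sum.empty using E.subspace_0[OF subM] T0 by (rule conjI)
  next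
    case (insert w G)
    then have w: "w \<in> Pi\<^sub>E {..<r} W" by simp
    have s: "tscale (c w) (?m w) \<in> ?M" by (rule E.subspace_scale[OF subM mM[OF w]])
    show ?case
      using insert s linear_onD(2)[OF T(1) s] linear_onD(3)[OF T(1) mM[OF w]] T(2)[OF w]
      by (simp add: E.subspace_add[OF subM])
  qed
  have kernel: "t = 0" if t: "t \<in> ?M" "?T t = 0" for t
  proof -
    have "\<exists>B. B \<subseteq> W i \<and> independent B \<and> W i \<subseteq> span B" for i
      using maximal_independent_subset by metis
    then obtain B where B: "\<And>i. B i \<subseteq> W i" "\<And>i. independent (B i)" "\<And>i. W i \<subseteq> span (B i)" by metis
    have "t \<in> E.span (?m ` Pi\<^sub>E {..<r} B)"
      by (rule subsetD[OF mtensor_spanned_by_bases[of sV r W B] t(1)])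
        (intro vector_space_axioms subspace_W B(1,3); assumption)+
    then obtain S c where S: "finite S" "S \<subseteq> ?m ` Pi\<^sub>E {..<r} B" "t = (\<Sum>s\<in>S. tscale (c s) s)"
      by (auto simp: E.span_explicit)
    \<comment> \<open>\<open>F\<close> picks one family for each tensor in \<open>S\<close>, so that
      the sum can be reindexed by families without repetition.\<close>
    then obtain F where F: "F \<subseteq> Pi\<^sub>E {..<r} B" "inj_on ?m F" "S = ?m ` F" by (auto simp: subset_image_inj)
    have finF: "finite F" using F S(1) finite_image_iff by blast
    have FW: "F \<subseteq> Pi\<^sub>E {..<r} W" using F(1) PiE_mono[of "{..<r}" B W] B(1) by blast
    have tF: "t = (\<Sum>w\<in>F. tscale (c (?m w)) (?m w))" unfolding S(3) F(3) by (simp add: sum.reindex[OF F(2)])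
    then have "(\<Sum>w\<in>F. sV (c (?m w)) (mul w)) = 0" using Tsum[OF finF FW, of "\<lambda>w. c (?m w)"] t(2) by simp
    then have "c (?m w) = 0" if "w \<in> F" for w
      using mul_bases_independent[of B F "\<lambda>w. c (?m w)" w, OF B(1,2) finF F(1) _ that] by simp
    then show ?thesis unfolding tF by simp
  qed
  have "inj_on ?T ?M"
  proof (rule inj_onI)
    fix s t assume s: "s \<in> ?M" and t: "t \<in> ?M" and eq: "?T s = ?T t"
    have d: "s - t \<in> ?M" by (rule E.subspace_diff[OF subM s t])
    have "?T (s - t) + ?T t = ?T s" using linear_onD(2)[OF T(1) d t] by simp
    then have "s - t = 0" using eq by (intro kernel[OF d]) simp
    then show "s = t" by simp
  qed
  moreover have "?T ` ?M = UNIV"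
  proof -
    have "span (mul ` Pi\<^sub>E {..<r} W) \<subseteq> ?T ` ?M"
    proof (rule span_minimal)
      show "mul ` Pi\<^sub>E {..<r} W \<subseteq> ?T ` ?M"
        using T(2) mM by (metis image_eqI image_subsetI)
      show "subspace (?T ` ?M)"
        unfolding subspace_def
      proof (intro conjI ballI allI)
        show "0 \<in> ?T ` ?M" using T0 E.subspace_0[OF subM] by (metis imageI)
      next
        fix x y assume "x \<in> ?T ` ?M" "y \<in> ?T ` ?M"
        then obtain s t where "s \<in> ?M" "t \<in> ?M" "x = ?T s" "y = ?T t" by blast
        then show "x + y \<in> ?T ` ?M" using linear_onD(2)[OF T(1)] E.subspace_add[OF subM] by (metis imageI)
      next
        fix c x assume "x \<in> ?T ` ?M"
        then obtain s where "s \<in> ?M" "x = ?T s" by blast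
        then show "sV c x \<in> ?T ` ?M" using linear_onD(3)[OF T(1)] E.subspace_scale[OF subM] by (metis imageI)
      qed
    qed
    then show ?thesis using mul_spans by auto
  qed
  ultimately show ?thesis by (simp add: bij_betw_def)
qed

end

section \<open>Evaluation modules\<close>

theorem (in commuting_modules) tensor_decomposition:
  "\<exists>W b. (\<forall>i<r. simple_lie_module sg UNIV br sV (W i) (\<rho> i) \<and> weight_decomposition sg H sV (W i) (\<rho> i)) \<and>
    multilinear_map sV r W sV b \<and> bij_betw (mtensor_lift sV r W sV b) (mtensor sV r W) UNIV \<and>
    (\<forall>w\<in>Pi\<^sub>E {..<r} W. \<forall>i<r. \<forall>x. b (w(i := \<rho> i x (w i))) = \<rho> i x (b w))"
proof -
  obtain \<kappa> v where \<kappa>: "\<And>i. i < r \<Longrightarrow> \<kappa> i \<in> dual" and v: "v \<in> joint \<kappa>" "v \<noteq> 0"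
    using joint_eigenvector_exists by blast
  obtain u where u: "u \<in> joint \<kappa>" "u \<noteq> 0" "\<And>i. i < r \<Longrightarrow> irreducible_under {i} (orbit {i} u)"
    using irreducible_generator_exists[OF \<kappa> v] by blast
  interpret G: irreducible_generator sV sg br H r \<rho> \<kappa> u
    by unfold_locales (use \<kappa> u in auto)
  show ?thesis
    by (intro exI[of _ G.W] exI[of _ G.mul] conjI allI impI ballI
        G.simple_W G.weights_W G.multilinear_mul G.mul_bij G.mul_\<rho>)
qed

text \<open>The inverse \<open>f\<close> of the bijection \<open>T\<close> carries
  \<open>\<phi>\<close> to the evaluation action. Uniqueness of lifts is used twice: for elementary
  \<open>F\<close>, on the tensor product of the modules, and then to pass to all
  \<open>F\<close>.\<close>

lemma evaluation_module_isomorphic: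
  fixes sV :: "'k::field \<Rightarrow> 'v::ab_group_add \<Rightarrow> 'v" and sg :: "'k \<Rightarrow> 'g::ab_group_add \<Rightarrow> 'g"
    and sS :: "'k \<Rightarrow> 's::comm_ring_1 \<Rightarrow> 's"
  assumes sg: "vector_space sg" and sS: "vector_space sS" and sV: "vector_space sV"
    and \<phi>: "\<And>F. F \<in> tensor sg sS \<Longrightarrow> linear_on sV UNIV sV UNIV (\<phi> F)"
      "\<And>v. linear_on tscale (tensor sg sS) sV UNIV (\<lambda>F. \<phi> F v)"
    and \<phi>_tens: "\<And>x s v. \<phi> (tens sg sS x s) v = (\<Sum>i<r. sV (residue sS s (M i)) (\<rho> i x v))"
    and W: "\<And>i. i < r \<Longrightarrow> subspace_of sV (W i)" "\<And>i x w. \<lbrakk>i < r; w \<in> W i\<rbrakk> \<Longrightarrow> \<rho> i x w \<in> W i"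
    and b: "multilinear_map sV r W sV b" "bij_betw (mtensor_lift sV r W sV b) (mtensor sV r W) UNIV"
      "\<And>w i x. \<lbrakk>w \<in> Pi\<^sub>E {..<r} W; i < r\<rbrakk> \<Longrightarrow> b (w(i := \<rho> i x (w i))) = \<rho> i x (b w)"
  shows "module_isomorphic (tensor sg sS) sV UNIV \<phi>
    tscale (mtensor sV r W) (evaluation_action sg sS r M sV W \<rho>)"
proof -
  interpret V: vector_space sV by fact
  interpret E: vector_space "tscale :: 'k \<Rightarrow> (((nat \<Rightarrow> 'v) \<Rightarrow> 'k) \<Rightarrow> 'k) \<Rightarrow> _" by (rule vector_space_tscale)
  let ?m = "mtens sV r W" and ?M = "mtensor sV r W"
  define T where "T = mtensor_lift sV r W sV b"
  define f where "f = inv_into ?M T"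
  have T: "linear_on tscale ?M sV UNIV T" "\<And>w. w \<in> Pi\<^sub>E {..<r} W \<Longrightarrow> T (?m w) = b w"
    unfolding T_def by (rule mtensor_universal[OF sV b(1)])+
  have inj: "inj_on T ?M" and surj: "T ` ?M = UNIV" using b(2) by (auto simp: T_def bij_betw_def)
  have fT: "f (T t) = t" if "t \<in> ?M" for t using inj that by (simp add: f_def)
  have fM: "f v \<in> ?M" and Tf: "T (f v) = v" for v
    using surj by (simp_all add: f_def inv_into_into f_inv_into_f)
  have subM: "E.subspace ?M" unfolding mtensor_def by (rule E.subspace_span)
  have mM: "?m w \<in> ?M" if "w \<in> Pi\<^sub>E {..<r} W" for w
    unfolding mtensor_def using that by (intro E.span_base imageI)
  have f: "f (u + v) = f u + f v" "f (sV c v) = tscale c (f v)" for u v c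
  proof -
    have "f u + f v \<in> ?M" "tscale c (f v) \<in> ?M"
      by (intro E.subspace_add[OF subM] E.subspace_scale[OF subM] fM)+
    moreover have "T (f u + f v) = u + v" "T (tscale c (f v)) = sV c v"
      using linear_onD(2)[OF T(1) fM fM, of u v] linear_onD(3)[OF T(1) fM, of c v] by (simp_all add: Tf)
    ultimately show "f (u + v) = f u + f v" "f (sV c v) = tscale c (f v)" using fT by metis+
  qed
  have upd: "w(i := u) \<in> Pi\<^sub>E {..<r} W" if "w \<in> Pi\<^sub>E {..<r} W" "i < r" "u \<in> W i" for w i u
    using that by (auto simp: PiE_iff extensional_def)
  \<comment> \<open>The inner sum of \<open>evaluation_action\<close>; once expressed through
    \<open>f\<close>, \<open>\<phi>\<close> and \<open>b\<close> it inherits multilinearity in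
    \<open>w\<close>.\<close>
  define B where "B x s w = (\<Sum>i<r. tscale (residue sS s (M i)) (?m (w(i := \<rho> i x (w i)))))" for x s w
  have B: "B x s w = f (\<phi> (tens sg sS x s) (b w))" if w: "w \<in> Pi\<^sub>E {..<r} W" for x s w
  proof -
    define g where "g i = ?m (w(i := \<rho> i x (w i)))" for i
    have g: "g i = f (\<rho> i x (b w))" if i: "i < r" for i
    proof -
      have "w i \<in> W i" using w i by auto
      then have wi: "w(i := \<rho> i x (w i)) \<in> Pi\<^sub>E {..<r} W" by (rule upd[OF w i W(2)[OF i]])
      have "g i = f (b (w(i := \<rho> i x (w i))))"
        unfolding g_def T(2)[OF wi, symmetric] by (rule fT[OF mM[OF wi], symmetric])
      then show ?thesis unfolding b(3)[OF w i] .
    qed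
    have f0: "f 0 = 0" using f(2)[of 0 0] by simp
    have "(\<Sum>i<n. tscale (residue sS s (M i)) (g i)) = f (\<Sum>i<n. sV (residue sS s (M i)) (\<rho> i x (b w)))"
      if "n \<le> r" for n
      using that by (induction n) (simp_all add: f f0 g)
    then show ?thesis unfolding B_def \<phi>_tens g_def by simp
  qed
  have multi: "multilinear_map sV r W tscale (B x s)" for x s
    unfolding multilinear_map_def
  proof (intro allI impI ballI)
    fix i w assume i: "i < r" and w: "w \<in> Pi\<^sub>E {..<r} W"
    have lin: "linear_on sV (W i) sV UNIV (\<lambda>u. b (w(i := u)))"
      using b(1) i w unfolding multilinear_map_def by blast
    have \<phi>l: "linear_on sV UNIV sV UNIV (\<phi> (tens sg sS x s))" by (rule \<phi>(1)) simp
    have sub: "V.subspace (W i)" using W(1) i by simp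
    have Bu: "B x s (w(i := u)) = f (\<phi> (tens sg sS x s) (b (w(i := u))))" if "u \<in> W i" for u
      by (rule B[OF upd[OF w i that]])
    show "linear_on sV (W i) tscale UNIV (\<lambda>u. B x s (w(i := u)))"
      unfolding linear_on_def
    proof (intro conjI ballI allI)
      fix u v assume u: "u \<in> W i" and v: "v \<in> W i"
      have uv: "u + v \<in> W i" using sub u v by (rule V.subspace_add)
      show "B x s (w(i := u + v)) = B x s (w(i := u)) + B x s (w(i := v))"
        unfolding Bu[OF u] Bu[OF v] Bu[OF uv] linear_onD(2)[OF lin u v]
        by (simp only: linear_onD(2)[OF \<phi>l UNIV_I UNIV_I] f)
    next
      fix c u assume u: "u \<in> W i"
      have cu: "sV c u \<in> W i" using sub u by (rule V.subspace_scale)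
      show "B x s (w(i := sV c u)) = tscale c (B x s (w(i := u)))"
        unfolding Bu[OF u] Bu[OF cu] linear_onD(3)[OF lin u]
        by (simp only: linear_onD(3)[OF \<phi>l UNIV_I] f)
    qed simp
  qed
  have lift: "mtensor_lift sV r W tscale (B x s) t = f (\<phi> (tens sg sS x s) (T t))" if t: "t \<in> ?M" for x s t
  proof (rule mtensor_universal(3)[OF vector_space_tscale multi _ _ t])
    have \<phi>l: "linear_on sV UNIV sV UNIV (\<phi> (tens sg sS x s))" by (rule \<phi>(1)) simp
    show "linear_on tscale ?M tscale UNIV (\<lambda>t. f (\<phi> (tens sg sS x s) (T t)))"
      unfolding linear_on_def
      by (simp add: linear_onD(2,3)[OF T(1)] linear_onD(2)[OF \<phi>l UNIV_I UNIV_I] linear_onD(3)[OF \<phi>l UNIV_I] f)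
    show "f (\<phi> (tens sg sS x s) (T (?m w))) = B x s w" if "w \<in> Pi\<^sub>E {..<r} W" for w
      by (simp only: B[OF that] T(2)[OF that])
  qed
  have act: "evaluation_action sg sS r M sV W \<rho> F t = f (\<phi> F (T t))" if F: "F \<in> tensor sg sS" and t: "t \<in> ?M" for F t
  proof -
    have lin: "linear_on tscale (tensor sg sS) tscale UNIV (\<lambda>F. f (\<phi> F (T t)))"
      unfolding linear_on_def by (simp add: linear_onD(2,3)[OF \<phi>(2)] f)
    note tens_lin = bilinear_tens[OF sg sS, unfolded bilinear_map_def linear_iff_additive]
    have "bilinear_map sg sS tscale (\<lambda>x s. f (\<phi> (tens sg sS x s) (T t)))"
      unfolding bilinear_map_def linear_iff_additive using tens_lin
      by (simp add: sg sS vector_space_tscale linear_onD(2,3)[OF lin])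
    from tensor_universal(3)[OF vector_space_tscale this lin _ F]
    have "tensor_lift sg sS tscale (\<lambda>x s. f (\<phi> (tens sg sS x s) (T t))) F = f (\<phi> F (T t))" by simp
    then show ?thesis unfolding evaluation_action_def B_def[symmetric] lift[OF t] .
  qed
  have "bij_betw f UNIV ?M"
    unfolding f_def using b(2) by (intro bij_betw_inv_into) (simp add: T_def)
  moreover have "linear_on sV UNIV tscale ?M f" using f fM by (simp add: linear_on_def)
  moreover have "f (\<phi> F v) = evaluation_action sg sS r M sV W \<rho> F (f v)" if "F \<in> tensor sg sS" for F v
    by (simp add: act[OF that fM] Tf)
  ultimately show ?thesis unfolding module_isomorphic_def by blast
qed

text \<open>The common conclusion of both cases of the theorem: \<open>tensor_decomposition\<close>
  supplies the factors, \<open>evaluation_module_isomorphic\<close> compares the actions.\<close>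

lemma evaluation_weight_module_if_commuting:
  fixes sg :: "'k::alg_closed_field \<Rightarrow> 'g::ab_group_add \<Rightarrow> 'g" and sS :: "'k \<Rightarrow> 's::comm_ring_1 \<Rightarrow> 's"
    and sV :: "'k \<Rightarrow> 'v::ab_group_add \<Rightarrow> 'v" and M :: "nat \<Rightarrow> 's set"
  assumes "commuting_modules sV sg br H r \<rho>"
    and M: "0 < r" "inj_on M {..<r}" "\<forall>i<r. maximal_ideal (M i)"
    and sg: "vector_space sg" and sS: "vector_space sS"
    and \<phi>: "lie_module tscale (tensor sg sS) (current_bracket sg br sS) sV UNIV \<phi>"
      "\<And>x s v. \<phi> (tens sg sS x s) v = (\<Sum>i<r. sV (residue sS s (M i)) (\<rho> i x v))"
  shows "\<exists>r' M' (W :: nat \<Rightarrow> 'v set) \<rho>. evaluation_weight_data sg br H r' M' sV W \<rho> \<and>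
    module_isomorphic (tensor sg sS) sV UNIV \<phi>
      tscale (mtensor sV r' W) (evaluation_action sg sS r' M' sV W \<rho>)"
proof -
  interpret commuting_modules sV sg br H r \<rho> by fact
  interpret \<phi>: lie_module tscale "tensor sg sS" "current_bracket sg br sS" sV UNIV \<phi> by fact
  obtain W b where W: "\<forall>i<r. simple_lie_module sg UNIV br sV (W i) (\<rho> i) \<and> weight_decomposition sg H sV (W i) (\<rho> i)"
    and b: "multilinear_map sV r W sV b" "bij_betw (mtensor_lift sV r W sV b) (mtensor sV r W) UNIV"
      "\<forall>w\<in>Pi\<^sub>E {..<r} W. \<forall>i<r. \<forall>x. b (w(i := \<rho> i x (w i))) = \<rho> i x (b w)"
    using tensor_decomposition by blast
  have Wi: "lie_module sg UNIV br sV (W i) (\<rho> i)" if "i < r" for i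
    using W that by (simp add: simple_lie_module_def)
  have "evaluation_weight_data sg br H r M sV W \<rho>"
    using M W by (simp add: evaluation_weight_data_def)
  moreover have "module_isomorphic (tensor sg sS) sV UNIV \<phi>
      tscale (mtensor sV r W) (evaluation_action sg sS r M sV W \<rho>)"
  proof (rule evaluation_module_isomorphic[OF sg sS vector_space_axioms _ _ \<phi>(2) _ _ b(1,2)])
    show "linear_on sV UNIV sV UNIV (\<phi> F)" if "F \<in> tensor sg sS" for F using that by (rule \<phi>.endomorphism)
    show "linear_on tscale (tensor sg sS) sV UNIV (\<lambda>F. \<phi> F v)" for v by (rule \<phi>.linear_action) simp
    show "subspace (W i)" if "i < r" for i by (rule lie_module.subspace_module[OF Wi[OF that]])
    show "\<rho> i x w \<in> W i" if "i < r" "w \<in> W i" for i x w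
      using linear_onD(1)[OF lie_module.endomorphism[OF Wi[OF that(1)]] that(2)] by simp
    show "b (w(i := \<rho> i x (w i))) = \<rho> i x (b w)" if "w \<in> Pi\<^sub>E {..<r} W" "i < r" for w i x
      using b(3) that by blast
  qed
  ultimately show ?thesis by blast
qed

text \<open>If the residues are not linear, no linear map has the prescribed values on elementary tensors, so that
  the description in \<open>tensor_lift\<close> is void and \<open>evaluation_map\<close> is constant.\<close>

lemma evaluation_map_constant:
  assumes sg: "vector_space sg" and sS: "vector_space sS"
    and "\<not> bilinear_map sg sS (pointwise sg) (\<lambda>x s i. if i < r then sg (residue sS s (M i)) x else 0)"
  shows "evaluation_map sg sS r M F = evaluation_map sg sS r M G"
proof -
  let ?b = "\<lambda>x s i. if i < r then sg (residue sS s (M i)) x else 0"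
  \<comment> \<open>A linear map with these values would make \<open>?b\<close> bilinear, because
    \<open>tens\<close> is.\<close>
  have "\<not> (linear_on tscale (tensor sg sS) (pointwise sg) UNIV T \<and> (\<forall>x s. T (tens sg sS x s) = ?b x s))" for T
  proof
    assume T: "linear_on tscale (tensor sg sS) (pointwise sg) UNIV T \<and> (\<forall>x s. T (tens sg sS x s) = ?b x s)"
    note tens_lin = bilinear_tens[OF sg sS, unfolded bilinear_map_def linear_iff_additive]
    have "bilinear_map sg sS (pointwise sg) (\<lambda>x s. T (tens sg sS x s))"
      unfolding bilinear_map_def linear_iff_additive using tens_lin
      by (simp add: sg sS vector_space_pointwise linear_onD(2,3)[OF conjunct1[OF T]])
    also have "(\<lambda>x s. T (tens sg sS x s)) = ?b" using T by blast
    finally show False using assms(3) by contradiction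
  qed
  then have eq: "(\<exists>T. linear_on tscale (tensor sg sS) (pointwise sg) UNIV T \<and>
      (\<forall>x s. T (tens sg sS x s) = ?b x s) \<and> z = T F) = False" for z F by blast
  show ?thesis unfolding evaluation_map_def tensor_lift_def eq ..
qed

section \<open>Maximal ideals\<close>

lemma ideal_of_type_iff:
  fixes J :: "'s::comm_ring_1 set"
  shows "ideal J (ring_of_type_algebra :: 's ring) \<longleftrightarrow>
    0 \<in> J \<and> (\<forall>x\<in>J. \<forall>y\<in>J. x + y \<in> J) \<and> (\<forall>x\<in>J. \<forall>a. a * x \<in> J)"
proof -
  let ?R = "ring_of_type_algebra :: 's ring"
  interpret R: cring ?R by (rule cring_from_type_algebra)
  have [simp]: "carrier ?R = UNIV" "x \<oplus>\<^bsub>?R\<^esub> y = x + y" "x \<otimes>\<^bsub>?R\<^esub> y = x * y" "\<zero>\<^bsub>?R\<^esub> = 0" for x y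
    by (simp_all add: ring_of_type_algebra_def)
  have minus: "\<ominus>\<^bsub>?R\<^esub> x = - x" for x by (rule R.minus_equality) auto
  show ?thesis
  proof
    assume "ideal J ?R"
    then interpret J: ideal J ?R .
    show "0 \<in> J \<and> (\<forall>x\<in>J. \<forall>y\<in>J. x + y \<in> J) \<and> (\<forall>x\<in>J. \<forall>a. a * x \<in> J)"
      using J.zero_closed J.a_closed J.I_l_closed by auto
  next
    assume J: "0 \<in> J \<and> (\<forall>x\<in>J. \<forall>y\<in>J. x + y \<in> J) \<and> (\<forall>x\<in>J. \<forall>a. a * x \<in> J)"
    have neg: "- x \<in> J" if "x \<in> J" for x
      using J that mult_minus1[of x] by metis
    show "ideal J ?R"
    proof (rule idealI)
      show "ring ?R" by (rule R.ring_axioms)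
      show "subgroup J (add_monoid ?R)"
        by (rule subgroup.intro) (use J neg minus in \<open>auto simp: a_inv_def\<close>)
    qed (use J in \<open>auto simp: mult.commute\<close>)
  qed
qed

text \<open>Zorn's lemma for the ideals that omit 1. The ideal serves as evaluation point when
  \<open>\<phi>\<close> is zero.\<close>

lemma maximal_ideal_exists: "\<exists>N :: 's::comm_ring_1 set. maximal_ideal N"
proof -
  let ?R = "ring_of_type_algebra :: 's ring"
  define A where "A = {J. ideal J ?R \<and> 1 \<notin> J}"
  have "{0} \<in> A" by (simp add: A_def ideal_of_type_iff)
  then have "A \<noteq> {}" by blast
  moreover have "\<Union>C \<in> A" if C: "C \<noteq> {}" "subset.chain A C" for C
  proof -
    have J: "0 \<in> J" "1 \<notin> J" "\<forall>x\<in>J. \<forall>y\<in>J. x + y \<in> J" "\<forall>x\<in>J. \<forall>a. a * x \<in> J" if "J \<in> C" for J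
      using C(2) that unfolding subset.chain_def A_def ideal_of_type_iff by blast+
    have "x + y \<in> \<Union>C" if xy: "x \<in> \<Union>C" "y \<in> \<Union>C" for x y
    proof -
      obtain J J' where "J \<in> C" "J' \<in> C" "x \<in> J" "y \<in> J'" using xy by blast
      moreover have "J \<subseteq> J' \<or> J' \<subseteq> J" using C(2) \<open>J \<in> C\<close> \<open>J' \<in> C\<close> unfolding subset.chain_def by blast
      ultimately show ?thesis using J(3) by blast
    qed
    moreover have "0 \<in> \<Union>C" using C(1) J(1) by blast
    moreover have "1 \<notin> \<Union>C" using J(2) by blast
    moreover have "a * x \<in> \<Union>C" if "x \<in> \<Union>C" for a x using that J(4) by blast
    ultimately show ?thesis by (simp add: A_def ideal_of_type_iff del: Union_iff)
  qed
  ultimately obtain N where N: "N \<in> A" "\<And>J. J \<in> A \<Longrightarrow> N \<subseteq> J \<Longrightarrow> J = N"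
    using subset_Zorn_nonempty[of A] by blast
  have carr: "carrier ?R = UNIV" by (simp add: ring_of_type_algebra_def)
  have "maximalideal N ?R"
  proof (rule maximalidealI)
    show "ideal N ?R" "carrier ?R \<noteq> N" using N(1) carr by (auto simp: A_def)
    show "J = N \<or> J = carrier ?R" if J: "ideal J ?R" "N \<subseteq> J" for J
    proof (cases "1 \<in> J")
      case True
      then have "a \<in> J" for a using J(1)[unfolded ideal_of_type_iff] mult_1_right[of a] by metis
      then show ?thesis using carr by auto
    next
      case False
      then show ?thesis using J N(2) by (simp add: A_def)
    qed
  qed
  then show ?thesis by blast
qed

text \<open>A scalar \<open>c\<close> other than 1 would put the unit \<open>1 - scale c 1\<close>
  into the ideal. Hence \<open>x \<otimes> 1\<close> acts as the plain sum of the
  \<open>\<rho> i x\<close>.\<close>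

lemma (in comm_algebra) residue_one:
  assumes "maximal_ideal N"
  shows "residue scale 1 N = 1"
  unfolding residue_def
proof (rule the_equality)
  let ?R = "ring_of_type_algebra :: 's ring"
  interpret N: maximalideal N ?R by fact
  have N: "0 \<in> N" "\<And>x a. x \<in> N \<Longrightarrow> a * x \<in> N"
    using N.is_ideal unfolding ideal_of_type_iff by blast+
  show "1 - scale 1 1 \<in> N" using N(1) by simp
  fix c assume c: "1 - scale c 1 \<in> N"
  show "c = 1"
  proof (rule ccontr)
    assume "c \<noteq> 1"
    have "scale (inverse (1 - c)) 1 * (1 - scale c 1) \<in> N" using N(2)[OF c] .
    moreover have "scale (inverse (1 - c)) 1 * (1 - scale c 1) = scale (inverse (1 - c)) (scale (1 - c) 1)"
      by (simp add: scale_mult_left scale_left_diff_distrib)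
    moreover have "\<dots> = 1" using \<open>c \<noteq> 1\<close> by simp
    ultimately have "1 \<in> N" by simp
    then have "a \<in> N" for a using N(2)[of 1 a] by simp
    moreover have "carrier ?R = UNIV" by (simp add: ring_of_type_algebra_def)
    ultimately show False using N.I_notcarr by auto
  qed
qed

section \<open>The Cartan subalgebra acts by commuting operators\<close>

text \<open>The centre is an ideal, and a proper one because the bracket is nonzero.\<close>

lemma (in simple_lie_algebra) central_eq_zero:
  assumes "z \<in> A" "\<And>x. x \<in> A \<Longrightarrow> br x z = 0"
  shows "z = 0"
proof -
  let ?C = "{z \<in> A. \<forall>x\<in>A. br x z = 0}"
  have zero: "0 \<in> A" by (rule subspace_0[OF subspace_carrier])
  have br0: "br x 0 = 0" if "x \<in> A" for x
    using linear_onD(3)[OF linear_right[OF that] zero, of 0] by simp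
  have "lie_ideal scale A br ?C"
    unfolding lie_ideal_def
  proof (intro conjI ballI)
    show "subspace ?C"
      using zero br0 subspace_add[OF subspace_carrier] subspace_scale[OF subspace_carrier] linear_onD(2,3)[OF linear_right]
      by (auto simp: subspace_def)
    show "br x y \<in> ?C" if "x \<in> A" "y \<in> ?C" for x y using that zero br0 by auto
  qed auto
  then have "?C = {0} \<or> ?C = A" by (rule ideals_trivial)
  moreover have "?C \<noteq> A" using nonabelian by blast
  ultimately show ?thesis using assms by blast
qed

text \<open>The kernel of the action is an ideal; as it contains the nonzero \<open>z\<close>, it is
  all of \<open>A\<close>.\<close>

lemma (in simple_lie_algebra) module_faithful_or_trivial:
  assumes "lie_module scale A br sV V \<rho>" and z: "z \<in> A" "\<And>v. v \<in> V \<Longrightarrow> \<rho> z v = 0"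
    and x: "x \<in> A" and v: "v \<in> V" and "z \<noteq> 0"
  shows "\<rho> x v = 0"
proof -
  interpret M: lie_module scale A br sV V \<rho> by fact
  let ?K = "{x \<in> A. \<forall>v\<in>V. \<rho> x v = 0}"
  have zero: "0 \<in> A" by (rule subspace_0[OF subspace_carrier])
  have a0: "\<rho> 0 v = 0" if "v \<in> V" for v
    using linear_onD(3)[OF M.linear_action[OF that] zero, of 0] by simp
  have e0: "\<rho> x 0 = 0" if "x \<in> A" for x
    using linear_onD(3)[OF M.endomorphism[OF that] M.V.subspace_0[OF M.subspace_module], of 0] by simp
  have "lie_ideal scale A br ?K"
    unfolding lie_ideal_def
  proof (intro conjI ballI)
    show "subspace ?K"
      using zero a0 subspace_add[OF subspace_carrier] subspace_scale[OF subspace_carrier] linear_onD(2,3)[OF M.linear_action]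
      by (auto simp: subspace_def)
    fix x y assume x: "x \<in> A" and y: "y \<in> ?K"
    have "br x y \<in> A" using linear_onD(1)[OF linear_right[OF x]] y by blast
    moreover have "\<rho> (br x y) v = 0" if v: "v \<in> V" for v
      using M.bracket_action[of x y v] x y v e0[OF x] linear_onD(1)[OF M.endomorphism[OF x] v] by simp
    ultimately show "br x y \<in> ?K" by simp
  qed auto
  then have "?K = {0} \<or> ?K = A" by (rule ideals_trivial)
  then show ?thesis using assms by blast
qed

text \<open>On a vector of weight \<open>\<mu>\<close> both orders multiply by
  \<open>\<mu> h\<close> and \<open>\<mu> h'\<close>, and such vectors span.\<close>

lemma weight_decomposition_commute:
  assumes "vector_space sV" and wd: "weight_decomposition s H sV UNIV act"
    and act: "\<And>h. h \<in> H \<Longrightarrow> linear_on sV UNIV sV UNIV (act h)" and h: "h \<in> H" "h' \<in> H"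
  shows "act h (act h' v) = act h' (act h v)"
proof -
  interpret vector_space sV by fact
  have "\<exists>f. (\<forall>\<mu>\<in>dual_space s H. f \<mu> \<in> weight_space H sV UNIV act \<mu>) \<and>
      (\<forall>\<mu>. \<mu> \<notin> dual_space s H \<longrightarrow> f \<mu> = 0) \<and> v = (\<Sum>\<mu> | f \<mu> \<noteq> 0. f \<mu>)"
    using wd unfolding weight_decomposition_def internal_direct_sum_def by blast
  then obtain f where f: "\<forall>\<mu>\<in>dual_space s H. f \<mu> \<in> weight_space H sV UNIV act \<mu>"
      "\<forall>\<mu>. \<mu> \<notin> dual_space s H \<longrightarrow> f \<mu> = 0" "v = (\<Sum>\<mu> | f \<mu> \<noteq> 0. f \<mu>)" by blast
  note lin = linear_onD(2,3)[OF act UNIV_I]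
  let ?C = "{v. act h (act h' v) = act h' (act h v)}"
  have "act h 0 = 0" "act h' 0 = 0" using lin(2)[OF h(1), of 0 0] lin(2)[OF h(2), of 0 0] by simp_all
  then have C: "subspace ?C" by (simp add: subspace_def lin h)
  have "f \<mu> \<in> ?C" if "f \<mu> \<noteq> 0" for \<mu>
  proof -
    have "act h (f \<mu>) = sV (\<mu> h) (f \<mu>)" "act h' (f \<mu>) = sV (\<mu> h') (f \<mu>)"
      using f(1,2) that h by (auto simp: weight_space_def)
    then show ?thesis by (simp add: lin h mult.commute)
  qed
  then have "v \<in> ?C" unfolding f(3) by (intro subspace_sum[OF C]) simp
  then show ?thesis by simp
qed

text \<open>The relation \<open>z\<close> expresses \<open>\<rho> i z\<close> through the other
  actions, so it commutes with every \<open>\<rho> i x\<close>, and \<open>br x z\<close> acts by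
  zero. If some \<open>br x z\<close> is nonzero, the whole action \<open>\<rho> i\<close> vanishes;
  otherwise \<open>z\<close> is central, hence zero.\<close>

lemma factor_acts_trivially:
  fixes r :: nat
  assumes g: "simple_lie_algebra sg UNIV br"
    and \<rho>: "\<And>i. i < r \<Longrightarrow> lie_module sg UNIV br sV UNIV (\<rho> i)"
    and commute: "\<And>i j x y v. \<lbrakk>i < r; j < r; i \<noteq> j\<rbrakk> \<Longrightarrow> \<rho> i x (\<rho> j y v) = \<rho> j y (\<rho> i x v)"
    and z: "\<And>v. (\<Sum>i<r. \<rho> i z v) = 0" and i: "i < r"
  shows "\<rho> i z v = 0"
proof -
  interpret g: simple_lie_algebra sg UNIV br by fact
  interpret M: lie_module sg UNIV br sV UNIV "\<rho> i" by (rule \<rho>[OF i])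
  have lin: "\<rho> i x (u + v) = \<rho> i x u + \<rho> i x v" "\<rho> i x 0 = 0" for x u v
    using linear_onD(2)[OF M.endomorphism, of x u v] linear_onD(3)[OF M.endomorphism, of x 0 0] by simp_all
  have sum: "\<rho> i x (\<Sum>j\<in>J. y j) = (\<Sum>j\<in>J. \<rho> i x (y j))" for J :: "nat set" and x y
    by (induction J rule: infinite_finite_induct) (simp_all add: lin)
  have bracket: "\<rho> i (br x z) v = 0" for x v
  proof -
    have "(\<Sum>j<r. \<rho> i x (\<rho> j z v)) = \<rho> i x (\<Sum>j<r. \<rho> j z v)" by (rule sum[symmetric])
    then have "(\<Sum>j<r. \<rho> i x (\<rho> j z v)) = 0" by (simp only: z lin(2))
    moreover have "(\<Sum>j\<in>{..<r} - {i}. \<rho> i x (\<rho> j z v)) = (\<Sum>j\<in>{..<r} - {i}. \<rho> j z (\<rho> i x v))"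
      by (rule sum.cong) (use commute i in auto)
    ultimately have "\<rho> i x (\<rho> i z v) + (\<Sum>j\<in>{..<r} - {i}. \<rho> j z (\<rho> i x v)) =
        \<rho> i z (\<rho> i x v) + (\<Sum>j\<in>{..<r} - {i}. \<rho> j z (\<rho> i x v))"
      using z[of "\<rho> i x v"] i by (simp add: sum.remove[of "{..<r}" i])
    then have "\<rho> i x (\<rho> i z v) = \<rho> i z (\<rho> i x v)" by (rule add_right_imp_eq)
    then show ?thesis by (simp add: M.bracket_action)
  qed
  show ?thesis
  proof (cases "\<exists>x. br x z \<noteq> 0")
    case True
    then obtain x where x: "br x z \<noteq> 0" by blast
    show ?thesis
      by (rule g.module_faithful_or_trivial[OF \<rho>[OF i] UNIV_I bracket UNIV_I UNIV_I x])
  next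
    case False
    then have "z = 0" using g.central_eq_zero[of z] by simp
    then show ?thesis using linear_onD(3)[OF M.linear_action[of v], of 0 0] by simp
  qed
qed

theorem theorem3p2:
  fixes sg :: "'k::{alg_closed_field,field_char_0} \<Rightarrow> 'g::ab_group_add \<Rightarrow> 'g"
    and br :: "'g \<Rightarrow> 'g \<Rightarrow> 'g" and H :: "'g set"
    and sS :: "'k \<Rightarrow> 's::comm_ring_1 \<Rightarrow> 's"
    and sV :: "'k \<Rightarrow> 'v::ab_group_add \<Rightarrow> 'v"
    and \<phi> :: "(('g \<Rightarrow> 's \<Rightarrow> 'k) \<Rightarrow> 'k) \<Rightarrow> 'v \<Rightarrow> 'v"
    and r :: nat and M :: "nat \<Rightarrow> 's set" and \<psi> :: "(nat \<Rightarrow> 'g) \<Rightarrow> 'v \<Rightarrow> 'v"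
  assumes "simple_lie_algebra sg UNIV br" and "fin_dim sg UNIV"
    and "cartan_subalgebra sg UNIV br H"
    and "finite_type_algebra sS"
    and "simple_lie_module tscale (tensor sg sS) (current_bracket sg br sS) sV UNIV \<phi>"
    and "weight_decomposition sg H sV UNIV (\<lambda>x. \<phi> (tens sg sS x 1))"
    and "\<forall>i<r. maximal_ideal (M i)" and "inj_on M {..<r}"
    and "lie_module (pointwise sg) (direct_power r) (power_bracket br) sV UNIV \<psi>"
    and "\<forall>F \<in> tensor sg sS. \<phi> F = \<psi> (evaluation_map sg sS r M F)"
  shows "\<exists>r' M' (W :: nat \<Rightarrow> 'v set) \<rho>. evaluation_weight_data sg br H r' M' sV W \<rho> \<and>
    module_isomorphic (tensor sg sS) sV UNIV \<phi>
      tscale (mtensor sV r' W) (evaluation_action sg sS r' M' sV W \<rho>)"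
proof -
  interpret g: simple_lie_algebra sg UNIV br by fact
  interpret S: finite_type_algebra sS by fact
  interpret L: current_algebra sg br sS ..
  interpret \<phi>: simple_lie_module tscale "tensor sg sS" "current_bracket sg br sS" sV UNIV \<phi> by fact
  interpret \<psi>: lie_module "pointwise sg" "direct_power r" "power_bracket br" sV UNIV \<psi> by fact
  note sg = g.vector_space_axioms and sS = S.vector_space_axioms
  have H: "g.subspace H" using assms(3) by (simp add: cartan_subalgebra_def lie_subalgebra_def)
  have \<phi>_module: "lie_module tscale (tensor sg sS) (current_bracket sg br sS) sV UNIV \<phi>" ..
  have \<phi>_lin: "\<phi> F (u + v) = \<phi> F u + \<phi> F v" "\<phi> F (sV c u) = sV c (\<phi> F u)" if "F \<in> tensor sg sS" for F u v c
    using linear_onD(2,3)[OF \<phi>.endomorphism[OF that] UNIV_I] by auto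
  have \<phi>_lin': "linear_on tscale (tensor sg sS) sV UNIV (\<lambda>F. \<phi> F v)" for v by (rule \<phi>.linear_action) simp
  have \<psi>_lin: "linear_on (pointwise sg) (direct_power r) sV UNIV (\<lambda>x. \<psi> x v)" for v by (rule \<psi>.linear_action) simp
  have zero_power: "0 \<in> direct_power r" by (simp add: direct_power_def zero_fun_apply)
  have \<psi>0: "\<psi> 0 v = 0" for v
    using linear_onD(3)[OF \<psi>_lin zero_power, of 0 v] by (simp add: pointwise_def zero_fun_def)
  have nontrivial: "\<exists>v::'v. v \<noteq> 0" using \<phi>.nonzero by blast
  let ?b = "\<lambda>x s i. if i < r then sg (residue sS s (M i)) x else 0"
  show ?thesis
  \<comment> \<open>Bilinearity of \<open>?b\<close> expresses linearity of the residues. The case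
    \<open>r = 0\<close> joins the degenerate one, as evaluation data have a positive number of
    factors.\<close>
  proof (cases "0 < r \<and> bilinear_map sg sS (pointwise sg) ?b")
    case True
    define e where "e i x = (\<lambda>j. if j = i then x else 0)" for i :: nat and x :: 'g
    define \<rho> where "\<rho> i x = \<psi> (e i x)" for i x
    have e: "e i x \<in> direct_power r" if "i < r" for i x
      using that by (simp add: e_def direct_power_def)
    have e_lin: "e i (x + y) = e i x + e i y" "e i (sg c x) = pointwise sg c (e i x)" for i x y c
      by (auto simp: e_def pointwise_def fun_eq_iff plus_fun_apply)
    have br0: "br x 0 = 0" "br 0 x = 0" for x
      using L.br_rules(3)[of 0 0 x] L.br_rules(4)[of x 0 0] by simp_all
    have e_br: "power_bracket br (e i x) (e j y) = (if i = j then e i (br x y) else 0)" for i j x y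
      by (auto simp: e_def power_bracket_def fun_eq_iff br0 zero_fun_apply)
    have \<rho>_module: "lie_module sg UNIV br sV UNIV (\<rho> i)" if i: "i < r" for i
    proof unfold_locales
      show "linear_on sV UNIV sV UNIV (\<rho> i x)" for x unfolding \<rho>_def by (rule \<psi>.endomorphism[OF e[OF i]])
      show "linear_on sg UNIV sV UNIV (\<lambda>x. \<rho> i x v)" for v
        unfolding linear_on_def \<rho>_def e_lin by (simp add: linear_onD(2,3)[OF \<psi>_lin] e i)
      show "\<rho> i (br x y) v = \<rho> i x (\<rho> i y v) - \<rho> i y (\<rho> i x v)" for x y v
        using \<psi>.bracket_action[OF e[OF i] e[OF i] UNIV_I, of x y v] by (simp add: \<rho>_def e_br)
    qed simp
    have commute: "\<rho> i x (\<rho> j y v) = \<rho> j y (\<rho> i x v)" if "i < r" "j < r" "i \<noteq> j" for i j x y v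
      using \<psi>.bracket_action[OF e[OF that(1)] e[OF that(2)] UNIV_I, of x y v] that(3)
      by (simp add: \<rho>_def e_br \<psi>0)
    \<comment> \<open>Stated for the first \<open>n\<close> coordinates so that the induction adds
      one summand at a time.\<close>
    have \<psi>_sum: "(\<lambda>i. if i < n then sg (c i) x else 0) \<in> direct_power r \<and>
        \<psi> (\<lambda>i. if i < n then sg (c i) x else 0) v = (\<Sum>i<n. sV (c i) (\<rho> i x v))" if "n \<le> r" for n c x v
      using that
    proof (induction n)
      case 0
      have "(\<lambda>i. if i < 0 then sg (c i) x else 0) = (0 :: nat \<Rightarrow> 'g)" by (simp add: fun_eq_iff zero_fun_apply)
      then show ?case using zero_power \<psi>0 by simp
    next
      case (Suc n)
      let ?f = "\<lambda>n i. if i < n then sg (c i) x else 0"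
      have n: "n < r" "?f n \<in> direct_power r" using Suc by auto
      have f: "?f (Suc n) = ?f n + e n (sg (c n) x)"
        by (auto simp: fun_eq_iff plus_fun_apply e_def less_Suc_eq)
      have "?f (Suc n) \<in> direct_power r" using Suc.prems by (auto simp: direct_power_def)
      moreover have "\<psi> (?f (Suc n)) v = \<psi> (?f n) v + sV (c n) (\<rho> n x v)"
      proof -
        have "\<psi> (?f (Suc n)) v = \<psi> (?f n) v + \<psi> (e n (sg (c n) x)) v"
          unfolding f by (rule linear_onD(2)[OF \<psi>_lin n(2) e[OF n(1)]])
        moreover have "\<psi> (e n (sg (c n) x)) v = sV (c n) (\<rho> n x v)"
          unfolding e_lin(2) \<rho>_def by (rule linear_onD(3)[OF \<psi>_lin e[OF n(1)]])
        ultimately show ?thesis by (rule trans[OF _ arg_cong[of _ _ "(+) _"]])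
      qed
      ultimately show ?case using Suc by simp
    qed
    have \<phi>_tens: "\<phi> (tens sg sS x s) v = (\<Sum>i<r. sV (residue sS s (M i)) (\<rho> i x v))" for x s v
    proof -
      have "evaluation_map sg sS r M (tens sg sS x s) = ?b x s"
        unfolding evaluation_map_def using tensor_universal(2)[OF vector_space_pointwise[OF sg]] True by blast
      then show ?thesis using assms(10) \<psi>_sum[of r "\<lambda>i. residue sS s (M i)" x v] by simp
    qed
    have \<phi>1: "\<phi> (tens sg sS x 1) v = (\<Sum>i<r. \<rho> i x v)" for x v
      using assms(7) by (simp add: \<phi>_tens S.residue_one)
    \<comment> \<open>The bracket of \<open>h \<otimes> 1\<close> and \<open>h' \<otimes> 1\<close>
      acts by zero, since both are diagonal on weight vectors; \<open>factor_acts_trivially\<close>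
      passes from the sum over the factors to each of them.\<close>
    have commute_H: "\<rho> i h (\<rho> i h' v) = \<rho> i h' (\<rho> i h v)" if i: "i < r" and h: "h \<in> H" "h' \<in> H" for i h h' v
    proof -
      have sum_zero: "(\<Sum>i<r. \<rho> i (br h h') v) = 0" for v
      proof -
        have "tens sg sS (br h h') 1 = current_bracket sg br sS (tens sg sS h 1) (tens sg sS h' 1)"
          by (simp add: L.bracket_tens)
        then have "(\<Sum>i<r. \<rho> i (br h h') v) = \<phi> (tens sg sS h 1) (\<phi> (tens sg sS h' 1) v) -
            \<phi> (tens sg sS h' 1) (\<phi> (tens sg sS h 1) v)"
          using \<phi>.bracket_action[of "tens sg sS h 1" "tens sg sS h' 1" v] by (simp add: \<phi>1[symmetric])
        also have "\<dots> = 0"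
          using weight_decomposition_commute[OF \<phi>.V.vector_space_axioms assms(6) _ h] \<phi>.endomorphism by simp
        finally show ?thesis .
      qed
      have "\<rho> i (br h h') v = 0"
        by (rule factor_acts_trivially[of sg br r sV \<rho>, OF assms(1) \<rho>_module commute sum_zero i])
      then show ?thesis using lie_module.bracket_action[OF \<rho>_module[OF i], of h h' v] by simp
    qed
    have "(\<lambda>x v. \<Sum>i<r. \<rho> i x v) = (\<lambda>x. \<phi> (tens sg sS x 1))" by (intro ext \<phi>1[symmetric])
    then have weights: "weight_decomposition sg H sV UNIV (\<lambda>x v. \<Sum>i<r. \<rho> i x v)" using assms(6) by simp
    have "commuting_modules sV sg br H r \<rho>"
    proof (intro commuting_modules.intro commuting_modules_axioms.intro)
      fix U assume U: "\<phi>.V.subspace U" "\<And>i x u. \<lbrakk>i < r; u \<in> U\<rbrakk> \<Longrightarrow> \<rho> i x u \<in> U"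
      \<comment> \<open>By \<open>\<phi>_tens\<close>, a subspace stable under all
        \<open>\<rho> i\<close> is a submodule for \<open>\<phi>\<close>.\<close>
      show "U = {0} \<or> U = UNIV"
      proof (rule \<phi>.submodules_trivial[OF U(1)])
        fix F u assume F: "F \<in> tensor sg sS" and u: "u \<in> U"
        show "\<phi> F u \<in> U" using F
        proof (induction rule: tensor_induct)
          case (tens x s)
          show ?case unfolding \<phi>_tens
            using U u by (intro \<phi>.V.subspace_sum \<phi>.V.subspace_scale) auto
        qed (simp_all add: linear_onD(2,3)[OF \<phi>_lin'] \<phi>.V.subspace_add[OF U(1)] \<phi>.V.subspace_scale[OF U(1)])
      qed simp
    qed (assumption | rule \<phi>.V.vector_space_axioms \<rho>_module commute commute_H nontrivial H weights)+
    from evaluation_weight_module_if_commuting[OF this _ assms(8,7) sg sS \<phi>_module \<phi>_tens] True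
    show ?thesis by blast
  next
    case False
    \<comment> \<open>For \<open>r = 0\<close> the evaluation map is zero; otherwise it is constant,
      so \<open>\<phi> F = \<phi> 0\<close>.\<close>
    have \<phi>0: "\<phi> F v = 0" if F: "F \<in> tensor sg sS" for F v
    proof (cases "r = 0")
      case True
      then have "direct_power r = {0 :: nat \<Rightarrow> 'g}" by (auto simp: direct_power_def fun_eq_iff zero_fun_apply)
      moreover have "evaluation_map sg sS r M F = 0"
        unfolding evaluation_map_def
      proof (rule tensor_universal(3)[OF vector_space_pointwise[OF sg] _ _ _ F])
        show "linear_on tscale (tensor sg sS) (pointwise sg) UNIV (\<lambda>_. 0)"
          by (simp add: linear_on_def pointwise_def fun_eq_iff zero_fun_apply)
        show "bilinear_map sg sS (pointwise sg) ?b"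
          using True by (simp add: bilinear_map_def linear_iff_additive sg sS vector_space_pointwise
              pointwise_def fun_eq_iff plus_fun_apply)
      qed (simp add: True fun_eq_iff zero_fun_apply)
      ultimately show ?thesis using assms(10) F \<psi>0 by simp
    next
      case r: False
      have zero: "0 \<in> tensor sg sS" using \<phi>.subspace_0[OF subspace_tensor] .
      have "\<phi> F v = \<phi> 0 v"
        using evaluation_map_constant[OF sg sS, of r M F 0] False r F zero assms(10) by simp
      also have "\<dots> = 0" using linear_onD(3)[OF \<phi>_lin' zero, of 0 v] by simp
      finally show ?thesis .
    qed
    \<comment> \<open>The evaluation data consist of a single factor at \<open>N\<close>, on which
      the Lie algebra acts by zero.\<close>
    obtain N :: "'s set" where N: "maximal_ideal N" using maximal_ideal_exists by blast
    have zero_module: "lie_module sg UNIV br sV UNIV (\<lambda>_ _. 0)"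
      by unfold_locales (simp_all add: linear_on_def)
    have "\<phi> (tens sg sS x 1) = (\<lambda>v. \<Sum>i<1::nat. 0)" for x by (simp add: fun_eq_iff \<phi>0)
    then have weights: "weight_decomposition sg H sV UNIV (\<lambda>x v. \<Sum>i<1::nat. 0)" using assms(6) by simp
    have "commuting_modules sV sg br H 1 (\<lambda>_ _ _. 0)"
    proof (intro commuting_modules.intro commuting_modules_axioms.intro)
      fix U assume U: "\<phi>.V.subspace U"
      \<comment> \<open>Every subspace is a submodule for the zero action, so simplicity of
        \<open>\<phi>\<close> leaves only the trivial ones.\<close>
      show "U = {0} \<or> U = UNIV"
        by (rule \<phi>.submodules_trivial[OF U]) (simp_all add: \<phi>0 \<phi>.V.subspace_0[OF U])
    qed (rule \<phi>.V.vector_space_axioms zero_module refl nontrivial H weights)+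
    from evaluation_weight_module_if_commuting[OF this _ _ _ sg sS \<phi>_module, of "\<lambda>_. N"] N
    show ?thesis by (simp add: \<phi>0 inj_on_def)
  qed
qed

end
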